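(* Let $J$ be an almost complex structure on $A$ and let $(\square,\sigma^{-1})$, $\square:\Omega^1A\to\Omega^1A\otimes_A\Omega^1A$, be a right bimodule covariant derivative with $(J\otimes\mathrm{id})\square=\square\,J$. Then $\mathcal T\mathrm{Vec}^{*,0}A=\bigoplus_{n\ge0}(\mathrm{Vec}^{1,0}A)^{\otimes_An}$ and $\mathcal T\mathrm{Vec}^{0,*}A=\bigoplus_{n\ge0}(\mathrm{Vec}^{0,1}A)^{\otimes_An}$ are subalgebras of $\mathcal T\mathrm{Vec}A_\bullet$ under the $\bullet$ product.
   Context: $A$ is a unital $*$-algebra over $\mathbb C$ with a differential graded algebra $(\Omega A=\oplus_n\Omega^nA,\mathrm d,\wedge)$, $\Omega^0A=A$, $\mathrm d^2=0$, graded Leibniz rule, generated over $A$ by $\Omega^1A$, with $\Omega^1A=A.\mathrm dA$, such that $a.\mathrm db\mapsto\mathrm db^*.a^*$ is a well defined star operation on $\Omega^1A$ extending to all $\Omega^nA$. $\Omega^1A$ is finitely generated projective as a right $A$-module. An almost complex structure is an $A$-bimodule map $J:\Omega^1A\to\Omega^1A$ with $J(\xi^* )=J(\xi)^*$, $J^2=-\mathrm{id}$, such that $J\otimes\mathrm{id}^{\otimes n-1}+\dots+\mathrm{id}^{\otimes n-1}\otimes J$ descends via $\wedge$ to a well defined map on $\Omega^nA$ for each $n$. $\mathrm{Vec}A=\mathrm{Hom}_A(\Omega^1A,A)$ (right module maps), a bimodule by $(a.v)(\xi)=a\,v(\xi)$, $(v.a)(\xi)=v(a\xi)$; $J(v)=v\circ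 J$; $\mathrm{Vec}^{1,0}A$, $\mathrm{Vec}^{0,1}A$ are the $+\mathrm i$, $-\mathrm i$ eigenspaces of $J$ on $\mathrm{Vec}A$. $\mathrm{Vec}^{\otimes n}A$ is the $n$-fold tensor power over $A$ ($A$ for $n=0$). $\mathrm{ev}$ is evaluation and $\mathrm{coev}(1)=\sum_i\xi_i\otimes u_i\in\Omega^1A\otimes_A\mathrm{Vec}A$ the dual basis. Right bimodule covariant derivative: $\square(\xi a)=\square(\xi)a+\xi\otimes\mathrm da$, $\square(a\xi)=a\square(\xi)+\sigma^{-1}(\mathrm da\otimes\xi)$, $\sigma^{-1}$ a bimodule map on $\Omega^1A\otimes_A\Omega^1A$ (not assumed invertible). The dual $\square:\mathrm{Vec}A\to\Omega^1A\otimes_A\mathrm{Vec}A$ is determined by $\mathrm d\circ\mathrm{ev}=(\mathrm{id}\otimes\mathrm{ev})(\square\otimes\mathrm{id})+(\mathrm{ev}\otimes\mathrm{id})(\mathrm{id}\otimes\square)$, with $\sigma=(\mathrm{ev}\otimes\mathrm{id}\otimes\mathrm{id})(\mathrm{id}\otimes\sigma^{-1}\otimes\mathrm{id})(\mathrm{id}\otimes\mathrm{id}\otimes\mathrm{coev}(1))$; it extends to $\square^{\langle n\rangle}:\mathrm{Vec}^{\otimes n}A\to\Omega^1A\otimes_A\mathrm{Vec}^{\otimes n}A$ by $\square^{\langle0\rangle}=\mathrm d$, $\square^{\langle1\rangle}=\square$, $\square^{\langle n+1\rangle}=\square\otimes\mathrm{id}^{\otimes n}+(\sigma\otimes\mathrm{id}^{\otimes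 n})(\mathrm{id}\otimes\square^{\langle n\rangle})$. $\mathcal T\mathrm{Vec}A_\bullet=\bigoplus_{n\ge0}\mathrm{Vec}^{\otimes n}A$ with the associative unital product $\bullet$ determined by $a\bullet\underline w=a.\underline w$, $u\bullet\underline w=u\otimes\underline w+(\mathrm{ev}\otimes\mathrm{id}^{\otimes m})(u\otimes\square^{\langle m\rangle}\underline w)$ and $(u\otimes\underline v)\bullet\underline w=u\bullet(\underline v\bullet\underline w)-\big((\mathrm{ev}\otimes\mathrm{id}^{\otimes n})(u\otimes\square^{\langle n\rangle}\underline v)\big)\bullet\underline w$, for $a\in A$, $u\in\mathrm{Vec}A$, $\underline v\in\mathrm{Vec}^{\otimes n}A$, $\underline w\in\mathrm{Vec}^{\otimes m}A$. *)

theory Defs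
  imports Complex_Main "HOL-Library.Poly_Mapping" "HOL-Computational_Algebra.Group_Closure"
begin

section \<open>Differential graded star algebras\<close>

text \<open>
  The whole calculus \<open>\<Omega>A\<close> is one type, with wedge product \<open>*\<close> and \<open>Omega n\<close> the forms of degree
  \<open>n\<close>; the algebra \<open>A\<close> itself is \<open>Omega 0\<close>, and the bimodule actions of \<open>A\<close> on forms are instances
  of \<open>*\<close>. The class \<open>ring_1\<close> is avoided because it excludes the zero algebra.

  The star is extended from \<open>\<Omega>\<^sup>1A\<close> to \<open>\<Omega>A\<close> with the usual sign
  \<open>(\<xi> \<and> \<eta>)\<^sup>* = (-1)\<^bsup>|\<xi>||\<eta>|\<^esup> \<eta>\<^sup>* \<and> \<xi>\<^sup>*\<close>. Multiplying the star on \<open>\<Omega>\<^sup>nA\<close> by \<open>(-1)\<^bsup>n(n-1)/2\<^esup>\<close>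
  turns it into an extension without sign, so the choice does not restrict the class of calculi.
\<close>

class star_dga = ring + monoid_mult +
  fixes scaleC :: "complex \<Rightarrow> 'a \<Rightarrow> 'a"  (infixr "*\<^sub>C" 75)
    and Omega :: "nat \<Rightarrow> 'a set"
    and extd :: "'a \<Rightarrow> 'a"
    and star :: "'a \<Rightarrow> 'a"
  assumes scaleC_add_right: "c *\<^sub>C (x + y) = c *\<^sub>C x + c *\<^sub>C y"
    and scaleC_add_left: "(c + c') *\<^sub>C x = c *\<^sub>C x + c' *\<^sub>C x"
    and scaleC_scaleC: "c *\<^sub>C (c' *\<^sub>C x) = (c * c') *\<^sub>C x"
    and scaleC_one: "1 *\<^sub>C x = x"
    and mult_scaleC_left: "(c *\<^sub>C x) * y = c *\<^sub>C (x * y)"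
    and mult_scaleC_right: "x * (c *\<^sub>C y) = c *\<^sub>C (x * y)"
    and Omega_zero: "0 \<in> Omega n"
    and Omega_add: "x \<in> Omega n \<Longrightarrow> y \<in> Omega n \<Longrightarrow> x + y \<in> Omega n"
    and Omega_scaleC: "x \<in> Omega n \<Longrightarrow> c *\<^sub>C x \<in> Omega n"
    and Omega_direct_sum:
      "\<exists>!f. (\<forall>n. f n \<in> Omega n) \<and> finite {n. f n \<noteq> 0} \<and> x = (\<Sum>n | f n \<noteq> 0. f n)"
    and Omega_one: "1 \<in> Omega 0"
    and Omega_mult: "x \<in> Omega m \<Longrightarrow> y \<in> Omega n \<Longrightarrow> x * y \<in> Omega (m + n)"
    and extd_add: "extd (x + y) = extd x + extd y"
    and extd_scaleC: "extd (c *\<^sub>C x) = c *\<^sub>C extd x"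
    and Omega_extd: "x \<in> Omega n \<Longrightarrow> extd x \<in> Omega (Suc n)"
    and extd_extd: "extd (extd x) = 0"
    and extd_mult: "x \<in> Omega m \<Longrightarrow> extd (x * y) = extd x * y + (- 1) ^ m * (x * extd y)"
    and generated: "Omega 0 \<subseteq> B \<Longrightarrow> Omega 1 \<subseteq> B \<Longrightarrow>
        (\<And>x y. x \<in> B \<Longrightarrow> y \<in> B \<Longrightarrow> x + y \<in> B) \<Longrightarrow>
        (\<And>x y. x \<in> B \<Longrightarrow> y \<in> B \<Longrightarrow> x * y \<in> B) \<Longrightarrow> B = UNIV"
    and Omega_1_A_dA: "x \<in> Omega 1 \<Longrightarrow>
        \<exists>k a b. (\<forall>i<k. a i \<in> Omega 0 \<and> b i \<in> Omega 0) \<and> x = (\<Sum>i<(k::nat). a i * extd (b i))"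
    and star_add: "star (x + y) = star x + star y"
    and star_scaleC: "star (c *\<^sub>C x) = cnj c *\<^sub>C star x"
    and star_star: "star (star x) = x"
    and Omega_star: "x \<in> Omega n \<Longrightarrow> star x \<in> Omega n"
    and star_mult: "x \<in> Omega m \<Longrightarrow> y \<in> Omega n \<Longrightarrow> star (x * y) = (- 1) ^ (m * n) * (star y * star x)"
    and star_A_dA: "a \<in> Omega 0 \<Longrightarrow> b \<in> Omega 0 \<Longrightarrow> star (a * extd b) = extd (star b) * star a"


section \<open>Vector fields\<close>

text \<open>
  Elements of \<open>Vec A\<close>, the right module maps from \<open>\<Omega>\<^sup>1A\<close> to \<open>A\<close>, are represented by functions
  that vanish outside \<open>Omega 1\<close>.
\<close>

definition vecA :: "('w::star_dga \<Rightarrow> 'w) set" where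
  "vecA = {v. (\<forall>\<xi>. \<xi> \<notin> Omega 1 \<longrightarrow> v \<xi> = 0) \<and>
              (\<forall>\<xi>\<in>Omega 1. v \<xi> \<in> Omega 0) \<and>
              (\<forall>\<xi>\<in>Omega 1. \<forall>\<eta>\<in>Omega 1. v (\<xi> + \<eta>) = v \<xi> + v \<eta>) \<and>
              (\<forall>\<xi>\<in>Omega 1. \<forall>a\<in>Omega 0. v (\<xi> * a) = v \<xi> * a)}"

definition vec_lact :: "'w::star_dga \<Rightarrow> ('w \<Rightarrow> 'w) \<Rightarrow> 'w \<Rightarrow> 'w" where
  "vec_lact a v = (\<lambda>\<xi>. a * v \<xi>)"

definition vec_ract :: "('w::star_dga \<Rightarrow> 'w) \<Rightarrow> 'w \<Rightarrow> 'w \<Rightarrow> 'w" where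
  "vec_ract v a = (\<lambda>\<xi>. if \<xi> \<in> Omega 1 then v (a * \<xi>) else 0)"

definition dual_basis :: "nat \<Rightarrow> (nat \<Rightarrow> 'w::star_dga) \<Rightarrow> (nat \<Rightarrow> 'w \<Rightarrow> 'w) \<Rightarrow> bool" where
  "dual_basis N e u \<longleftrightarrow> (\<forall>i<N. e i \<in> Omega 1 \<and> u i \<in> vecA) \<and>
     (\<forall>\<xi>\<in>Omega 1. \<xi> = (\<Sum>i<N. e i * u i \<xi>))"


section \<open>Almost complex structures\<close>

definition almost_complex :: "('w::star_dga \<Rightarrow> 'w) \<Rightarrow> bool" where
  "almost_complex J \<longleftrightarrow>
     (\<forall>\<xi>\<in>Omega 1. J \<xi> \<in> Omega 1) \<and>
     (\<forall>\<xi>\<in>Omega 1. \<forall>\<eta>\<in>Omega 1. J (\<xi> + \<eta>) = J \<xi> + J \<eta>) \<and>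
     (\<forall>a\<in>Omega 0. \<forall>\<xi>\<in>Omega 1. J (a * \<xi>) = a * J \<xi> \<and> J (\<xi> * a) = J \<xi> * a) \<and>
     (\<forall>\<xi>\<in>Omega 1. J (star \<xi>) = star (J \<xi>)) \<and>
     (\<forall>\<xi>\<in>Omega 1. J (J \<xi>) = - \<xi>) \<and>
     (\<forall>n\<ge>1. \<exists>Jn. (\<forall>x\<in>Omega n. Jn x \<in> Omega n) \<and>
        (\<forall>x\<in>Omega n. \<forall>y\<in>Omega n. Jn (x + y) = Jn x + Jn y) \<and>
        (\<forall>xs. length xs = n \<and> set xs \<subseteq> Omega 1 \<longrightarrow>
           Jn (prod_list xs) = (\<Sum>i<n. prod_list (xs[i := J (xs ! i)]))))"

definition vecJ :: "('w::star_dga \<Rightarrow> 'w) \<Rightarrow> ('w \<Rightarrow> 'w) \<Rightarrow> 'w \<Rightarrow> 'w" where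
  "vecJ J v = (\<lambda>\<xi>. if \<xi> \<in> Omega 1 then v (J \<xi>) else 0)"

definition vec10 :: "('w::star_dga \<Rightarrow> 'w) \<Rightarrow> ('w \<Rightarrow> 'w) set" where
  "vec10 J = {v \<in> vecA. vecJ J v = (\<lambda>\<xi>. \<i> *\<^sub>C v \<xi>)}"

definition vec01 :: "('w::star_dga \<Rightarrow> 'w) \<Rightarrow> ('w \<Rightarrow> 'w) set" where
  "vec01 J = {v \<in> vecA. vecJ J v = (\<lambda>\<xi>. (- \<i>) *\<^sub>C v \<xi>)}"


section \<open>Tensor products over \<open>A\<close>\<close>

text \<open>
  A tensor product over \<open>A\<close> of \<open>k\<close> bimodules, each of them \<open>A\<close>, \<open>\<Omega>\<^sup>1A\<close> or \<open>Vec A\<close>, is the free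
  abelian group on the words of length \<open>k\<close> with letters in the respective bimodules, modulo
  additivity in every letter and \<open>A\<close>-balancedness between neighbouring letters. The constructors of
  \<open>slot\<close> mark the bimodule a letter is taken from. Since the relations never relate words of
  different kinds, all these tensor products can be realised inside a single quotient group
  \<open>tensor\<close>, as the subgroups generated by the words of a given kind.
\<close>

datatype 'w slot = Scal 'w | Form 'w | Vect "'w \<Rightarrow> 'w"

abbreviation AS :: "'w::star_dga slot set" where "AS \<equiv> Scal ` Omega 0"
abbreviation FS :: "'w::star_dga slot set" where "FS \<equiv> Form ` Omega 1"
abbreviation VS :: "'w::star_dga slot set" where "VS \<equiv> Vect ` vecA"

fun slot_add :: "'w::star_dga slot \<Rightarrow> 'w slot \<Rightarrow> 'w slot" where
  "slot_add (Scal a) (Scal b) = Scal (a + b)"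
| "slot_add (Form \<xi>) (Form \<eta>) = Form (\<xi> + \<eta>)"
| "slot_add (Vect u) (Vect v) = Vect (\<lambda>\<xi>. u \<xi> + v \<xi>)"
| "slot_add _ _ = undefined"

fun slot_lact :: "'w::star_dga \<Rightarrow> 'w slot \<Rightarrow> 'w slot" where
  "slot_lact a (Scal b) = Scal (a * b)"
| "slot_lact a (Form \<xi>) = Form (a * \<xi>)"
| "slot_lact a (Vect v) = Vect (vec_lact a v)"

fun slot_ract :: "'w::star_dga slot \<Rightarrow> 'w \<Rightarrow> 'w slot" where
  "slot_ract (Scal b) a = Scal (b * a)"
| "slot_ract (Form \<xi>) a = Form (\<xi> * a)"
| "slot_ract (Vect v) a = Vect (vec_ract v a)"

definition tensor_rels :: "('w::star_dga slot list \<Rightarrow>\<^sub>0 int) set" where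
  "tensor_rels =
     {frag_of (p @ [slot_add s t] @ q) - frag_of (p @ [s] @ q) - frag_of (p @ [t] @ q) | p q s t M.
        M \<in> {AS, FS, VS} \<and> s \<in> M \<and> t \<in> M} \<union>
     {frag_of (p @ [slot_ract s a, t] @ q) - frag_of (p @ [s, slot_lact a t] @ q) | p q s t a.
        a \<in> Omega 0 \<and> s \<in> AS \<union> FS \<union> VS \<and> t \<in> AS \<union> FS \<union> VS}"

definition tensor_eq :: "('w::star_dga slot list \<Rightarrow>\<^sub>0 int) \<Rightarrow> ('w slot list \<Rightarrow>\<^sub>0 int) \<Rightarrow> bool" where
  "tensor_eq x y \<longleftrightarrow> x - y \<in> group_closure tensor_rels"

lemma equivp_tensor_eq: "equivp tensor_eq"
proof (rule equivpI)
  show "reflp tensor_eq" by (simp add: reflp_def tensor_eq_def)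
  show "symp tensor_eq"
    unfolding symp_def tensor_eq_def by (metis group_closure_minus_iff minus_diff_eq)
  show "transp tensor_eq"
  proof (rule transpI)
    fix x y z :: "'w::star_dga slot list \<Rightarrow>\<^sub>0 int"
    assume "tensor_eq x y" "tensor_eq y z"
    then have "(x - y) + (y - z) \<in> group_closure tensor_rels"
      unfolding tensor_eq_def by (rule group_closure_add)
    then show "tensor_eq x z" by (simp add: tensor_eq_def)
  qed
qed

quotient_type (overloaded) 'w tensor = "'w::star_dga slot list \<Rightarrow>\<^sub>0 int" / tensor_eq
  by (rule equivp_tensor_eq)

instantiation tensor :: (star_dga) ab_group_add
begin

lift_definition zero_tensor :: "'a tensor" is 0 .

lift_definition plus_tensor :: "'a tensor \<Rightarrow> 'a tensor \<Rightarrow> 'a tensor" is plus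
  unfolding tensor_eq_def by (metis add_diff_add group_closure_add)

lift_definition uminus_tensor :: "'a tensor \<Rightarrow> 'a tensor" is uminus
  unfolding tensor_eq_def by (metis group_closure_minus_iff minus_diff_minus)

lift_definition minus_tensor :: "'a tensor \<Rightarrow> 'a tensor \<Rightarrow> 'a tensor" is minus
  unfolding tensor_eq_def by (smt (verit) add_diff_eq diff_add_eq diff_diff_eq2 group_closure.diff diff_right_commute)

instance
  by standard (transfer; simp add: tensor_eq_def algebra_simps)+

end

lift_definition pure :: "'w::star_dga slot list \<Rightarrow> 'w tensor" is frag_of .

text \<open>
  \<open>tspan\<close> of \<open>listset [M\<^sub>1, \<dots>, M\<^sub>k]\<close> is \<open>M\<^sub>1 \<otimes>\<^sub>A \<dots> \<otimes>\<^sub>A M\<^sub>k\<close> for \<open>M\<^sub>i\<close> among \<open>AS\<close>, \<open>FS\<close>, \<open>VS\<close>.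
\<close>

definition tspan :: "'w::star_dga slot list set \<Rightarrow> 'w tensor set" where
  "tspan W = group_closure (pure ` W)"

text \<open>
  \<open>textend W f\<close> is the additive map given on pure tensors by \<open>f\<close> for words in \<open>W\<close>, and by zero for
  all other words. It is meaningful if \<open>f\<close> respects the relations, by \<open>ex1_additive_tensor\<close>.
\<close>

definition textend ::
    "'w::star_dga slot list set \<Rightarrow> ('w slot list \<Rightarrow> 'w tensor) \<Rightarrow> 'w tensor \<Rightarrow> 'w tensor" where
  "textend W f = (THE g. additive g \<and> (\<forall>w. g (pure w) = (if w \<in> W then f w else 0)))"

lemma abs_tensor_eq_0_iff: "abs_tensor x = 0 \<longleftrightarrow> x \<in> group_closure tensor_rels"
  unfolding zero_tensor_def tensor.abs_eq_iff by (simp add: tensor_eq_def)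

lemma ex1_additive_tensor:
  fixes f :: "'w::star_dga slot list \<Rightarrow> 'w tensor"
  assumes add: "\<And>p q s t M. M \<in> {AS, FS, VS} \<Longrightarrow> s \<in> M \<Longrightarrow> t \<in> M \<Longrightarrow>
      f (p @ [slot_add s t] @ q) = f (p @ [s] @ q) + f (p @ [t] @ q)"
    and bal: "\<And>p q s t a. a \<in> Omega 0 \<Longrightarrow> s \<in> AS \<union> FS \<union> VS \<Longrightarrow> t \<in> AS \<union> FS \<union> VS \<Longrightarrow>
      f (p @ [slot_ract s a, t] @ q) = f (p @ [s, slot_lact a t] @ q)"
  shows "\<exists>!g. additive g \<and> (\<forall>w. g (pure w) = f w)"
proof (rule ex_ex1I)
  define F where "F x = abs_tensor (frag_extend (\<lambda>w. rep_tensor (f w)) x)" for x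
  have F_diff: "F (x - y) = F x - F y" for x y
    unfolding F_def by (simp add: frag_extend_diff minus_tensor.abs_eq)
  have F_of: "F (frag_of w) = f w" for w
    unfolding F_def by (simp add: Quotient_abs_rep[OF Quotient_tensor])
  have F_add: "F (x + y) = F x + F y" for x y
    unfolding F_def by (simp add: frag_extend_add plus_tensor.abs_eq)
  have rels: "F r = 0" if "r \<in> tensor_rels" for r
    using that unfolding tensor_rels_def
  proof (rule UnE, goal_cases)
    case 1
    then obtain p q s t M where
      "r = frag_of (p @ [slot_add s t] @ q) - frag_of (p @ [s] @ q) - frag_of (p @ [t] @ q)"
      and "M \<in> {AS, FS, VS}" "s \<in> M" "t \<in> M" by blast
    then show ?case by (simp only: F_diff F_of add) simp
  next
    case 2
    then obtain p q s t a where
      "r = frag_of (p @ [slot_ract s a, t] @ q) - frag_of (p @ [s, slot_lact a t] @ q)"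
      and "a \<in> Omega 0" "s \<in> AS \<union> FS \<union> VS" "t \<in> AS \<union> FS \<union> VS" by blast
    then show ?case by (simp only: F_diff F_of bal diff_self)
  qed
  have F0: "F 0 = 0" using F_diff[of 0 0] by simp
  have cl: "F r = 0" if "r \<in> group_closure tensor_rels" for r
    using that by induction (auto simp: rels F0 F_diff)
  define g where "g t = F (rep_tensor t)" for t
  have g: "g (abs_tensor x) = F x" for x
  proof -
    have "tensor_eq (rep_tensor (abs_tensor x)) x"
      using Quotient_rep_abs[OF Quotient_tensor] equivp_reflp[OF equivp_tensor_eq] by blast
    then have "F (rep_tensor (abs_tensor x) - x) = 0"
      by (intro cl) (simp add: tensor_eq_def)
    then show ?thesis by (simp add: g_def F_diff)
  qed
  have "g (s + t) = g s + g t" for s t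
    by (induct s rule: tensor.abs_induct, induct t rule: tensor.abs_induct)
       (simp add: plus_tensor.abs_eq g F_add)
  then show "\<exists>g. additive g \<and> (\<forall>w. g (pure w) = f w)"
    by (intro exI[of _ g]) (simp add: additive_def pure.abs_eq g F_of)
next
  fix g h :: "'w tensor \<Rightarrow> 'w tensor"
  assume g: "additive g \<and> (\<forall>w. g (pure w) = f w)" and h: "additive h \<and> (\<forall>w. h (pure w) = f w)"
  have "g (abs_tensor x) = h (abs_tensor x)" for x
    using subset_UNIV
  proof (induction x rule: frag_induction)
    case zero
    then show ?case using additive.zero[of g] additive.zero[of h] g h by (simp add: zero_tensor_def)
  next
    case (one w)
    then show ?case using g h by (simp add: pure.abs_eq[symmetric])
  next
    case (diff a b)
    then show ?case using g h by (simp add: minus_tensor.abs_eq[symmetric] additive.diff)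
  qed
  then have "g t = h t" for t
    by (induct t rule: tensor.abs_induct) simp
  then show "g = h" by (rule ext)
qed


subsection \<open>Canonical maps\<close>

definition tens :: "'w::star_dga tensor \<Rightarrow> 'w tensor \<Rightarrow> 'w tensor"  (infixr "\<otimes>" 70) where
  "x \<otimes> y = textend UNIV (\<lambda>p. textend UNIV (\<lambda>q. pure (p @ q)) y) x"

text \<open>\<open>a \<otimes> []\<close> is read as \<open>a\<close> itself, so that \<open>contract\<close> below sends \<open>\<Omega>\<^sup>1A\<close> (nothing left after
  the form) to \<open>A\<close>.\<close>

fun word_lact :: "'w::star_dga \<Rightarrow> 'w slot list \<Rightarrow> 'w slot list" where
  "word_lact a [] = [Scal a]"
| "word_lact a (s # ws) = slot_lact a s # ws"

definition tlact :: "'w::star_dga \<Rightarrow> 'w tensor \<Rightarrow> 'w tensor" where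
  "tlact a = textend UNIV (\<lambda>ws. pure (word_lact a ws))"

definition tract :: "'w::star_dga tensor \<Rightarrow> 'w \<Rightarrow> 'w tensor" where
  "tract x a = textend UNIV (\<lambda>ws. if ws = [] then pure [Scal a]
                                   else pure (butlast ws @ [slot_ract (last ws) a])) x"

definition form_words :: "'w::star_dga slot list set" where
  "form_words = {Form \<xi> # ws | \<xi> ws. \<xi> \<in> Omega 1 \<and> set ws \<subseteq> AS \<union> FS \<union> VS}"

text \<open>\<open>contract v x = (ev \<otimes> id)(v \<otimes> x)\<close> for \<open>x\<close> in \<open>\<Omega>\<^sup>1A \<otimes>\<^sub>A N\<close>.\<close>

definition contract :: "('w::star_dga \<Rightarrow> 'w) \<Rightarrow> 'w tensor \<Rightarrow> 'w tensor" where
  "contract v = textend form_words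
     (\<lambda>ws. case ws of Form \<xi> # zs \<Rightarrow> pure (word_lact (v \<xi>) zs) | _ \<Rightarrow> 0)"

text \<open>\<open>pairing x \<xi> = (id \<otimes> ev)(x \<otimes> \<xi>)\<close> for \<open>x\<close> in \<open>\<Omega>\<^sup>1A \<otimes>\<^sub>A Vec A\<close>.\<close>

definition pairing :: "'w::star_dga tensor \<Rightarrow> 'w \<Rightarrow> 'w tensor" where
  "pairing x \<xi> = textend (listset [FS, VS])
     (\<lambda>ws. case ws of [Form \<eta>, Vect v] \<Rightarrow> pure [Form (\<eta> * v \<xi>)] | _ \<Rightarrow> 0) x"

text \<open>\<open>J \<otimes> id\<close> on \<open>\<Omega>\<^sup>1A \<otimes>\<^sub>A \<Omega>\<^sup>1A\<close>.\<close>

definition J_id :: "('w::star_dga \<Rightarrow> 'w) \<Rightarrow> 'w tensor \<Rightarrow> 'w tensor" where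
  "J_id J = textend (listset [FS, FS])
     (\<lambda>ws. case ws of [Form \<xi>, Form \<eta>] \<Rightarrow> pure [Form (J \<xi>), Form \<eta>] | _ \<Rightarrow> 0)"


section \<open>Bimodule covariant derivatives\<close>

text \<open>\<open>\<complex>\<close>-linearity follows from additivity and the Leibniz rule, as \<open>d\<close> vanishes on \<open>\<complex>1\<close>.\<close>

definition right_bimod_connection ::
    "('w::star_dga \<Rightarrow> 'w tensor) \<Rightarrow> ('w tensor \<Rightarrow> 'w tensor) \<Rightarrow> bool" where
  "right_bimod_connection D \<sigma>inv \<longleftrightarrow>
     (\<forall>x\<in>tspan (listset [FS, FS]). \<sigma>inv x \<in> tspan (listset [FS, FS])) \<and>
     (\<forall>x\<in>tspan (listset [FS, FS]). \<forall>y\<in>tspan (listset [FS, FS]). \<sigma>inv (x + y) = \<sigma>inv x + \<sigma>inv y) \<and>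
     (\<forall>x\<in>tspan (listset [FS, FS]). \<forall>a\<in>Omega 0.
        \<sigma>inv (tlact a x) = tlact a (\<sigma>inv x) \<and> \<sigma>inv (tract x a) = tract (\<sigma>inv x) a) \<and>
     (\<forall>\<xi>\<in>Omega 1. D \<xi> \<in> tspan (listset [FS, FS])) \<and>
     (\<forall>\<xi>\<in>Omega 1. \<forall>\<eta>\<in>Omega 1. D (\<xi> + \<eta>) = D \<xi> + D \<eta>) \<and>
     (\<forall>\<xi>\<in>Omega 1. \<forall>a\<in>Omega 0. D (\<xi> * a) = tract (D \<xi>) a + pure [Form \<xi>, Form (extd a)]) \<and>
     (\<forall>\<xi>\<in>Omega 1. \<forall>a\<in>Omega 0. D (a * \<xi>) = tlact a (D \<xi>) + \<sigma>inv (pure [Form (extd a), Form \<xi>]))"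

text \<open>The dual connection on \<open>Vec A\<close>: the element \<open>\<square>v\<close> with
  \<open>d(ev(v \<otimes> \<xi>)) = (id \<otimes> ev)(\<square>v \<otimes> \<xi>) + (ev \<otimes> id)(v \<otimes> \<square>\<xi>)\<close>.\<close>

definition dual_connection :: "('w::star_dga \<Rightarrow> 'w tensor) \<Rightarrow> ('w \<Rightarrow> 'w) \<Rightarrow> 'w tensor" where
  "dual_connection D v = (THE t. t \<in> tspan (listset [FS, VS]) \<and>
     (\<forall>\<xi>\<in>Omega 1. pure [Form (extd (v \<xi>))] = pairing t \<xi> + contract v (D \<xi>)))"

text \<open>\<open>\<sigma>(v \<otimes> \<eta>)\<close>, with \<open>coev(1) = \<Sum>\<^sub>i e\<^sub>i \<otimes> u\<^sub>i\<close>.\<close>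

definition sigma :: "('w::star_dga tensor \<Rightarrow> 'w tensor) \<Rightarrow> nat \<Rightarrow> (nat \<Rightarrow> 'w) \<Rightarrow> (nat \<Rightarrow> 'w \<Rightarrow> 'w) \<Rightarrow>
    ('w \<Rightarrow> 'w) \<Rightarrow> 'w \<Rightarrow> 'w tensor" where
  "sigma \<sigma>inv N e u v \<eta> =
     (\<Sum>i<N. contract v (\<sigma>inv (pure [Form \<eta>, Form (e i)])) \<otimes> pure [Vect (u i)])"

text \<open>\<open>sigma_id \<sigma> v x = (\<sigma> \<otimes> id)(v \<otimes> x)\<close> for \<open>x\<close> in \<open>\<Omega>\<^sup>1A \<otimes>\<^sub>A N\<close>.\<close>

definition sigma_id ::
    "(('w::star_dga \<Rightarrow> 'w) \<Rightarrow> 'w \<Rightarrow> 'w tensor) \<Rightarrow> ('w \<Rightarrow> 'w) \<Rightarrow> 'w tensor \<Rightarrow> 'w tensor" where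
  "sigma_id \<sigma> v = textend form_words
     (\<lambda>ws. case ws of Form \<eta> # zs \<Rightarrow> \<sigma> v \<eta> \<otimes> pure zs | _ \<Rightarrow> 0)"


section \<open>Tensor powers of vector fields and the bullet product\<close>

definition vwords :: "('w::star_dga \<Rightarrow> 'w) set \<Rightarrow> nat \<Rightarrow> 'w slot list set" where
  "vwords V n = (if n = 0 then listset [AS] else listset (replicate n (Vect ` V)))"

text \<open>
  \<open>vpow vecA n\<close> is the \<open>n\<close>-th tensor power of \<open>Vec A\<close>. For a direct summand \<open>V\<close> of the bimodule
  \<open>Vec A\<close>, such as \<open>Vec\<^sup>1\<^sup>,\<^sup>0A\<close> or \<open>Vec\<^sup>0\<^sup>,\<^sup>1A\<close>, the \<open>n\<close>-th tensor power of \<open>V\<close> embeds into that of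
  \<open>Vec A\<close>, and \<open>vpow V n\<close> is its image.
\<close>

definition vpow :: "('w::star_dga \<Rightarrow> 'w) set \<Rightarrow> nat \<Rightarrow> 'w tensor set" where
  "vpow V n = tspan (vwords V n)"

definition tensor_alg :: "('w::star_dga \<Rightarrow> 'w) set \<Rightarrow> 'w tensor set" where
  "tensor_alg V = {\<Sum>n<k. x n | (k::nat) x. \<forall>n<k. x n \<in> vpow V n}"

fun vdeg :: "'w slot list \<Rightarrow> nat" where
  "vdeg [Scal a] = 0"
| "vdeg ws = length ws"

text \<open>\<open>box_pow \<square> \<sigma> n\<close> is \<open>\<square>\<^bsup>\<langle>n\<rangle>\<^esup> : Vec\<^bsup>\<otimes>n\<^esup>A \<rightarrow> \<Omega>\<^sup>1A \<otimes>\<^sub>A Vec\<^bsup>\<otimes>n\<^esup>A\<close>, where \<open>\<Omega>\<^sup>1A \<otimes>\<^sub>A A\<close> is identified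
  with \<open>\<Omega>\<^sup>1A\<close>. The two summands of the recursion are not separately balanced over \<open>A\<close>; only their
  sum is.\<close>

primrec box_pow :: "(('w::star_dga \<Rightarrow> 'w) \<Rightarrow> 'w tensor) \<Rightarrow> (('w \<Rightarrow> 'w) \<Rightarrow> 'w \<Rightarrow> 'w tensor) \<Rightarrow>
    nat \<Rightarrow> 'w tensor \<Rightarrow> 'w tensor" where
  "box_pow D \<sigma> 0 = textend (vwords vecA 0)
     (\<lambda>ws. case ws of [Scal a] \<Rightarrow> pure [Form (extd a)] | _ \<Rightarrow> 0)"
| "box_pow D \<sigma> (Suc n) = textend (vwords vecA (Suc n))
     (\<lambda>ws. case ws of
         Vect v # zs \<Rightarrow>
           if n = 0 then D v
           else D v \<otimes> pure zs + sigma_id \<sigma> v (box_pow D \<sigma> n (pure zs))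
       | _ \<Rightarrow> 0)"

text \<open>\<open>u \<otimes> w\<close>, with \<open>Vec A \<otimes>\<^sub>A A\<close> identified with \<open>Vec A\<close>.\<close>

definition vcons :: "('w::star_dga \<Rightarrow> 'w) \<Rightarrow> 'w slot list \<Rightarrow> 'w slot list" where
  "vcons u ws = (case ws of [Scal a] \<Rightarrow> [Vect (vec_ract u a)] | _ \<Rightarrow> Vect u # ws)"

text \<open>In the following, \<open>B n\<close> is \<open>\<square>\<^bsup>\<langle>n\<rangle>\<^esup>\<close>. First \<open>u \<bullet> y\<close> for \<open>u\<close> in \<open>Vec A\<close>, then \<open>x \<bullet> y\<close> for \<open>x\<close> in
  \<open>Vec\<^bsup>\<otimes>n\<^esup>A\<close>, then the general case.\<close>

definition vec_bullet ::
    "(nat \<Rightarrow> 'w::star_dga tensor \<Rightarrow> 'w tensor) \<Rightarrow> ('w \<Rightarrow> 'w) \<Rightarrow> 'w tensor \<Rightarrow> 'w tensor" where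
  "vec_bullet B u = textend (\<Union>m. vwords vecA m)
     (\<lambda>ws. pure (vcons u ws) + contract u (B (vdeg ws) (pure ws)))"

primrec pow_bullet ::
    "(nat \<Rightarrow> 'w::star_dga tensor \<Rightarrow> 'w tensor) \<Rightarrow> nat \<Rightarrow> 'w tensor \<Rightarrow> 'w tensor \<Rightarrow> 'w tensor" where
  "pow_bullet B 0 x y = textend (vwords vecA 0)
     (\<lambda>ws. case ws of [Scal a] \<Rightarrow> tlact a y | _ \<Rightarrow> 0) x"
| "pow_bullet B (Suc n) x y = textend (vwords vecA (Suc n))
     (\<lambda>ws. case ws of
         Vect u # vs \<Rightarrow>
           if n = 0 then vec_bullet B u y
           else vec_bullet B u (pow_bullet B n (pure vs) y)
                - pow_bullet B n (contract u (B n (pure vs))) y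
       | _ \<Rightarrow> 0) x"

definition bullet :: "(nat \<Rightarrow> 'w::star_dga tensor \<Rightarrow> 'w tensor) \<Rightarrow> 'w tensor \<Rightarrow> 'w tensor \<Rightarrow> 'w tensor" where
  "bullet B x y = textend (\<Union>n. vwords vecA n) (\<lambda>ws. pow_bullet B (vdeg ws) (pure ws) y) x"

text \<open>Unital complex subalgebras of \<open>tensor_alg vecA\<close>; the scalar \<open>c\<close> acts as \<open>c1 \<in> A\<close>.\<close>

definition is_subalgebra ::
    "('w::star_dga tensor \<Rightarrow> 'w tensor \<Rightarrow> 'w tensor) \<Rightarrow> 'w tensor set \<Rightarrow> bool" where
  "is_subalgebra m S \<longleftrightarrow> S \<subseteq> tensor_alg vecA \<and> pure [Scal 1] \<in> S \<and>
     (\<forall>x\<in>S. \<forall>y\<in>S. x + y \<in> S) \<and>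
     (\<forall>c. \<forall>x\<in>S. tlact (c *\<^sub>C 1) x \<in> S) \<and>
     (\<forall>x\<in>S. \<forall>y\<in>S. m x y \<in> S)"

end

theory Submission
  imports Defs
begin

text \<open>
  The dual basis identifies \<open>\<Omega>\<^sup>1A \<otimes>\<^sub>A Vec A\<close> with the right module maps \<open>\<phi> : \<Omega>\<^sup>1A \<rightarrow> \<Omega>\<^sup>1A\<close>, and \<open>\<phi>\<close> lies in
  \<open>\<Omega>\<^sup>1A \<otimes>\<^sub>A V\<close>, for \<open>V\<close> the \<open>c\<close>-eigenspace of \<open>J\<close> with \<open>c\<^sup>2 = -1\<close>, as soon as \<open>\<phi>\<close> vanishes on all
  \<open>\<xi> + c J\<xi>\<close>. For \<open>v \<in> V\<close> the map of \<open>\<box>v\<close> is \<open>\<xi> \<mapsto> d(v(\<xi>)) - (ev \<otimes> id)(v \<otimes> \<box>\<xi>)\<close> and that of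
  \<open>\<sigma>(v \<otimes> \<eta>)\<close> is \<open>\<xi> \<mapsto> (ev \<otimes> id)(v \<otimes> \<sigma>\<^sup>-\<^sup>1(\<eta> \<otimes> \<xi>))\<close>. The first vanishes on \<open>\<xi> + c J\<xi>\<close> because
  \<open>(J \<otimes> id)\<box> = \<box>J\<close>; so does the second, because \<open>\<sigma>\<^sup>-\<^sup>1(db \<otimes> \<xi>) = \<box>(b\<xi>) - b\<box>\<xi>\<close> and
  \<open>\<Omega>\<^sup>1A = A.dA\<close>. Hence \<open>\<box>\<^bsup>\<langle>n\<rangle>\<^esup>\<close> maps \<open>V\<^bsup>\<otimes>n\<^esup>\<close> into \<open>\<Omega>\<^sup>1A \<otimes>\<^sub>A V\<^bsup>\<otimes>n\<^esup>\<close>, and the recursion for the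
  product never leaves \<open>V\<close>.
\<close>

text \<open>What shapes the proof is well-definedness. Every map on tensors is a
  \<open>textend\<close>, a definite description whose values are unknown until its word function is
  shown additive in each letter and balanced over A. In the recursions for \<open>box_pow\<close>
  and \<open>pow_bullet\<close> the summands are not balanced one by one: moving a scalar a across
  the first two letters leaves a term \<sigma>(v \<otimes> da), respectively v(da), that cancels
  only against the Leibniz rule one degree lower. Each induction on the degree therefore carries
  well-definedness, the behaviour under left multiplication and closure together. Closure is stated
  for all stable V at once, with Vec A among them, since the case of Vec A supplies the domains on
  which the maps can be computed. The second obstacle is that a tensor power of V is a span inside
  that of Vec A, so membership needs a representative with letters in V. Applying the projection (1
  - cJ)/2 to the vector fields of the dual basis provides one.\<close>

declare One_nat_def [simp del]

section \<open>Maps out of tensor products\<close>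

definition kinds :: "'w::star_dga slot set set" where "kinds = {AS, FS, VS}"

definition slots :: "'w::star_dga slot set" where "slots = AS \<union> FS \<union> VS"

lemma kinds [simp]: "AS \<in> kinds" "FS \<in> kinds" "VS \<in> kinds"
  by (simp_all add: kinds_def)

lemma slotsE:
  assumes "s \<in> slots"
  obtains M where "M \<in> kinds" "s \<in> M"
  using assms by (auto simp: slots_def kinds_def)

lemma slotsI: "M \<in> kinds \<Longrightarrow> s \<in> M \<Longrightarrow> s \<in> slots"
  unfolding slots_def kinds_def by (elim insertE emptyE) simp_all

text \<open>The relations exchange letters only within one of the three bimodules. The equality
  makes the relation reflexive also on letters outside all of them, such as
  \<open>Form \<xi>\<close> with \<open>\<xi>\<close> not in \<open>Omega 1\<close>, which still
  occur in words of \<open>tensor\<close>.\<close>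

definition same_kind :: "'w::star_dga slot \<Rightarrow> 'w slot \<Rightarrow> bool" where
  "same_kind s t \<longleftrightarrow> s = t \<or> (\<exists>M\<in>kinds. s \<in> M \<and> t \<in> M)"

lemma same_kind_refl: "same_kind s s"
  by (simp add: same_kind_def)

lemma same_kindI: "M \<in> kinds \<Longrightarrow> s \<in> M \<Longrightarrow> t \<in> M \<Longrightarrow> same_kind s t"
  unfolding same_kind_def by (rule disjI2, rule bexI[of _ M]) simp_all

lemma same_kind_sym: "same_kind s t \<Longrightarrow> same_kind t s"
  unfolding same_kind_def by (elim disjE bexE conjE; intro disjI1 disjI2 bexI conjI; simp)

text \<open>All words of a defining relation then lie in \<open>W\<close> or none does, so extension
  by zero outside \<open>W\<close> is compatible with the relations.\<close>

definition saturated :: "'w::star_dga slot list set \<Rightarrow> bool" where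
  "saturated W \<longleftrightarrow> (\<forall>w w'. w \<in> W \<longrightarrow> list_all2 same_kind w w' \<longrightarrow> w' \<in> W)"

text \<open>The hypotheses of \<open>ex1_additive_tensor\<close>, required only on a set of words that the relations
  cannot leave; then \<open>textend W f\<close> is meaningful.\<close>

definition tensorial :: "'w::star_dga slot list set \<Rightarrow> ('w slot list \<Rightarrow> 'w tensor) \<Rightarrow> bool" where
  "tensorial W f \<longleftrightarrow> saturated W \<and>
     (\<forall>p q s t. \<forall>M\<in>kinds. s \<in> M \<longrightarrow> t \<in> M \<longrightarrow> p @ [s] @ q \<in> W \<longrightarrow>
        f (p @ [slot_add s t] @ q) = f (p @ [s] @ q) + f (p @ [t] @ q)) \<and>
     (\<forall>p q s t. \<forall>a\<in>Omega 0. s \<in> slots \<longrightarrow> t \<in> slots \<longrightarrow> p @ [s, t] @ q \<in> W \<longrightarrow>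
        f (p @ [slot_ract s a, t] @ q) = f (p @ [s, slot_lact a t] @ q))"

lemma tensorialI:
  assumes "saturated W"
    and "\<And>p q s t M. M \<in> kinds \<Longrightarrow> s \<in> M \<Longrightarrow> t \<in> M \<Longrightarrow> p @ [s] @ q \<in> W \<Longrightarrow>
        f (p @ [slot_add s t] @ q) = f (p @ [s] @ q) + f (p @ [t] @ q)"
    and "\<And>p q s t a. a \<in> Omega 0 \<Longrightarrow> s \<in> slots \<Longrightarrow> t \<in> slots \<Longrightarrow> p @ [s, t] @ q \<in> W \<Longrightarrow>
        f (p @ [slot_ract s a, t] @ q) = f (p @ [s, slot_lact a t] @ q)"
  shows "tensorial W f"
  unfolding tensorial_def by (intro conjI allI ballI impI assms; assumption)

lemma tensorial_saturated: "tensorial W f \<Longrightarrow> saturated W"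
  by (simp add: tensorial_def)

lemma tensorial_add:
  assumes "tensorial W f" "M \<in> kinds" "s \<in> M" "t \<in> M" "p @ [s] @ q \<in> W"
  shows "f (p @ [slot_add s t] @ q) = f (p @ [s] @ q) + f (p @ [t] @ q)"
  using assms(1)[unfolded tensorial_def, THEN conjunct2, THEN conjunct1, rule_format, OF assms(2-5)] .

lemma tensorial_bal:
  assumes "tensorial W f" "a \<in> Omega 0" "s \<in> slots" "t \<in> slots" "p @ [s, t] @ q \<in> W"
  shows "f (p @ [slot_ract s a, t] @ q) = f (p @ [s, slot_lact a t] @ q)"
  using assms(1)[unfolded tensorial_def, THEN conjunct2, THEN conjunct2, rule_format, OF assms(2-5)] .

section \<open>Vector fields and the bimodule actions on letters\<close>

lemma Omega_0_mult: "a \<in> Omega 0 \<Longrightarrow> x \<in> Omega n \<Longrightarrow> a * x \<in> Omega n"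
  using Omega_mult[of a 0 x n] by simp

lemma Omega_mult_0: "x \<in> Omega n \<Longrightarrow> a \<in> Omega 0 \<Longrightarrow> x * a \<in> Omega n"
  using Omega_mult[of x n a 0] by simp

text \<open>Values outside \<open>Omega 1\<close> are zero and hence also in \<open>Omega 0\<close>;
  this is why the second fact holds for every argument.\<close>

lemma vecAD:
  assumes "v \<in> vecA"
  shows "\<xi> \<notin> Omega 1 \<Longrightarrow> v \<xi> = 0"
    and "v \<xi> \<in> Omega 0"
    and "\<xi> \<in> Omega 1 \<Longrightarrow> \<eta> \<in> Omega 1 \<Longrightarrow> v (\<xi> + \<eta>) = v \<xi> + v \<eta>"
    and "\<xi> \<in> Omega 1 \<Longrightarrow> a \<in> Omega 0 \<Longrightarrow> v (\<xi> * a) = v \<xi> * a"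
proof -
  show "\<xi> \<notin> Omega 1 \<Longrightarrow> v \<xi> = 0" using assms by (simp add: vecA_def)
  then show "v \<xi> \<in> Omega 0" using assms Omega_zero[of 0] by (cases "\<xi> \<in> Omega 1") (auto simp: vecA_def)
qed (use assms in \<open>auto simp: vecA_def\<close>)

lemma vecAI:
  assumes "\<And>\<xi>. \<xi> \<notin> Omega 1 \<Longrightarrow> v \<xi> = 0"
    and "\<And>\<xi>. \<xi> \<in> Omega 1 \<Longrightarrow> v \<xi> \<in> Omega 0"
    and "\<And>\<xi> \<eta>. \<xi> \<in> Omega 1 \<Longrightarrow> \<eta> \<in> Omega 1 \<Longrightarrow> v (\<xi> + \<eta>) = v \<xi> + v \<eta>"
    and "\<And>\<xi> a. \<xi> \<in> Omega 1 \<Longrightarrow> a \<in> Omega 0 \<Longrightarrow> v (\<xi> * a) = v \<xi> * a"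
  shows "v \<in> vecA"
  using assms unfolding vecA_def by blast

lemma vecA_lact:
  assumes "a \<in> Omega 0" "v \<in> vecA"
  shows "vec_lact a v \<in> vecA"
  by (rule vecAI)
     (auto simp: vec_lact_def vecAD[OF assms(2)] Omega_0_mult assms(1) distrib_left mult.assoc)

lemma vecA_ract:
  assumes "a \<in> Omega 0" "v \<in> vecA"
  shows "vec_ract v a \<in> vecA"
proof (rule vecAI)
  fix \<xi> b :: 'a assume "\<xi> \<in> Omega 1" "b \<in> Omega 0"
  then show "vec_ract v a (\<xi> * b) = vec_ract v a \<xi> * b"
    using assms(1) vecAD(4)[OF assms(2), of "a * \<xi>" b]
    by (simp add: vec_ract_def Omega_mult_0 Omega_0_mult mult.assoc)
qed (auto simp: vec_ract_def vecAD[OF assms(2)] assms(1) Omega_0_mult Omega_add distrib_left)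

lemma vecA_add:
  assumes "v \<in> vecA" "w \<in> vecA"
  shows "(\<lambda>\<xi>. v \<xi> + w \<xi>) \<in> vecA"
  by (rule vecAI) (auto simp: vecAD[OF assms(1)] vecAD[OF assms(2)] Omega_add distrib_right)

lemma slot_add_closed: "M \<in> kinds \<Longrightarrow> s \<in> M \<Longrightarrow> t \<in> M \<Longrightarrow> slot_add s t \<in> M"
  unfolding kinds_def by (auto simp: Omega_add vecA_add)

lemma slot_lact_closed: "a \<in> Omega 0 \<Longrightarrow> M \<in> kinds \<Longrightarrow> s \<in> M \<Longrightarrow> slot_lact a s \<in> M"
  unfolding kinds_def by (auto simp: vecA_lact Omega_0_mult)

lemma slot_ract_closed: "a \<in> Omega 0 \<Longrightarrow> M \<in> kinds \<Longrightarrow> s \<in> M \<Longrightarrow> slot_ract s a \<in> M"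
  unfolding kinds_def by (auto simp: vecA_ract Omega_mult_0)

lemma slot_lact_slots: "a \<in> Omega 0 \<Longrightarrow> s \<in> slots \<Longrightarrow> slot_lact a s \<in> slots"
  by (erule slotsE, rule slotsI, assumption, rule slot_lact_closed)

lemma slot_ract_slots: "a \<in> Omega 0 \<Longrightarrow> s \<in> slots \<Longrightarrow> slot_ract s a \<in> slots"
  by (erule slotsE, rule slotsI, assumption, rule slot_ract_closed)

lemma slot_lact_add:
  "M \<in> kinds \<Longrightarrow> s \<in> M \<Longrightarrow> t \<in> M \<Longrightarrow> slot_lact a (slot_add s t) = slot_add (slot_lact a s) (slot_lact a t)"
  unfolding kinds_def by (auto simp: distrib_left vec_lact_def)

lemma slot_ract_add:
  "M \<in> kinds \<Longrightarrow> s \<in> M \<Longrightarrow> t \<in> M \<Longrightarrow> slot_ract (slot_add s t) a = slot_add (slot_ract s a) (slot_ract t a)"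
  unfolding kinds_def by (auto simp: distrib_right vec_ract_def fun_eq_iff)

lemma slot_lact_ract: "slot_lact a (slot_ract s b) = slot_ract (slot_lact a s) b"
  by (cases s) (auto simp: mult.assoc vec_ract_def vec_lact_def fun_eq_iff)

lemma slot_lact_lact: "slot_lact a (slot_lact b s) = slot_lact (a * b) s"
  by (cases s) (auto simp: mult.assoc vec_lact_def)

lemma slot_ract_ract:
  "a \<in> Omega 0 \<Longrightarrow> b \<in> Omega 0 \<Longrightarrow> slot_ract (slot_ract s a) b = slot_ract s (a * b)"
  by (cases s) (auto simp: mult.assoc vec_ract_def fun_eq_iff Omega_0_mult)

section \<open>Sets of words that the relations cannot leave\<close>

lemma saturated_same_kind:
  "saturated W \<Longrightarrow> list_all2 same_kind w w' \<Longrightarrow> w \<in> W \<longleftrightarrow> w' \<in> W"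
proof -
  assume W: "saturated W" and w: "list_all2 same_kind w w'"
  have "symp (list_all2 (same_kind :: 'a slot \<Rightarrow> _))"
    by (rule list.rel_symp) (auto simp: symp_def same_kind_sym)
  then have "list_all2 same_kind w' w"
    using w by (rule sympD)
  then show ?thesis using W w unfolding saturated_def by blast
qed

lemma saturated_UNIV: "saturated UNIV"
  by (simp add: saturated_def)

lemma saturated_UN: "(\<And>i. i \<in> I \<Longrightarrow> saturated (W i)) \<Longrightarrow> saturated (\<Union>i\<in>I. W i)"
  unfolding saturated_def by blast

lemma saturated_Nil: "saturated {[]}"
  by (simp add: saturated_def)

text \<open>The three kinds are images under different constructors and so pairwise
  disjoint.\<close>

lemma same_kind_iff:
  "M \<in> kinds \<Longrightarrow> same_kind s t \<Longrightarrow> s \<in> M \<longleftrightarrow> t \<in> M"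
  unfolding same_kind_def kinds_def by (elim insertE emptyE) auto

lemma saturated_set_Cons:
  assumes "M \<in> kinds" "saturated Z"
  shows "saturated (set_Cons M Z)"
  unfolding saturated_def
proof (intro allI impI)
  fix w w' assume "w \<in> set_Cons M Z" and w': "list_all2 same_kind w w'"
  then obtain s z where w: "w = s # z" "s \<in> M" "z \<in> Z" by (auto simp: set_Cons_def)
  with w' obtain s' z' where "w' = s' # z'" "same_kind s s'" "list_all2 same_kind z z'"
    by (auto simp: list_all2_Cons1)
  then show "w' \<in> set_Cons M Z"
    using w assms same_kind_iff[of M s s'] by (auto simp: set_Cons_def saturated_def)
qed

lemma saturated_lists_slots: "saturated (lists slots)"
  unfolding saturated_def
proof (intro allI impI)
  fix w w' :: "'a slot list" assume "w \<in> lists slots" and w': "list_all2 same_kind w w'"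
  have "s \<in> slots \<Longrightarrow> t \<in> slots" if "same_kind s t" for s t :: "'a slot"
    by (meson slotsE slotsI same_kind_iff that)
  then have "list_all2 (\<lambda>s t. s \<in> slots \<longrightarrow> t \<in> slots) w w'"
    using w' by (auto intro: list_all2_mono)
  then show "w' \<in> lists slots"
    using \<open>w \<in> lists slots\<close> by (induction rule: list_all2_induct) auto
qed

lemma saturated_listset: "set Ms \<subseteq> kinds \<Longrightarrow> saturated (listset Ms)"
proof (induction Ms)
  case Nil
  then show ?case by (simp add: saturated_Nil)
next
  case (Cons M Ms)
  then have "M \<in> kinds" "saturated (listset Ms)" by auto
  then show ?case unfolding listset.simps by (rule saturated_set_Cons)
qed

lemma form_words_eq: "form_words = set_Cons FS (lists slots)"
  unfolding form_words_def set_Cons_def slots_def by (auto simp: lists_eq_set)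

lemma list_all2_same_kind_refl: "list_all2 same_kind p p"
  by (rule list.rel_refl) (rule same_kind_refl)

lemma saturated_replace:
  assumes "saturated W" "list_all2 same_kind w w'"
  shows "p @ w @ q \<in> W \<longleftrightarrow> p @ w' @ q \<in> W"
  by (rule saturated_same_kind[OF assms(1)])
     (intro list_all2_appendI list_all2_same_kind_refl assms)

lemma saturated_add_iff:
  assumes "saturated W" "M \<in> kinds" "s \<in> M" "t \<in> M"
  shows "p @ [slot_add s t] @ q \<in> W \<longleftrightarrow> p @ [s] @ q \<in> W"
    and "p @ [t] @ q \<in> W \<longleftrightarrow> p @ [s] @ q \<in> W"
  using same_kindI[OF assms(2) slot_add_closed[OF assms(2-4)] assms(3)] same_kindI[OF assms(2,4,3)]
  by (intro saturated_replace assms(1); simp)+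

lemma same_kind_act:
  assumes "a \<in> Omega 0" "s \<in> slots"
  shows "same_kind (slot_ract s a) s" "same_kind (slot_lact a s) s"
proof -
  from assms(2) obtain M where M: "M \<in> kinds" "s \<in> M" by (rule slotsE)
  show "same_kind (slot_ract s a) s" "same_kind (slot_lact a s) s"
    by (rule same_kindI[OF M(1)]; intro slot_ract_closed slot_lact_closed assms M)+
qed

lemma saturated_bal_iff:
  assumes "saturated W" "a \<in> Omega 0" "s \<in> slots" "t \<in> slots"
  shows "p @ [slot_ract s a, t] @ q \<in> W \<longleftrightarrow> p @ [s, t] @ q \<in> W"
    and "p @ [s, slot_lact a t] @ q \<in> W \<longleftrightarrow> p @ [s, t] @ q \<in> W"
  using same_kind_act[OF assms(2,3)] same_kind_act[OF assms(2,4)]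
  by (intro saturated_replace assms(1); simp add: same_kind_refl)+

text \<open>Saturation makes the case distinctions on both sides of a relation agree, so the
  function cut off by zero meets the hypotheses of \<open>ex1_additive_tensor\<close>. From here on
  the definite description in \<open>textend\<close> is used only through these two facts.\<close>

lemma textend_additive_pure:
  assumes "tensorial W f"
  shows "additive (textend W f) \<and> (\<forall>w. textend W f (pure w) = (if w \<in> W then f w else 0))"
proof -
  note sat = tensorial_saturated[OF assms]
  have "\<exists>!g. additive g \<and> (\<forall>w. g (pure w) = (if w \<in> W then f w else 0))"
  proof (rule ex1_additive_tensor, unfold kinds_def[symmetric] slots_def[symmetric])
    fix p q s t and M :: "'a slot set" assume M: "M \<in> kinds" "s \<in> M" "t \<in> M"
    show "(if p @ [slot_add s t] @ q \<in> W then f (p @ [slot_add s t] @ q) else 0) =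
      (if p @ [s] @ q \<in> W then f (p @ [s] @ q) else 0) + (if p @ [t] @ q \<in> W then f (p @ [t] @ q) else 0)"
      unfolding saturated_add_iff[OF sat M] using tensorial_add[OF assms M] by simp
  next
    fix p q and s t :: "'a slot" and a :: 'a assume a: "a \<in> Omega 0" "s \<in> slots" "t \<in> slots"
    show "(if p @ [slot_ract s a, t] @ q \<in> W then f (p @ [slot_ract s a, t] @ q) else 0) =
      (if p @ [s, slot_lact a t] @ q \<in> W then f (p @ [s, slot_lact a t] @ q) else 0)"
      unfolding saturated_bal_iff[OF sat a] using tensorial_bal[OF assms a] by simp
  qed
  from theI'[OF this] show ?thesis unfolding textend_def .
qed

lemmas textend_additive = textend_additive_pure[THEN conjunct1]
lemmas textend_pure = textend_additive_pure[THEN conjunct2, rule_format]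

lemma abs_tensor_induct_pure:
  assumes "P 0" "\<And>w. P (pure w)" "\<And>x y. P x \<Longrightarrow> P y \<Longrightarrow> P (x - y)"
  shows "P (x :: 'w::star_dga tensor)"
proof (induct x rule: tensor.abs_induct)
  fix x :: "'w slot list \<Rightarrow>\<^sub>0 int"
  show "P (abs_tensor x)"
    using subset_UNIV
    by (induction x rule: frag_induction)
       (auto simp: assms pure.abs_eq[symmetric] minus_tensor.abs_eq[symmetric]
          assms(1)[unfolded zero_tensor_def])
qed

lemma tspan_UNIV: "tspan UNIV = (UNIV :: 'w::star_dga tensor set)"
proof -
  have "x \<in> tspan UNIV" for x :: "'w tensor"
    by (induction x rule: abs_tensor_induct_pure) (auto simp: tspan_def intro: group_closure.intros)
  then show ?thesis by blast
qed

lemma tspan_pure: "w \<in> W \<Longrightarrow> pure w \<in> tspan W"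
  by (auto simp: tspan_def intro: group_closure.base)

lemma tspan_zero [simp]: "0 \<in> tspan W"
  by (simp add: tspan_def)

lemma tspan_add: "x \<in> tspan W \<Longrightarrow> y \<in> tspan W \<Longrightarrow> x + y \<in> tspan W"
  unfolding tspan_def by (rule group_closure_add)

lemma tspan_diff: "x \<in> tspan W \<Longrightarrow> y \<in> tspan W \<Longrightarrow> x - y \<in> tspan W"
  unfolding tspan_def by (rule group_closure.diff)

lemma tspan_sum: "(\<And>i. i \<in> I \<Longrightarrow> f i \<in> tspan W) \<Longrightarrow> (\<Sum>i\<in>I. f i) \<in> tspan W"
  by (induction I rule: infinite_finite_induct) (auto intro: tspan_add)

lemma tspan_induct [consumes 1, case_names zero pure diff]:
  assumes "x \<in> tspan W" "P 0" "\<And>w. w \<in> W \<Longrightarrow> P (pure w)" "\<And>x y. P x \<Longrightarrow> P y \<Longrightarrow> P (x - y)"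
  shows "P x"
  using assms(1) unfolding tspan_def by induction (auto simp: assms)

lemma tspan_eqI:
  assumes "x \<in> tspan W" "additive f" "additive g" "\<And>w. w \<in> W \<Longrightarrow> f (pure w) = g (pure w)"
  shows "f x = g x"
  using assms(1)
  by (induction rule: tspan_induct) (auto simp: assms additive.zero additive.diff)

lemma tensor_eqI:
  assumes "additive f" "additive g" "\<And>w. f (pure w) = g (pure w)"
  shows "f x = g x"
  by (rule tspan_eqI[of x UNIV]) (auto simp: assms tspan_UNIV)

lemma tspan_mapI:
  assumes "x \<in> tspan W" "additive f" "\<And>w. w \<in> W \<Longrightarrow> f (pure w) \<in> tspan W'"
  shows "f x \<in> tspan W'"
  using assms(1)
  by (induction rule: tspan_induct) (auto simp: assms additive.zero additive.diff intro: tspan_diff)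

lemma tspan_mono: "W \<subseteq> W' \<Longrightarrow> x \<in> tspan W \<Longrightarrow> x \<in> tspan W'"
  by (erule tspan_induct) (auto intro: tspan_pure tspan_diff)

lemma pure_add:
  assumes "M \<in> kinds" "s \<in> M" "t \<in> M"
  shows "pure (p @ [slot_add s t] @ q) = pure (p @ [s] @ q) + pure (p @ [t] @ q)"
proof -
  have "frag_of (p @ [slot_add s t] @ q) - frag_of (p @ [s] @ q) - frag_of (p @ [t] @ q) \<in> tensor_rels"
    unfolding tensor_rels_def kinds_def[symmetric] slots_def[symmetric] using assms by blast
  then have "abs_tensor (frag_of (p @ [slot_add s t] @ q) - frag_of (p @ [s] @ q) - frag_of (p @ [t] @ q)) = 0"
    unfolding abs_tensor_eq_0_iff by (auto intro: group_closure.base)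
  then show ?thesis
    unfolding minus_tensor.abs_eq[symmetric] pure.abs_eq[symmetric] by (simp add: diff_diff_eq)
qed

lemma pure_bal:
  assumes "a \<in> Omega 0" "s \<in> slots" "t \<in> slots"
  shows "pure (p @ [slot_ract s a, t] @ q) = pure (p @ [s, slot_lact a t] @ q)"
proof -
  have "frag_of (p @ [slot_ract s a, t] @ q) - frag_of (p @ [s, slot_lact a t] @ q) \<in> tensor_rels"
    unfolding tensor_rels_def kinds_def[symmetric] slots_def[symmetric] using assms by blast
  then have "abs_tensor (frag_of (p @ [slot_ract s a, t] @ q) - frag_of (p @ [s, slot_lact a t] @ q)) = 0"
    unfolding abs_tensor_eq_0_iff by (auto intro: group_closure.base)
  then show ?thesis
    unfolding minus_tensor.abs_eq[symmetric] pure.abs_eq[symmetric] by simp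
qed

text \<open>\<open>pure\<close> satisfies the relations, hence so does any function that factors
  through it additively. The map \<open>G\<close> may vary with the word, since a relation compares
  only words whose letters are of the same kinds.\<close>

lemma tensorial_additive:
  assumes "saturated W" "\<And>w. w \<in> W \<Longrightarrow> \<exists>G. additive G \<and> (\<forall>w' \<in> W. list_all2 same_kind w w' \<longrightarrow> f w' = G (pure w'))"
  shows "tensorial W f"
proof (rule tensorialI)
  fix p q s t and M :: "'a slot set"
  assume M: "M \<in> kinds" "s \<in> M" "t \<in> M" and W: "p @ [s] @ q \<in> W"
  obtain G where G: "additive G" "\<forall>w' \<in> W. list_all2 same_kind (p @ [s] @ q) w' \<longrightarrow> f w' = G (pure w')"
    using assms(2)[OF W] by blast
  have "same_kind s (slot_add s t)" "same_kind s t"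
    by (intro same_kindI[OF M(1,2)] slot_add_closed M)+
  then have "f (p @ [w'] @ q) = G (pure (p @ [w'] @ q))" if "w' \<in> {s, t, slot_add s t}" for w'
    using that W saturated_add_iff[OF assms(1) M, of p q]
    by (intro G(2)[rule_format] list_all2_appendI list_all2_same_kind_refl) (auto simp: same_kind_refl)
  then show "f (p @ [slot_add s t] @ q) = f (p @ [s] @ q) + f (p @ [t] @ q)"
    using G(1) by (simp only: insertI1 insert_iff simp_thms pure_add[OF M] additive.add)
next
  fix p q and s t :: "'a slot" and a :: 'a
  assume a: "a \<in> Omega 0" "s \<in> slots" "t \<in> slots" and W: "p @ [s, t] @ q \<in> W"
  obtain G where G: "additive G" "\<forall>w' \<in> W. list_all2 same_kind (p @ [s, t] @ q) w' \<longrightarrow> f w' = G (pure w')"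
    using assms(2)[OF W] by blast
  have "same_kind s (slot_ract s a)" "same_kind t (slot_lact a t)"
    by (rule same_kind_sym[OF same_kind_act(1)[OF a(1,2)]] same_kind_sym[OF same_kind_act(2)[OF a(1,3)]])+
  then have "f (p @ w' @ q) = G (pure (p @ w' @ q))" if "w' \<in> {[slot_ract s a, t], [s, slot_lact a t]}" for w'
    using that W saturated_bal_iff[OF assms(1) a, of p q]
    by (intro G(2)[rule_format] list_all2_appendI list_all2_same_kind_refl) (auto simp: same_kind_refl)
  then show "f (p @ [slot_ract s a, t] @ q) = f (p @ [s, slot_lact a t] @ q)"
    by (simp only: insertI1 insert_iff simp_thms pure_bal[OF a])
qed (rule assms(1))

text \<open>Recursion on the first letter: a relation is additivity in the first letter,
  balancedness between the first two, or takes place entirely in the tail.\<close>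

lemma tensorial_Cons:
  assumes M: "M \<in> kinds" and Z: "saturated Z"
    and add: "\<And>s t z. s \<in> M \<Longrightarrow> t \<in> M \<Longrightarrow> z \<in> Z \<Longrightarrow> f (slot_add s t # z) = f (s # z) + f (t # z)"
    and tail: "\<And>s. s \<in> M \<Longrightarrow> tensorial Z (\<lambda>z. f (s # z))"
    and bal: "\<And>s t q a. s \<in> M \<Longrightarrow> t \<in> slots \<Longrightarrow> t # q \<in> Z \<Longrightarrow> a \<in> Omega 0 \<Longrightarrow>
      f (slot_ract s a # t # q) = f (s # slot_lact a t # q)"
  shows "tensorial (set_Cons M Z) f"
proof (rule tensorialI)
  fix p q s t and M' :: "'a slot set"
  assume M': "M' \<in> kinds" "s \<in> M'" "t \<in> M'" and W: "p @ [s] @ q \<in> set_Cons M Z"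
  show "f (p @ [slot_add s t] @ q) = f (p @ [s] @ q) + f (p @ [t] @ q)"
  proof (cases p)
    case Nil
    then have s: "s \<in> M" "q \<in> Z" using W by (auto simp: set_Cons_def)
    moreover have "t \<in> M" using same_kind_iff[OF M same_kindI[OF M']] s by simp
    ultimately show ?thesis using Nil add by simp
  next
    case (Cons h p')
    then have "h \<in> M" "p' @ [s] @ q \<in> Z" using W by (auto simp: set_Cons_def)
    then show ?thesis using tensorial_add[OF tail M'] Cons by simp
  qed
next
  fix p q and s t :: "'a slot" and a :: 'a
  assume a: "a \<in> Omega 0" "s \<in> slots" "t \<in> slots" and W: "p @ [s, t] @ q \<in> set_Cons M Z"
  show "f (p @ [slot_ract s a, t] @ q) = f (p @ [s, slot_lact a t] @ q)"
  proof (cases p)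
    case Nil
    then have s: "s \<in> M" "t # q \<in> Z" using W by (auto simp: set_Cons_def)
    then show ?thesis using Nil bal a by simp
  next
    case (Cons h p')
    then have "h \<in> M" "p' @ [s, t] @ q \<in> Z" using W by (auto simp: set_Cons_def)
    then show ?thesis using tensorial_bal[OF tail a] Cons by simp
  qed
qed (rule saturated_set_Cons[OF M Z])

lemma tensorial_comp:
  assumes "saturated W" "additive G" "\<And>w. w \<in> W \<Longrightarrow> f w = G (pure w)"
  shows "tensorial W f"
  by (rule tensorial_additive[OF assms(1)]) (use assms(2,3) in blast)

section \<open>The canonical maps\<close>

lemma tensorial_append: "tensorial UNIV (\<lambda>q. pure (p @ q))"
  by (rule tensorialI[OF saturated_UNIV])
     (simp_all only: pure_add[where p = "p @ _", unfolded append_assoc] pure_bal[where p = "p @ _", unfolded append_assoc])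

lemma append_textend:
  "additive (textend UNIV (\<lambda>q. pure (p @ q)))" "textend UNIV (\<lambda>q. pure (p @ q)) (pure w) = pure (p @ w)"
  by (simp_all add: textend_additive[OF tensorial_append] textend_pure[OF tensorial_append])

text \<open>A relation in the left word becomes an identity between additive maps of
  \<open>y\<close>. On pure \<open>y\<close> it is the same relation inside a longer word.\<close>

lemma tensorial_tens: "tensorial UNIV (\<lambda>p. textend UNIV (\<lambda>q. pure (p @ q)) y)"
proof -
  define h where "h p = textend UNIV (\<lambda>q. pure (p @ q))" for p :: "'a slot list"
  have h: "h p (x + y) = h p x + h p y" "h p (pure w) = pure (p @ w)" for p x y w
    unfolding h_def by (rule additive.add[OF append_textend(1)], rule append_textend(2))
  have "tensorial UNIV (\<lambda>p. h p y)"
  proof (rule tensorialI[OF saturated_UNIV])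
    fix p q and s t :: "'a slot" and M
    assume M: "M \<in> kinds" "s \<in> M" "t \<in> M"
    show "h (p @ [slot_add s t] @ q) y = h (p @ [s] @ q) y + h (p @ [t] @ q) y"
    proof (rule tensor_eqI[where x = y])
      show "additive (\<lambda>y. h (p @ [s] @ q) y + h (p @ [t] @ q) y)"
        unfolding additive_def h by (simp add: ac_simps)
      show "h (p @ [slot_add s t] @ q) (pure w) = h (p @ [s] @ q) (pure w) + h (p @ [t] @ q) (pure w)" for w
        unfolding h append_assoc by (rule pure_add[OF M])
    qed (simp add: additive_def h)
  next
    fix p q and s t :: "'a slot" and a :: 'a
    assume a: "a \<in> Omega 0" "s \<in> slots" "t \<in> slots"
    show "h (p @ [slot_ract s a, t] @ q) y = h (p @ [s, slot_lact a t] @ q) y"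
    proof (rule tensor_eqI[where x = y])
      show "h (p @ [slot_ract s a, t] @ q) (pure w) = h (p @ [s, slot_lact a t] @ q) (pure w)" for w
        unfolding h append_assoc by (rule pure_bal[OF a])
    qed (simp_all add: additive_def h)
  qed
  then show ?thesis unfolding h_def .
qed

lemma tens_pure: "pure p \<otimes> pure q = pure (p @ q)"
  unfolding tens_def textend_pure[OF tensorial_tens] by (simp add: append_textend(2))

lemma additive_tens_left: "additive (\<lambda>x. x \<otimes> y)"
  unfolding tens_def by (rule textend_additive[OF tensorial_tens])

lemma additive_tens_right: "additive (\<lambda>y. x \<otimes> y)"
  unfolding additive_def
proof (intro allI)
  fix y z :: "'a tensor"
  show "x \<otimes> (y + z) = x \<otimes> y + x \<otimes> z"
  proof (rule tensor_eqI[where x = x])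
    show "additive (\<lambda>x. x \<otimes> (y + z))" by (rule additive_tens_left)
    show "additive (\<lambda>x. x \<otimes> y + x \<otimes> z)"
      by (simp add: additive_def additive.add[OF additive_tens_left])
    fix w :: "'a slot list"
    have "pure w \<otimes> y = textend UNIV (\<lambda>q. pure (w @ q)) y" for y
      unfolding tens_def by (simp add: textend_pure[OF tensorial_tens])
    then show "pure w \<otimes> (y + z) = pure w \<otimes> y + pure w \<otimes> z"
      by (simp add: additive.add[OF append_textend(1)])
  qed
qed

lemmas tens_add_left = additive.add[OF additive_tens_left]
lemmas tens_add_right = additive.add[OF additive_tens_right]

lemma tspan_tens:
  assumes "x \<in> tspan W" "y \<in> tspan W'" "\<And>w w'. w \<in> W \<Longrightarrow> w' \<in> W' \<Longrightarrow> w @ w' \<in> W''"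
  shows "x \<otimes> y \<in> tspan W''"
proof (rule tspan_mapI[OF assms(1) additive_tens_left])
  fix w assume "w \<in> W"
  show "pure w \<otimes> y \<in> tspan W''"
    by (rule tspan_mapI[OF assms(2) additive_tens_right])
       (simp add: tens_pure tspan_pure assms(3) \<open>w \<in> W\<close>)
qed

section \<open>Left and right action of A on tensors\<close>

lemma tensorial_word_lact:
  assumes "a \<in> Omega 0"
  shows "tensorial UNIV (\<lambda>ws. pure (word_lact a ws))"
proof (rule tensorialI[OF saturated_UNIV])
  fix p q and s t :: "'a slot" and M
  assume M: "M \<in> kinds" "s \<in> M" "t \<in> M"
  have M': "slot_lact a s \<in> M" "slot_lact a t \<in> M"
    using slot_lact_closed[OF assms M(1)] M by blast+
  show "pure (word_lact a (p @ [slot_add s t] @ q)) = pure (word_lact a (p @ [s] @ q)) + pure (word_lact a (p @ [t] @ q))"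
  proof (cases p)
    case Nil
    then show ?thesis using pure_add[OF M(1) M', of "[]" q] slot_lact_add[OF M] by simp
  next
    case (Cons h p')
    then show ?thesis using pure_add[OF M, of "slot_lact a h # p'" q] by simp
  qed
next
  fix p q and s t :: "'a slot" and b :: 'a
  assume b: "b \<in> Omega 0" "s \<in> slots" "t \<in> slots"
  show "pure (word_lact a (p @ [slot_ract s b, t] @ q)) = pure (word_lact a (p @ [s, slot_lact b t] @ q))"
  proof (cases p)
    \<comment> \<open>Only here do the left action and the balancing scalar meet on the same letter;
      they commute because every letter comes from a bimodule.\<close>
    case Nil
    then show ?thesis
      using pure_bal[OF b(1) slot_lact_slots[OF assms b(2)] b(3), of "[]" q] by (simp add: slot_lact_ract)
  next
    case (Cons h p')
    then show ?thesis using pure_bal[OF b, of "slot_lact a h # p'" q] by simp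
  qed
qed

lemma additive_tlact: "a \<in> Omega 0 \<Longrightarrow> additive (tlact a)"
  unfolding tlact_def by (rule textend_additive[OF tensorial_word_lact])

lemma tlact_pure: "a \<in> Omega 0 \<Longrightarrow> tlact a (pure w) = pure (word_lact a w)"
  unfolding tlact_def by (simp add: textend_pure[OF tensorial_word_lact])

lemmas tlact_add = additive.add[OF additive_tlact]

lemma word_lact_word_lact: "word_lact a (word_lact b w) = word_lact (a * b) w"
  by (cases w) (simp_all add: slot_lact_lact)

lemma tlact_tlact:
  assumes "a \<in> Omega 0" "b \<in> Omega 0"
  shows "tlact a (tlact b x) = tlact (a * b) x"
  by (rule tensor_eqI[where x = x])
     (simp_all add: additive_def tlact_add tlact_pure assms Omega_0_mult word_lact_word_lact)

lemma slot_lact_add_left: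
  "s \<in> slots \<Longrightarrow> slot_lact (a + b) s = slot_add (slot_lact a s) (slot_lact b s)"
  by (auto simp: slots_def distrib_right vec_lact_def)

lemma pure_word_lact_add:
  assumes "a \<in> Omega 0" "b \<in> Omega 0" "w \<in> lists slots"
  shows "pure (word_lact (a + b) w) = pure (word_lact a w) + pure (word_lact b w)"
proof (cases w)
  \<comment> \<open>On the empty word the action creates a scalar letter, so additivity is that of
    the letters from A.\<close>
  case Nil
  then show ?thesis using pure_add[of AS "Scal a" "Scal b" "[]" "[]"] assms by simp
next
  case (Cons s w')
  with assms obtain M where M: "M \<in> kinds" "s \<in> M" by (auto elim: slotsE)
  then show ?thesis
    using pure_add[OF M(1) slot_lact_closed[OF assms(1) M] slot_lact_closed[OF assms(2) M], of "[]" w'] Cons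
      slot_lact_add_left[OF slotsI[OF M]] by simp
qed

lemma tlact_add_left:
  assumes "a \<in> Omega 0" "b \<in> Omega 0" "x \<in> tspan (lists slots)"
  shows "tlact (a + b) x = tlact a x + tlact b x"
  by (rule tspan_eqI[OF assms(3)])
     (simp_all add: additive_def tlact_add assms Omega_add tlact_pure pure_word_lact_add ac_simps)

text \<open>The empty word is excluded because \<open>tlact\<close> turns it into the letter
  \<open>Scal a\<close>, which would stand in front of \<open>y\<close> instead of acting on its
  first letter.\<close>

lemma tlact_tens:
  assumes "a \<in> Omega 0" "x \<in> tspan (- {[]})"
  shows "tlact a (x \<otimes> y) = tlact a x \<otimes> y"
proof (rule tspan_eqI[OF assms(2)])
  fix w :: "'a slot list" assume w: "w \<in> - {[]}"
  show "tlact a (pure w \<otimes> y) = tlact a (pure w) \<otimes> y"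
    by (rule tensor_eqI[where x = y])
       (use w in \<open>auto simp: additive_def tlact_add tens_add_right tens_pure tlact_pure assms(1) neq_Nil_conv\<close>)
qed (simp_all add: additive_def tlact_add tens_add_left assms(1))

lemma tensorial_word_ract:
  assumes "a \<in> Omega 0"
  shows "tensorial UNIV (\<lambda>ws. if ws = [] then pure [Scal a] else pure (butlast ws @ [slot_ract (last ws) a]))"
proof (rule tensorialI[OF saturated_UNIV])
  fix p q and s t :: "'a slot" and M
  assume M: "M \<in> kinds" "s \<in> M" "t \<in> M"
  have M': "slot_ract s a \<in> M" "slot_ract t a \<in> M"
    using slot_ract_closed[OF assms M(1)] M by blast+
  show "(if p @ [slot_add s t] @ q = [] then pure [Scal a]
      else pure (butlast (p @ [slot_add s t] @ q) @ [slot_ract (last (p @ [slot_add s t] @ q)) a])) =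
    (if p @ [s] @ q = [] then pure [Scal a] else pure (butlast (p @ [s] @ q) @ [slot_ract (last (p @ [s] @ q)) a])) +
    (if p @ [t] @ q = [] then pure [Scal a] else pure (butlast (p @ [t] @ q) @ [slot_ract (last (p @ [t] @ q)) a]))"
  proof (cases q rule: rev_cases)
    case Nil
    then show ?thesis using pure_add[OF M(1) M', of p "[]"] slot_ract_add[OF M] by simp
  next
    case (snoc q' h)
    then show ?thesis using pure_add[OF M, of p "q' @ [slot_ract h a]"] by (simp add: butlast_append)
  qed
next
  fix p q and s t :: "'a slot" and b :: 'a
  assume b: "b \<in> Omega 0" "s \<in> slots" "t \<in> slots"
  show "(if p @ [slot_ract s b, t] @ q = [] then pure [Scal a]
      else pure (butlast (p @ [slot_ract s b, t] @ q) @ [slot_ract (last (p @ [slot_ract s b, t] @ q)) a])) =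
    (if p @ [s, slot_lact b t] @ q = [] then pure [Scal a]
      else pure (butlast (p @ [s, slot_lact b t] @ q) @ [slot_ract (last (p @ [s, slot_lact b t] @ q)) a]))"
  proof (cases q rule: rev_cases)
    case Nil
    then show ?thesis
      using pure_bal[OF b(1,2) slot_ract_slots[OF assms b(3)], of p "[]"]
      by (simp add: butlast_append slot_lact_ract)
  next
    case (snoc q' h)
    then show ?thesis using pure_bal[OF b, of p "q' @ [slot_ract h a]"] by (simp add: butlast_append)
  qed
qed

lemma additive_tract: "a \<in> Omega 0 \<Longrightarrow> additive (\<lambda>x. tract x a)"
  unfolding tract_def by (rule textend_additive[OF tensorial_word_ract])

lemmas tract_add = additive.add[OF additive_tract]

lemma tract_pure: "a \<in> Omega 0 \<Longrightarrow> tract (pure (w @ [s])) a = pure (w @ [slot_ract s a])"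
  unfolding tract_def by (simp add: textend_pure[OF tensorial_word_ract])

lemma tract_tens_pure:
  assumes "a \<in> Omega 0"
  shows "tract (x \<otimes> pure [s]) a = x \<otimes> pure [slot_ract s a]"
  by (rule tensor_eqI[where x = x])
     (simp_all add: additive_def tract_add tens_add_left assms tens_pure tract_pure)

text \<open>Balancedness at the junction of the two factors; \<open>x\<close> needs a last letter to
  absorb \<open>a\<close>.\<close>

lemma tens_pure_lact:
  assumes "a \<in> Omega 0" "x \<in> tspan (lists slots - {[]})" "t \<in> slots"
  shows "x \<otimes> pure (slot_lact a t # q) = tract x a \<otimes> pure (t # q)"
proof (rule tspan_eqI[OF assms(2)])
  fix w :: "'a slot list" assume "w \<in> lists slots - {[]}"
  then obtain p s where "w = p @ [s]" "s \<in> slots" by (cases w rule: rev_cases) auto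
  then show "pure w \<otimes> pure (slot_lact a t # q) = tract (pure w) a \<otimes> pure (t # q)"
    using pure_bal[OF assms(1) _ assms(3), of s p q] by (simp add: tens_pure tract_pure assms(1))
qed (simp_all add: additive_def tract_add tens_add_left assms(1))

section \<open>Contraction with a vector field\<close>

lemma tensorial_contract:
  assumes "v \<in> vecA"
  shows "tensorial form_words (\<lambda>ws. case ws of Form \<xi> # zs \<Rightarrow> pure (word_lact (v \<xi>) zs) | _ \<Rightarrow> 0)"
  unfolding form_words_eq
proof (rule tensorial_Cons, goal_cases)
  case (3 s t z)
  then show ?case using pure_word_lact_add[OF vecAD(2)[OF assms] vecAD(2)[OF assms] 3(3)] by (auto simp: vecAD(3)[OF assms])
next
  case (4 s)
  then obtain \<xi> where "s = Form \<xi>" by auto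
  then show ?case
    by (intro tensorial_comp[OF saturated_lists_slots additive_tlact[of "v \<xi>"]]) (simp_all add: tlact_pure vecAD[OF assms])
next
  \<comment> \<open>Right linearity of \<open>v\<close> turns balancedness into associativity of the
    left action.\<close>
  case (5 s t q a)
  then show ?case by (auto simp: slot_lact_lact vecAD[OF assms])
qed (simp_all add: saturated_lists_slots)

lemma additive_contract: "v \<in> vecA \<Longrightarrow> additive (contract v)"
  unfolding contract_def by (rule textend_additive[OF tensorial_contract])

lemmas contract_add = additive.add[OF additive_contract]

lemma contract_pure:
  "v \<in> vecA \<Longrightarrow> \<xi> \<in> Omega 1 \<Longrightarrow> zs \<in> lists slots \<Longrightarrow>
   contract v (pure (Form \<xi> # zs)) = pure (word_lact (v \<xi>) zs)"
  unfolding contract_def using textend_pure[OF tensorial_contract, of v "Form \<xi> # zs"]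
  by (simp add: form_words_eq set_Cons_def)

lemma tensorial_Nil: "tensorial {[]} f"
  by (rule tensorialI[OF saturated_Nil]) auto

lemma listset_single: "listset [M] = (\<lambda>s. [s]) ` M"
  by (auto simp: set_Cons_def)

lemma listset_pair: "listset [M, M'] = {[s, t] | s t. s \<in> M \<and> t \<in> M'}"
  by (auto simp: set_Cons_def)

lemma listset_kinds_subset: "set Ms \<subseteq> kinds \<Longrightarrow> listset Ms \<subseteq> lists slots"
proof (induction Ms)
  case (Cons M Ms)
  then have "s \<in> slots" if "s \<in> M" for s using that by (intro slotsI[of M]) auto
  then show ?case using Cons by (fastforce simp: set_Cons_def)
qed simp

lemma Form_slots: "\<xi> \<in> Omega 1 \<Longrightarrow> Form \<xi> \<in> slots"
  by (simp add: slots_def)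

lemma Vect_slots: "v \<in> vecA \<Longrightarrow> Vect v \<in> slots"
  by (simp add: slots_def)

lemma FF_form_words: "listset [FS, FS] \<subseteq> form_words"
  by (auto simp: form_words_eq set_Cons_def Form_slots)

lemma form_wordsE:
  assumes "w \<in> form_words"
  obtains \<xi> zs where "w = Form \<xi> # zs" "\<xi> \<in> Omega 1" "zs \<in> lists slots"
  using assms by (auto simp: form_words_eq set_Cons_def)

lemma vec_lact_apply: "vec_lact a v \<xi> = a * v \<xi>"
  by (simp add: vec_lact_def)

lemma vec_ract_apply: "\<xi> \<in> Omega 1 \<Longrightarrow> vec_ract v a \<xi> = v (a * \<xi>)"
  by (simp add: vec_ract_def)

lemma contract_lact:
  assumes "a \<in> Omega 0" "v \<in> vecA" "x \<in> tspan form_words"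
  shows "contract (vec_lact a v) x = tlact a (contract v x)"
proof (rule tspan_eqI[OF assms(3)])
  fix w :: "'a slot list" assume "w \<in> form_words"
  then obtain \<xi> zs where "w = Form \<xi> # zs" "\<xi> \<in> Omega 1" "zs \<in> lists slots" by (rule form_wordsE)
  then show "contract (vec_lact a v) (pure w) = tlact a (contract v (pure w))"
    using assms by (simp add: contract_pure tlact_pure vecA_lact vec_lact_apply word_lact_word_lact)
qed (simp_all add: assms additive_def contract_add tlact_add vecA_lact)

lemma contract_ract:
  assumes "a \<in> Omega 0" "v \<in> vecA" "x \<in> tspan form_words"
  shows "contract (vec_ract v a) x = contract v (tlact a x)"
proof (rule tspan_eqI[OF assms(3)])
  fix w :: "'a slot list" assume "w \<in> form_words"
  then obtain \<xi> zs where "w = Form \<xi> # zs" "\<xi> \<in> Omega 1" "zs \<in> lists slots" by (rule form_wordsE)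
  then show "contract (vec_ract v a) (pure w) = contract v (tlact a (pure w))"
    using assms by (simp add: contract_pure tlact_pure vecA_ract Omega_0_mult vec_ract_apply)
qed (simp_all add: assms additive_def contract_add tlact_add vecA_ract)

lemma contract_add_left:
  assumes "v \<in> vecA" "v' \<in> vecA" "x \<in> tspan form_words"
  shows "contract (\<lambda>\<xi>. v \<xi> + v' \<xi>) x = contract v x + contract v' x"
proof (rule tspan_eqI[OF assms(3)])
  fix w :: "'a slot list" assume "w \<in> form_words"
  then obtain \<xi> zs where "w = Form \<xi> # zs" "\<xi> \<in> Omega 1" "zs \<in> lists slots" by (rule form_wordsE)
  then show "contract (\<lambda>\<xi>. v \<xi> + v' \<xi>) (pure w) = contract v (pure w) + contract v' (pure w)"
    using assms vecAD(2)[OF assms(1)] vecAD(2)[OF assms(2)]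
    by (simp add: contract_pure contract_pure[OF vecA_add[OF assms(1,2)]] pure_word_lact_add)
qed (simp_all add: assms additive_def contract_add contract_add[OF vecA_add[OF assms(1,2)]] ac_simps)

text \<open>Contraction consumes the first letter and the right action changes the last one; in a
  word of two forms these are different letters.\<close>

lemma contract_tract_FF:
  assumes "a \<in> Omega 0" "v \<in> vecA" "x \<in> tspan (listset [FS, FS])"
  shows "contract v (tract x a) = tract (contract v x) a"
proof (rule tspan_eqI[OF assms(3)])
  fix w :: "'a slot list" assume "w \<in> listset [FS, FS]"
  then obtain \<xi> \<eta> where w: "w = [Form \<xi>] @ [Form \<eta>]" "\<xi> \<in> Omega 1" "\<eta> \<in> Omega 1"
    unfolding listset_pair by auto
  have "tract (pure w) a = pure [Form \<xi>, Form (\<eta> * a)]"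
    unfolding w(1) tract_pure[OF assms(1)] by simp
  then have "contract v (tract (pure w) a) = pure [Form (v \<xi> * (\<eta> * a))]"
    using w assms by (simp add: contract_pure Form_slots Omega_mult_0)
  moreover have "contract v (pure w) = pure ([] @ [Form (v \<xi> * \<eta>)])"
    using w assms by (simp add: contract_pure Form_slots)
  ultimately show "contract v (tract (pure w) a) = tract (contract v (pure w)) a"
    unfolding tract_pure[OF assms(1)] by (simp add: mult.assoc tract_pure[OF assms(1), of "[]", simplified])
qed (simp_all add: assms additive_def contract_add tract_add)

lemma pure_Form_add:
  assumes "\<xi> \<in> Omega 1" "\<eta> \<in> Omega 1"
  shows "pure (Form (\<xi> + \<eta>) # q) = pure (Form \<xi> # q) + pure (Form \<eta> # q)"
  using pure_add[OF kinds(2), of "Form \<xi>" "Form \<eta>" "[]" q] assms by simp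

section \<open>Pairing with a form, and J on the first factor\<close>

lemma tensorial_pairing:
  assumes "\<xi> \<in> Omega 1"
  shows "tensorial (listset [FS, VS])
     (\<lambda>ws. case ws of [Form \<eta>, Vect v] \<Rightarrow> pure [Form (\<eta> * v \<xi>)] | _ \<Rightarrow> 0)"
  unfolding listset.simps
proof (intro tensorial_Cons saturated_set_Cons saturated_Nil tensorial_Nil kinds, goal_cases)
  case (1 s t z)
  then show ?case
    by (auto simp: set_Cons_def distrib_right Omega_mult_0 vecAD(2) pure_Form_add)
next
  case (2 s s' t z)
  then show ?case
    by (auto simp: distrib_left Omega_mult_0 vecAD(2) pure_Form_add)
qed (auto simp: set_Cons_def vec_lact_def mult.assoc)

lemma additive_pairing: "\<xi> \<in> Omega 1 \<Longrightarrow> additive (\<lambda>x. pairing x \<xi>)"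
  unfolding pairing_def by (rule textend_additive[OF tensorial_pairing])

lemmas pairing_add = additive.add[OF additive_pairing]

lemma pairing_pure:
  "\<eta> \<in> Omega 1 \<Longrightarrow> v \<in> vecA \<Longrightarrow> \<xi> \<in> Omega 1 \<Longrightarrow>
   pairing (pure [Form \<eta>, Vect v]) \<xi> = pure [Form (\<eta> * v \<xi>)]"
  unfolding pairing_def by (subst textend_pure[OF tensorial_pairing]) (auto simp: set_Cons_def)

lemma pairing_tens:
  assumes "x \<in> tspan (listset [FS])" "v \<in> vecA" "\<xi> \<in> Omega 1"
  shows "pairing (x \<otimes> pure [Vect v]) \<xi> = tract x (v \<xi>)"
proof (rule tspan_eqI[OF assms(1)])
  fix w :: "'a slot list" assume "w \<in> listset [FS]"
  then show "pairing (pure w \<otimes> pure [Vect v]) \<xi> = tract (pure w) (v \<xi>)"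
    using assms tract_pure[OF vecAD(2)[OF assms(2)], of "[]"]
    by (auto simp: set_Cons_def tens_pure pairing_pure)
qed (simp_all add: additive_def tens_add_left pairing_add tract_add vecAD(2)[OF assms(2)] assms(3))

lemma almost_complexD:
  assumes "almost_complex J" "\<xi> \<in> Omega 1"
  shows "J \<xi> \<in> Omega 1"
    and "\<eta> \<in> Omega 1 \<Longrightarrow> J (\<xi> + \<eta>) = J \<xi> + J \<eta>"
    and "a \<in> Omega 0 \<Longrightarrow> J (a * \<xi>) = a * J \<xi>"
    and "a \<in> Omega 0 \<Longrightarrow> J (\<xi> * a) = J \<xi> * a"
    and "J (J \<xi>) = - \<xi>"
  using assms(1)[unfolded almost_complex_def, THEN conjunct1]
    assms(1)[unfolded almost_complex_def, THEN conjunct2, THEN conjunct1]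
    assms(1)[unfolded almost_complex_def, THEN conjunct2, THEN conjunct2, THEN conjunct1]
    assms(1)[unfolded almost_complex_def, THEN conjunct2, THEN conjunct2, THEN conjunct2,
      THEN conjunct2, THEN conjunct1] assms(2)
  by simp_all

lemma tensorial_J_id:
  assumes "almost_complex J"
  shows "tensorial (listset [FS, FS])
     (\<lambda>ws. case ws of [Form \<xi>, Form \<eta>] \<Rightarrow> pure [Form (J \<xi>), Form \<eta>] | _ \<Rightarrow> 0)"
proof -
  note J = almost_complexD[OF assms]
  show ?thesis
    unfolding listset.simps
  proof (intro tensorial_Cons saturated_set_Cons saturated_Nil tensorial_Nil kinds, goal_cases)
    case (1 s t z)
    then show ?case
      by (auto simp: set_Cons_def J pure_Form_add)
  next
    case (2 s s' t z)
    then show ?case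
      using pure_add[OF kinds(2), of s' t "[Form (J \<xi>)]" "[]" for \<xi>] by auto
  next
    \<comment> \<open>Balancedness of \<open>J \<otimes> id\<close> comes from right linearity of
      \<open>J\<close>.\<close>
    case (4 s t q a)
    then show ?case
      using pure_bal[of a "Form (J \<xi>)" t "[]" "[]" for \<xi>] by (auto simp: set_Cons_def J Form_slots)
  qed auto
qed

lemma additive_J_id: "almost_complex J \<Longrightarrow> additive (J_id J)"
  unfolding J_id_def by (rule textend_additive[OF tensorial_J_id])

lemma J_id_pure:
  "almost_complex J \<Longrightarrow> \<xi> \<in> Omega 1 \<Longrightarrow> \<eta> \<in> Omega 1 \<Longrightarrow>
   J_id J (pure [Form \<xi>, Form \<eta>]) = pure [Form (J \<xi>), Form \<eta>]"
  unfolding J_id_def by (subst textend_pure[OF tensorial_J_id]) (auto simp: set_Cons_def)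

section \<open>Connections\<close>

declare listset.simps [simp del]

lemma Omega_sum: "(\<And>i. i \<in> I \<Longrightarrow> f i \<in> Omega n) \<Longrightarrow> (\<Sum>i\<in>I. f i) \<in> Omega n"
  by (induction I rule: infinite_finite_induct) (auto intro: Omega_add Omega_zero)

lemma vecA_zero: "(\<lambda>_. 0) \<in> vecA"
  by (rule vecAI) (auto simp: Omega_zero)

lemma vecA_apply_sum:
  assumes "v \<in> vecA" "\<And>i. i \<in> I \<Longrightarrow> f i \<in> Omega 1"
  shows "v (\<Sum>i\<in>I. f i) = (\<Sum>i\<in>I. v (f i))"
proof -
  have "v 0 = 0" using vecAD(3)[OF assms(1) Omega_zero Omega_zero] by simp
  then show ?thesis
    using assms(2)
    by (induction I rule: infinite_finite_induct) (simp_all add: vecAD(3)[OF assms(1)] Omega_sum)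
qed

lemma pure_Vect_add:
  assumes "v \<in> vecA" "w \<in> vecA"
  shows "pure (Vect (\<lambda>\<xi>. v \<xi> + w \<xi>) # q) = pure (Vect v # q) + pure (Vect w # q)"
  using pure_add[OF kinds(3), of "Vect v" "Vect w" "[]" q] assms by simp

lemma pure_Vect_zero: "pure (Vect (\<lambda>_. 0) # q) = 0"
  using pure_Vect_add[OF vecA_zero vecA_zero, of q] by simp

lemma vecA_sum: "(\<And>i. i \<in> I \<Longrightarrow> w i \<in> vecA) \<Longrightarrow> (\<lambda>\<xi>. \<Sum>i\<in>I. w i \<xi>) \<in> vecA"
  by (induction I rule: infinite_finite_induct) (auto intro: vecA_zero vecA_add)

lemma pure_Vect_sum:
  "(\<And>i. i \<in> I \<Longrightarrow> w i \<in> vecA) \<Longrightarrow> pure (Vect (\<lambda>\<xi>. \<Sum>i\<in>I. w i \<xi>) # q) = (\<Sum>i\<in>I. pure (Vect (w i) # q))"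
  by (induction I rule: infinite_finite_induct) (auto simp: pure_Vect_zero pure_Vect_add vecA_sum)

text \<open>The target is the copy of the 1-forms inside \<open>tensor\<close>, because that is
  where \<open>contract\<close> and \<open>pairing\<close> take their values.\<close>

definition right_linear :: "('w::star_dga \<Rightarrow> 'w tensor) \<Rightarrow> bool" where
  "right_linear \<phi> \<longleftrightarrow> (\<forall>\<xi>\<in>Omega 1. \<phi> \<xi> \<in> tspan (listset [FS])) \<and>
     (\<forall>\<xi>\<in>Omega 1. \<forall>\<eta>\<in>Omega 1. \<phi> (\<xi> + \<eta>) = \<phi> \<xi> + \<phi> \<eta>) \<and>
     (\<forall>\<xi>\<in>Omega 1. \<forall>a\<in>Omega 0. \<phi> (\<xi> * a) = tract (\<phi> \<xi>) a)"

lemma right_linearD: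
  assumes "right_linear \<phi>" "\<xi> \<in> Omega 1"
  shows "\<phi> \<xi> \<in> tspan (listset [FS])"
    and "\<eta> \<in> Omega 1 \<Longrightarrow> \<phi> (\<xi> + \<eta>) = \<phi> \<xi> + \<phi> \<eta>"
    and "a \<in> Omega 0 \<Longrightarrow> \<phi> (\<xi> * a) = tract (\<phi> \<xi>) a"
  using assms unfolding right_linear_def by blast+

lemma right_linear_sum:
  assumes "right_linear \<phi>" "\<And>i. i \<in> I \<Longrightarrow> f i \<in> Omega 1"
  shows "\<phi> (\<Sum>i\<in>I. f i) = (\<Sum>i\<in>I. \<phi> (f i))"
proof -
  have "\<phi> 0 = 0" using right_linearD(2)[OF assms(1) Omega_zero Omega_zero] by simp
  then show ?thesis
    using assms(2)
    by (induction I rule: infinite_finite_induct) (simp_all add: right_linearD(2)[OF assms(1)] Omega_sum)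
qed

lemma FS_lists_slots: "listset [FS] \<subseteq> lists slots - {[]}"
  by (auto simp: listset_single listset_pair Form_slots)

lemma tract_pure_Form: "a \<in> Omega 0 \<Longrightarrow> tract (pure [Form \<xi>]) a = pure [Form (\<xi> * a)]"
  using tract_pure[of a "[]" "Form \<xi>"] by simp

lemma pure_Form_in: "\<xi> \<in> Omega 1 \<Longrightarrow> pure [Form \<xi>] \<in> tspan (listset [FS])"
  by (rule tspan_pure) (simp add: listset_single listset_pair)

lemma pure_FF_in: "\<xi> \<in> Omega 1 \<Longrightarrow> \<eta> \<in> Omega 1 \<Longrightarrow> pure [Form \<xi>, Form \<eta>] \<in> tspan (listset [FS, FS])"
  by (rule tspan_pure) (auto simp: listset_single listset_pair)

lemma pure_FV_in: "\<xi> \<in> Omega 1 \<Longrightarrow> v \<in> V \<Longrightarrow> pure [Form \<xi>, Vect v] \<in> tspan (listset [FS, Vect ` V])"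
  by (rule tspan_pure) (auto simp: listset_single listset_pair)

lemma contract_FF_in:
  assumes "v \<in> vecA" "x \<in> tspan (listset [FS, FS])"
  shows "contract v x \<in> tspan (listset [FS])"
proof (rule tspan_mapI[OF assms(2) additive_contract[OF assms(1)]])
  fix w :: "'a slot list" assume "w \<in> listset [FS, FS]"
  then obtain \<xi> \<eta> where "w = [Form \<xi>, Form \<eta>]" "\<xi> \<in> Omega 1" "\<eta> \<in> Omega 1"
    unfolding listset_pair by auto
  then show "contract v (pure w) \<in> tspan (listset [FS])"
    using assms(1) pure_Form_in[of "v \<xi> * \<eta>"] by (simp add: contract_pure Form_slots Omega_0_mult vecAD(2))
qed

section \<open>The dual basis isomorphism\<close>

locale finite_calculus =
  fixes N :: nat and e :: "nat \<Rightarrow> 'w::star_dga" and u :: "nat \<Rightarrow> 'w \<Rightarrow> 'w"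
  assumes basis: "dual_basis N e u"
begin

lemma e_in: "i < N \<Longrightarrow> e i \<in> Omega 1" and u_in: "i < N \<Longrightarrow> u i \<in> vecA"
  and expand: "\<xi> \<in> Omega 1 \<Longrightarrow> (\<Sum>i<N. e i * u i \<xi>) = \<xi>"
  using basis unfolding dual_basis_def by auto

text \<open>The isomorphism from the right module maps \<open>\<Omega>\<^sup>1A \<rightarrow> \<Omega>\<^sup>1A\<close> onto
  \<open>\<Omega>\<^sup>1A \<otimes>\<^sub>A Vec A\<close>, inverse to the pairing.\<close>

definition of_map :: "('w \<Rightarrow> 'w tensor) \<Rightarrow> 'w tensor" where
  "of_map \<phi> = (\<Sum>i<N. \<phi> (e i) \<otimes> pure [Vect (u i)])"

lemma of_map_cong: "(\<And>\<xi>. \<xi> \<in> Omega 1 \<Longrightarrow> \<phi> \<xi> = \<psi> \<xi>) \<Longrightarrow> of_map \<phi> = of_map \<psi>"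
  unfolding of_map_def by (rule sum.cong) (simp_all add: e_in)

lemma of_map_add: "of_map (\<lambda>\<xi>. \<phi> \<xi> + \<psi> \<xi>) = of_map \<phi> + of_map \<psi>"
  unfolding of_map_def by (simp add: tens_add_left sum.distrib)

lemma of_map_lact:
  assumes "a \<in> Omega 0" "right_linear \<phi>"
  shows "tlact a (of_map \<phi>) = of_map (\<lambda>\<xi>. tlact a (\<phi> \<xi>))"
proof -
  have "tlact a (\<phi> (e i) \<otimes> pure [Vect (u i)]) = tlact a (\<phi> (e i)) \<otimes> pure [Vect (u i)]" if "i < N" for i
  proof (rule tlact_tens[OF assms(1)], rule tspan_mono)
    show "\<phi> (e i) \<in> tspan (listset [FS])" by (rule right_linearD(1)[OF assms(2) e_in[OF that]])
  qed (auto simp: listset_single)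
  then show ?thesis
    unfolding of_map_def by (simp add: additive.sum[OF additive_tlact[OF assms(1)]])
qed

text \<open>Applying \<open>v\<close> to the dual basis expansion of a form gives v = \<Sum> v(e_j)
  u_j, and the scalars v(e_j) then move across the tensor sign.\<close>

lemma tens_Vect_expand:
  assumes "x \<in> tspan (listset [FS])" "v \<in> vecA"
  shows "x \<otimes> pure [Vect v] = (\<Sum>j<N. tract x (v (e j)) \<otimes> pure [Vect (u j)])"
proof -
  have "v \<xi> = (\<Sum>j<N. vec_lact (v (e j)) (u j) \<xi>)" for \<xi>
  proof (cases "\<xi> \<in> Omega 1")
    case True
    have "v \<xi> = v (\<Sum>j<N. e j * u j \<xi>)" by (simp add: expand True)
    also have "\<dots> = (\<Sum>j<N. v (e j * u j \<xi>))"
      by (rule vecA_apply_sum[OF assms(2)]) (simp add: e_in u_in Omega_mult_0 vecAD(2))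
    also have "\<dots> = (\<Sum>j<N. v (e j) * u j \<xi>)"
      by (rule sum.cong) (simp_all add: vecAD(4)[OF assms(2)] e_in vecAD(2)[OF u_in])
    finally show ?thesis by (simp add: vec_lact_def)
  next
    \<comment> \<open>Outside \<open>Omega 1\<close> both sides vanish by the convention for vector
      fields, so the equality holds as one of functions and can be used inside a letter.\<close>
    case False
    then show ?thesis using vecAD(1)[OF assms(2)] vecAD(1)[OF u_in] by (simp add: vec_lact_def)
  qed
  then have "pure [Vect v] = pure [Vect (\<lambda>\<xi>. \<Sum>j<N. vec_lact (v (e j)) (u j) \<xi>)]"
    by (metis (no_types) ext)
  also have "\<dots> = (\<Sum>j<N. pure [slot_lact (v (e j)) (Vect (u j))])"
    by (subst pure_Vect_sum) (simp_all add: vecA_lact u_in vecAD(2)[OF assms(2)])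
  finally have "x \<otimes> pure [Vect v] = (\<Sum>j<N. x \<otimes> pure [slot_lact (v (e j)) (Vect (u j))])"
    by (simp only: additive.sum[OF additive_tens_right])
  also have "\<dots> = (\<Sum>j<N. tract x (v (e j)) \<otimes> pure [Vect (u j)])"
    by (intro sum.cong refl tens_pure_lact vecAD(2)[OF assms(2)] tspan_mono[OF FS_lists_slots assms(1)])
       (simp add: Vect_slots u_in)
  finally show ?thesis .
qed

text \<open>With q the endomorphism \<Sum> e_i w_i of the 1-forms, the tensor \<Sum> \<phi>(e_i)
  \<otimes> w_i represents \<phi> composed with q: expand each w_i in the dual basis, move the
  coefficients to the left and resum. It serves for left multiplication by a scalar as q, and for
  the projection that splits off an eigenspace.\<close>

lemma of_map_comp:
  assumes \<phi>: "right_linear \<phi>" and w: "\<And>i. i < N \<Longrightarrow> w i \<in> vecA"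
    and q: "\<And>\<xi>. \<xi> \<in> Omega 1 \<Longrightarrow> (\<Sum>i<N. e i * w i \<xi>) = q \<xi>"
  shows "(\<Sum>i<N. \<phi> (e i) \<otimes> pure [Vect (w i)]) = of_map (\<lambda>\<xi>. \<phi> (q \<xi>))"
proof -
  have "(\<Sum>i<N. \<phi> (e i) \<otimes> pure [Vect (w i)]) =
      (\<Sum>i<N. \<Sum>j<N. tract (\<phi> (e i)) (w i (e j)) \<otimes> pure [Vect (u j)])"
    by (rule sum.cong) (simp_all add: tens_Vect_expand right_linearD(1)[OF \<phi>] e_in w)
  also have "\<dots> = (\<Sum>j<N. \<Sum>i<N. \<phi> (e i * w i (e j)) \<otimes> pure [Vect (u j)])"
    by (subst sum.swap) (simp add: right_linearD(3)[OF \<phi>] e_in vecAD(2)[OF w])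
  also have "\<dots> = (\<Sum>j<N. \<phi> (\<Sum>i<N. e i * w i (e j)) \<otimes> pure [Vect (u j)])"
    by (subst right_linear_sum[OF \<phi>])
       (simp_all add: additive.sum[OF additive_tens_left] Omega_mult_0 e_in vecAD(2)[OF w])
  finally show ?thesis unfolding of_map_def by (simp add: q e_in)
qed

lemma of_map_ract:
  assumes "right_linear \<phi>" "a \<in> Omega 0"
  shows "tract (of_map \<phi>) a = of_map (\<lambda>\<xi>. \<phi> (a * \<xi>))"
proof -
  have "tract (of_map \<phi>) a = (\<Sum>i<N. \<phi> (e i) \<otimes> pure [Vect (vec_ract (u i) a)])"
    unfolding of_map_def by (simp add: additive.sum[OF additive_tract[OF assms(2)]] tract_tens_pure assms(2))
  also have "\<dots> = of_map (\<lambda>\<xi>. \<phi> (a * \<xi>))"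
    by (rule of_map_comp[OF assms(1)]) (simp_all add: vecA_ract assms(2) u_in vec_ract_apply expand Omega_0_mult)
  finally show ?thesis .
qed

text \<open>One inverse law: on \<eta> \<otimes> v it is the dual basis expansion of v. The other
  one, \<open>pairing_of_map\<close>, is the expansion of the form at which the map is
  evaluated.\<close>

lemma of_map_pairing:
  assumes "t \<in> tspan (listset [FS, VS])"
  shows "of_map (pairing t) = t"
proof (rule tspan_eqI[OF assms])
  show "additive (\<lambda>t. of_map (pairing t))"
    unfolding additive_def of_map_def by (simp add: pairing_add e_in tens_add_left sum.distrib)
  fix w :: "'w slot list" assume "w \<in> listset [FS, VS]"
  then obtain \<eta> v where w: "w = [Form \<eta>, Vect v]" "\<eta> \<in> Omega 1" "v \<in> vecA"
    unfolding listset_pair by auto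
  have "pure w = pure [Form \<eta>] \<otimes> pure [Vect v]" by (simp add: tens_pure w(1))
  also have "\<dots> = (\<Sum>j<N. tract (pure [Form \<eta>]) (v (e j)) \<otimes> pure [Vect (u j)])"
    by (rule tens_Vect_expand) (simp_all only: pure_Form_in w)
  also have "\<dots> = of_map (pairing (pure w))"
    unfolding of_map_def w(1)
    by (rule sum.cong) (simp_all add: pairing_pure w e_in tract_pure_Form vecAD(2)[OF w(3)])
  finally show "of_map (pairing (pure w)) = pure w" ..
qed (simp add: additive_def)

lemma pairing_of_map:
  assumes "right_linear \<phi>" "\<xi> \<in> Omega 1"
  shows "pairing (of_map \<phi>) \<xi> = \<phi> \<xi>"
proof -
  have "pairing (of_map \<phi>) \<xi> = (\<Sum>i<N. \<phi> (e i * u i \<xi>))"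
    unfolding of_map_def
    by (simp add: additive.sum[OF additive_pairing[OF assms(2)]] pairing_tens right_linearD[OF assms(1)]
        e_in u_in assms(2) vecAD(2)[OF u_in])
  also have "\<dots> = \<phi> \<xi>"
    by (subst right_linear_sum[OF assms(1), symmetric])
       (simp_all add: expand assms(2) Omega_mult_0 e_in vecAD(2)[OF u_in])
  finally show ?thesis .
qed

lemma of_map_in:
  assumes "right_linear \<phi>"
  shows "of_map \<phi> \<in> tspan (listset [FS, VS])"
  unfolding of_map_def
proof (rule tspan_sum)
  fix i assume "i \<in> {..<N}"
  then show "\<phi> (e i) \<otimes> pure [Vect (u i)] \<in> tspan (listset [FS, VS])"
    by (intro tspan_tens[OF right_linearD(1)[OF assms] tspan_pure[of _ "{[Vect (u i)]}"]])
       (auto simp: listset_single listset_pair e_in u_in)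
qed

lemma of_map_elem:
  assumes "\<eta> \<in> Omega 1" "v \<in> vecA"
  shows "of_map (\<lambda>\<xi>. pure [Form (\<eta> * v \<xi>)]) = pure [Form \<eta>, Vect v]"
proof -
  have "of_map (\<lambda>\<xi>. pure [Form (\<eta> * v \<xi>)]) = of_map (pairing (pure [Form \<eta>, Vect v]))"
    by (rule of_map_cong) (simp add: pairing_pure assms)
  then show ?thesis by (simp only: of_map_pairing[OF pure_FV_in[OF assms]])
qed

end

section \<open>The dual connection and \<sigma> as right module maps\<close>

lemma extd_one: "extd (1::'w::star_dga) = 0"
  using extd_mult[OF Omega_one, of "1::'w"] by simp

lemma extd_0_mult: "a \<in> Omega 0 \<Longrightarrow> extd (a * b) = extd a * b + a * extd b"
  using extd_mult[of a 0 b] by simp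

lemma Omega_extd_0: "a \<in> Omega 0 \<Longrightarrow> extd a \<in> Omega 1"
  using Omega_extd[of a 0] by (simp add: One_nat_def)

locale connection = finite_calculus N e u
  for N :: nat and e :: "nat \<Rightarrow> 'w::star_dga" and u :: "nat \<Rightarrow> 'w \<Rightarrow> 'w" +
  fixes D :: "'w \<Rightarrow> 'w tensor" and \<sigma>inv :: "'w tensor \<Rightarrow> 'w tensor"
  assumes conn: "right_bimod_connection D \<sigma>inv"
begin

abbreviation "FF \<equiv> tspan (listset [FS, FS] :: 'w slot list set)"

lemma conn_facts:
  shows "x \<in> FF \<Longrightarrow> \<sigma>inv x \<in> FF"
    and "x \<in> FF \<Longrightarrow> y \<in> FF \<Longrightarrow> \<sigma>inv (x + y) = \<sigma>inv x + \<sigma>inv y"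
    and "x \<in> FF \<Longrightarrow> a \<in> Omega 0 \<Longrightarrow> \<sigma>inv (tlact a x) = tlact a (\<sigma>inv x)"
    and "x \<in> FF \<Longrightarrow> a \<in> Omega 0 \<Longrightarrow> \<sigma>inv (tract x a) = tract (\<sigma>inv x) a"
    and "\<xi> \<in> Omega 1 \<Longrightarrow> D \<xi> \<in> FF"
    and "\<xi> \<in> Omega 1 \<Longrightarrow> \<eta> \<in> Omega 1 \<Longrightarrow> D (\<xi> + \<eta>) = D \<xi> + D \<eta>"
    and "\<xi> \<in> Omega 1 \<Longrightarrow> a \<in> Omega 0 \<Longrightarrow> D (\<xi> * a) = tract (D \<xi>) a + pure [Form \<xi>, Form (extd a)]"
    and "\<xi> \<in> Omega 1 \<Longrightarrow> a \<in> Omega 0 \<Longrightarrow> D (a * \<xi>) = tlact a (D \<xi>) + \<sigma>inv (pure [Form (extd a), Form \<xi>])"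
  using conn unfolding right_bimod_connection_def by - (elim conjE, simp only: ball_simps)+

definition dmap :: "('w \<Rightarrow> 'w) \<Rightarrow> 'w \<Rightarrow> 'w tensor" where
  "dmap v \<xi> = pure [Form (extd (v \<xi>))] - contract v (D \<xi>)"

definition smap :: "('w \<Rightarrow> 'w) \<Rightarrow> 'w \<Rightarrow> 'w \<Rightarrow> 'w tensor" where
  "smap v \<eta> \<xi> = contract v (\<sigma>inv (pure [Form \<eta>, Form \<xi>]))"

abbreviation "box \<equiv> dual_connection D"
abbreviation "sig \<equiv> sigma \<sigma>inv N e u"

lemma FF_form: "x \<in> FF \<Longrightarrow> x \<in> tspan form_words"
  by (rule tspan_mono[OF FF_form_words])

lemma \<sigma>inv_pure:
  assumes "\<eta> \<in> Omega 1" "\<xi> \<in> Omega 1"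
  shows "\<sigma>inv (pure [Form \<eta>, Form \<xi>]) \<in> FF"
  by (rule conn_facts(1)[OF pure_FF_in[OF assms]])

lemma pure_FF_add_right:
  "\<xi> \<in> Omega 1 \<Longrightarrow> \<xi>' \<in> Omega 1 \<Longrightarrow> pure [Form \<eta>, Form (\<xi> + \<xi>')] = pure [Form \<eta>, Form \<xi>] + pure [Form \<eta>, Form \<xi>']"
  using pure_add[OF kinds(2), of "Form \<xi>" "Form \<xi>'" "[Form \<eta>]" "[]"] by simp

text \<open>Neither term is right linear by itself. On \<xi>a both the derivative of v(\<xi>)a and
  the contraction of \<box>(\<xi>a) contribute v(\<xi>) da, and the two contributions
  cancel.\<close>

lemma right_linear_dmap:
  assumes "v \<in> vecA"
  shows "right_linear (dmap v)"
  unfolding right_linear_def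
proof (intro conjI ballI)
  fix \<xi> :: 'w assume \<xi>: "\<xi> \<in> Omega 1"
  note v = vecAD[OF assms]
  show "dmap v \<xi> \<in> tspan (listset [FS])"
    unfolding dmap_def by (intro tspan_diff pure_Form_in contract_FF_in conn_facts Omega_extd_0 v assms \<xi>)
  show "dmap v (\<xi> + \<eta>) = dmap v \<xi> + dmap v \<eta>" if "\<eta> \<in> Omega 1" for \<eta>
    using that \<xi> by (simp add: dmap_def v extd_add pure_Form_add Omega_extd_0 conn_facts contract_add assms)
  fix a :: 'w assume a: "a \<in> Omega 0"
  have "contract v (pure [Form \<xi>, Form (extd a)]) = pure [Form (v \<xi> * extd a)]"
    using \<xi> a assms by (simp add: contract_pure Form_slots Omega_extd_0)
  moreover have "pure [Form (extd (v \<xi>) * a + v \<xi> * extd a)] = pure [Form (extd (v \<xi>) * a)] + pure [Form (v \<xi> * extd a)]"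
    by (rule pure_Form_add) (simp_all add: Omega_0_mult Omega_mult_0 Omega_extd_0 a v)
  ultimately show "dmap v (\<xi> * a) = tract (dmap v \<xi>) a"
    using \<xi> a
    by (simp add: dmap_def v extd_0_mult conn_facts contract_add assms contract_tract_FF
        additive.diff[OF additive_tract] tract_pure_Form)
qed

lemma right_linear_smap:
  assumes "v \<in> vecA" "\<eta> \<in> Omega 1"
  shows "right_linear (smap v \<eta>)"
  unfolding right_linear_def
proof (intro conjI ballI)
  fix \<xi> :: 'w assume \<xi>: "\<xi> \<in> Omega 1"
  show "smap v \<eta> \<xi> \<in> tspan (listset [FS])"
    unfolding smap_def by (intro contract_FF_in \<sigma>inv_pure assms \<xi>)
  show "smap v \<eta> (\<xi> + \<xi>') = smap v \<eta> \<xi> + smap v \<eta> \<xi>'" if "\<xi>' \<in> Omega 1" for \<xi>'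
    unfolding smap_def pure_FF_add_right[OF \<xi> that]
      conn_facts(2)[OF pure_FF_in[OF assms(2) \<xi>] pure_FF_in[OF assms(2) that]]
    by (rule contract_add[OF assms(1)])
  fix a :: 'w assume a: "a \<in> Omega 0"
  have "pure [Form \<eta>, Form (\<xi> * a)] = tract (pure [Form \<eta>, Form \<xi>]) a"
    using tract_pure[OF a, of "[Form \<eta>]" "Form \<xi>"] by simp
  then show "smap v \<eta> (\<xi> * a) = tract (smap v \<eta> \<xi>) a"
    unfolding smap_def
    by (simp only: conn_facts(4)[OF pure_FF_in[OF assms(2) \<xi>] a] contract_tract_FF[OF a assms(1) \<sigma>inv_pure[OF assms(2) \<xi>]])
qed

text \<open>The defining equation prescribes the pairing of the dual connection with every form. As
  pairing is inverse to \<open>of_map\<close> on right module maps, it has exactly one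
  solution.\<close>

lemma box_eq:
  assumes "v \<in> vecA"
  shows "box v = of_map (dmap v)"
  unfolding dual_connection_def
proof (rule the_equality)
  show "of_map (dmap v) \<in> tspan (listset [FS, VS]) \<and>
    (\<forall>\<xi>\<in>Omega 1. pure [Form (extd (v \<xi>))] = pairing (of_map (dmap v)) \<xi> + contract v (D \<xi>))"
    using of_map_in[OF right_linear_dmap[OF assms]]
    by (simp add: pairing_of_map[OF right_linear_dmap[OF assms]] dmap_def)
next
  fix t :: "'w tensor" assume t: "t \<in> tspan (listset [FS, VS]) \<and>
    (\<forall>\<xi>\<in>Omega 1. pure [Form (extd (v \<xi>))] = pairing t \<xi> + contract v (D \<xi>))"
  then have "of_map (pairing t) = of_map (dmap v)"
    by (intro of_map_cong) (simp add: dmap_def)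
  then show "t = of_map (dmap v)" using of_map_pairing t by simp
qed

lemma sig_eq: "sig v \<eta> = of_map (smap v \<eta>)"
  unfolding sigma_def of_map_def smap_def ..

lemma box_in: "v \<in> vecA \<Longrightarrow> box v \<in> tspan (listset [FS, VS])"
  by (simp add: box_eq of_map_in right_linear_dmap)

lemma sig_in: "v \<in> vecA \<Longrightarrow> \<eta> \<in> Omega 1 \<Longrightarrow> sig v \<eta> \<in> tspan (listset [FS, VS])"
  by (simp add: sig_eq of_map_in right_linear_smap)

lemma box_add:
  assumes "v \<in> vecA" "w \<in> vecA"
  shows "box (\<lambda>\<xi>. v \<xi> + w \<xi>) = box v + box w"
  unfolding box_eq[OF vecA_add[OF assms]] box_eq[OF assms(1)] box_eq[OF assms(2)] of_map_add[symmetric]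
  by (rule of_map_cong)
     (simp add: dmap_def extd_add pure_Form_add Omega_extd_0 vecAD(2)[OF assms(1)] vecAD(2)[OF assms(2)]
        contract_add_left assms FF_form conn_facts)

text \<open>The dual of a right connection is a left connection: da \<otimes> v comes from
  differentiating a v(\<xi>), while contraction with a.v merely pulls a out.\<close>

lemma box_lact:
  assumes "a \<in> Omega 0" "v \<in> vecA"
  shows "box (vec_lact a v) = tlact a (box v) + pure [Form (extd a), Vect v]"
proof -
  note v = vecAD[OF assms(2)]
  have "box (vec_lact a v) = of_map (dmap (vec_lact a v))"
    by (rule box_eq) (rule vecA_lact[OF assms])
  also have "\<dots> = of_map (\<lambda>\<xi>. tlact a (dmap v \<xi>) + pure [Form (extd a * v \<xi>)])"
  proof (rule of_map_cong)
    fix \<xi> :: 'w assume \<xi>: "\<xi> \<in> Omega 1"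
    have "pure [Form (extd (a * v \<xi>))] = pure [Form (extd a * v \<xi>)] + tlact a (pure [Form (extd (v \<xi>))])"
      by (simp add: extd_0_mult assms(1) pure_Form_add Omega_extd_0 v Omega_0_mult Omega_mult_0 tlact_pure)
    then show "dmap (vec_lact a v) \<xi> = tlact a (dmap v \<xi>) + pure [Form (extd a * v \<xi>)]"
      unfolding dmap_def
      by (simp add: vec_lact_apply contract_lact assms FF_form conn_facts(5) \<xi> additive.diff[OF additive_tlact[OF assms(1)]])
  qed
  also have "\<dots> = tlact a (box v) + pure [Form (extd a), Vect v]"
    by (simp add: of_map_add of_map_lact box_eq right_linear_dmap assms of_map_elem Omega_extd_0)
  finally show ?thesis .
qed

text \<open>The twisted half of the Leibniz rule: (v.a)(\<xi>) = v(a\<xi>), and the rule for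
  \<box>(a\<xi>) contributes \<open>\<sigma>inv\<close> of da \<otimes> \<xi>, whose contraction
  with v is the map of \<sigma>(v \<otimes> da).\<close>

lemma box_ract:
  assumes "a \<in> Omega 0" "v \<in> vecA"
  shows "box (vec_ract v a) = tract (box v) a + sig v (extd a)"
proof -
  have "box (vec_ract v a) = of_map (dmap (vec_ract v a))"
    by (rule box_eq) (rule vecA_ract[OF assms])
  also have "\<dots> = of_map (\<lambda>\<xi>. dmap v (a * \<xi>) + smap v (extd a) \<xi>)"
  proof (rule of_map_cong)
    fix \<xi> :: 'w assume \<xi>: "\<xi> \<in> Omega 1"
    show "dmap (vec_ract v a) \<xi> = dmap v (a * \<xi>) + smap v (extd a) \<xi>"
      unfolding dmap_def smap_def
      by (simp add: vec_ract_apply contract_ract assms FF_form conn_facts \<xi> contract_add)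
  qed
  also have "\<dots> = tract (box v) a + sig v (extd a)"
    by (simp add: of_map_add of_map_ract box_eq sig_eq right_linear_dmap assms)
  finally show ?thesis .
qed

text \<open>Left linearity of \<open>\<sigma>inv\<close>. It makes \<sigma> balanced over A, and
  later lets the coefficient of a.db be absorbed into the vector field.\<close>

lemma smap_mult:
  assumes "a \<in> Omega 0" "v \<in> vecA" "\<eta> \<in> Omega 1" "\<xi> \<in> Omega 1"
  shows "smap v (a * \<eta>) \<xi> = smap (vec_ract v a) \<eta> \<xi>"
proof -
  have "pure [Form (a * \<eta>), Form \<xi>] = tlact a (pure [Form \<eta>, Form \<xi>])"
    by (simp add: tlact_pure assms(1))
  then show ?thesis
    by (simp only: smap_def contract_ract[OF assms(1,2) FF_form[OF \<sigma>inv_pure[OF assms(3,4)]]]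
        conn_facts(3)[OF pure_FF_in[OF assms(3,4)] assms(1)])
qed

lemma smap_add_left:
  assumes "v \<in> vecA" "\<eta> \<in> Omega 1" "\<eta>' \<in> Omega 1" "\<xi> \<in> Omega 1"
  shows "smap v (\<eta> + \<eta>') \<xi> = smap v \<eta> \<xi> + smap v \<eta>' \<xi>"
  by (simp add: smap_def pure_Form_add conn_facts(2) pure_FF_in contract_add assms)

lemma sig_add_left:
  assumes "v \<in> vecA" "w \<in> vecA" "\<eta> \<in> Omega 1"
  shows "sig (\<lambda>\<xi>. v \<xi> + w \<xi>) \<eta> = sig v \<eta> + sig w \<eta>"
  unfolding sig_eq of_map_add[symmetric]
  by (rule of_map_cong) (simp add: smap_def contract_add_left assms FF_form \<sigma>inv_pure)

lemma sig_add_right: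
  assumes "v \<in> vecA" "\<eta> \<in> Omega 1" "\<eta>' \<in> Omega 1"
  shows "sig v (\<eta> + \<eta>') = sig v \<eta> + sig v \<eta>'"
  unfolding sig_eq of_map_add[symmetric] by (rule of_map_cong) (simp add: smap_add_left assms)

lemma sig_lact:
  assumes "a \<in> Omega 0" "v \<in> vecA" "\<eta> \<in> Omega 1"
  shows "sig (vec_lact a v) \<eta> = tlact a (sig v \<eta>)"
  unfolding sig_eq of_map_lact[OF assms(1) right_linear_smap[OF assms(2,3)]]
  by (rule of_map_cong) (simp add: smap_def contract_lact assms FF_form \<sigma>inv_pure)

lemma sig_ract_left:
  assumes "a \<in> Omega 0" "v \<in> vecA" "\<eta> \<in> Omega 1"
  shows "sig (vec_ract v a) \<eta> = sig v (a * \<eta>)"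
  unfolding sig_eq by (rule of_map_cong) (simp add: smap_mult assms)

lemma sig_ract_right:
  assumes "a \<in> Omega 0" "v \<in> vecA" "\<eta> \<in> Omega 1"
  shows "sig v (\<eta> * a) = tract (sig v \<eta>) a"
  unfolding sig_eq of_map_ract[OF right_linear_smap[OF assms(2,3)] assms(1)]
proof (rule of_map_cong)
  fix \<xi> :: 'w assume \<xi>: "\<xi> \<in> Omega 1"
  show "smap v (\<eta> * a) \<xi> = smap v \<eta> (a * \<xi>)"
    using pure_bal[of a "Form \<eta>" "Form \<xi>" "[]" "[]"] assms \<xi> by (simp add: smap_def Form_slots)
qed

lemma FV_lists_slots: "x \<in> tspan (listset [FS, VS]) \<Longrightarrow> x \<in> tspan (lists slots - {[]})"
  by (erule tspan_mono[rotated]) (auto simp: listset_pair Form_slots Vect_slots)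

lemma FV_nonempty: "x \<in> tspan (listset [FS, VS]) \<Longrightarrow> x \<in> tspan (- {[]})"
  by (erule tspan_mono[rotated]) (auto simp: listset_pair)

section \<open>\<sigma> on the first two factors\<close>

lemma tensorial_sigma_id:
  assumes "v \<in> vecA"
  shows "tensorial form_words (\<lambda>ws. case ws of Form \<eta> # zs \<Rightarrow> sig v \<eta> \<otimes> pure zs | _ \<Rightarrow> 0)"
  unfolding form_words_eq
proof (rule tensorial_Cons, goal_cases)
  case (3 s t z)
  then show ?case by (auto simp: sig_add_right assms tens_add_left)
next
  case (4 s)
  then obtain \<xi> where "s = Form \<xi>" by auto
  then show ?case
    by (intro tensorial_comp[OF saturated_lists_slots additive_tens_right[of "sig v \<xi>"]]) simp_all
next
  case (5 s t q a)
  then show ?case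
    using tens_pure_lact[OF _ FV_lists_slots[OF sig_in], of a v _ t q] assms
    by (auto simp: sig_ract_right)
qed (simp_all add: saturated_lists_slots)

abbreviation "sid \<equiv> sigma_id sig"

lemma additive_sid: "v \<in> vecA \<Longrightarrow> additive (sid v)"
  unfolding sigma_id_def by (rule textend_additive[OF tensorial_sigma_id])

lemmas sid_add_right = additive.add[OF additive_sid]

lemma sid_pure:
  "v \<in> vecA \<Longrightarrow> \<xi> \<in> Omega 1 \<Longrightarrow> zs \<in> lists slots \<Longrightarrow> sid v (pure (Form \<xi> # zs)) = sig v \<xi> \<otimes> pure zs"
  unfolding sigma_id_def by (subst textend_pure[OF tensorial_sigma_id]) (auto simp: form_words_eq set_Cons_def)

lemma sid_add_left:
  assumes "v \<in> vecA" "v' \<in> vecA" "x \<in> tspan form_words"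
  shows "sid (\<lambda>\<xi>. v \<xi> + v' \<xi>) x = sid v x + sid v' x"
proof (rule tspan_eqI[OF assms(3)])
  fix w :: "'w slot list" assume "w \<in> form_words"
  then obtain \<xi> zs where "w = Form \<xi> # zs" "\<xi> \<in> Omega 1" "zs \<in> lists slots" by (rule form_wordsE)
  then show "sid (\<lambda>\<xi>. v \<xi> + v' \<xi>) (pure w) = sid v (pure w) + sid v' (pure w)"
    using assms by (simp add: sid_pure sid_pure[OF vecA_add[OF assms(1,2)]] sig_add_left tens_add_left)
qed (simp_all add: assms additive_def sid_add_right sid_add_right[OF vecA_add[OF assms(1,2)]] ac_simps)

lemma sid_lact:
  assumes "a \<in> Omega 0" "v \<in> vecA" "x \<in> tspan form_words"
  shows "sid (vec_lact a v) x = tlact a (sid v x)"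
proof (rule tspan_eqI[OF assms(3)])
  fix w :: "'w slot list" assume "w \<in> form_words"
  then obtain \<xi> zs where "w = Form \<xi> # zs" "\<xi> \<in> Omega 1" "zs \<in> lists slots" by (rule form_wordsE)
  then show "sid (vec_lact a v) (pure w) = tlact a (sid v (pure w))"
    using assms by (simp add: sid_pure vecA_lact sig_lact tlact_tens[OF assms(1) FV_nonempty[OF sig_in]])
qed (simp_all add: assms additive_def sid_add_right tlact_add vecA_lact)

lemma sid_ract:
  assumes "a \<in> Omega 0" "v \<in> vecA" "x \<in> tspan form_words"
  shows "sid (vec_ract v a) x = sid v (tlact a x)"
proof (rule tspan_eqI[OF assms(3)])
  fix w :: "'w slot list" assume "w \<in> form_words"
  then obtain \<xi> zs where "w = Form \<xi> # zs" "\<xi> \<in> Omega 1" "zs \<in> lists slots" by (rule form_wordsE)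
  then show "sid (vec_ract v a) (pure w) = sid v (tlact a (pure w))"
    using assms by (simp add: sid_pure vecA_ract sig_ract_left tlact_pure Omega_0_mult)
qed (simp_all add: assms additive_def sid_add_right tlact_add vecA_ract)

text \<open>The properties of \<open>V \<subseteq> Vec A\<close> that make its tensor powers closed under the bullet product;
  they hold for \<open>Vec A\<close> itself and for the eigenspaces of \<open>J\<close>.\<close>

definition stable :: "('w \<Rightarrow> 'w) set \<Rightarrow> bool" where
  "stable V \<longleftrightarrow> V \<subseteq> vecA \<and>
     (\<forall>v\<in>V. \<forall>a\<in>Omega 0. vec_lact a v \<in> V \<and> vec_ract v a \<in> V) \<and>
     (\<forall>v\<in>V. box v \<in> tspan (listset [FS, Vect ` V])) \<and>
     (\<forall>v\<in>V. \<forall>\<eta>\<in>Omega 1. sig v \<eta> \<in> tspan (listset [FS, Vect ` V]))"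

lemma stableD:
  assumes "stable V"
  shows "v \<in> V \<Longrightarrow> v \<in> vecA"
    and "v \<in> V \<Longrightarrow> a \<in> Omega 0 \<Longrightarrow> vec_lact a v \<in> V"
    and "v \<in> V \<Longrightarrow> a \<in> Omega 0 \<Longrightarrow> vec_ract v a \<in> V"
    and "v \<in> V \<Longrightarrow> box v \<in> tspan (listset [FS, Vect ` V])"
    and "v \<in> V \<Longrightarrow> \<eta> \<in> Omega 1 \<Longrightarrow> sig v \<eta> \<in> tspan (listset [FS, Vect ` V])"
  using assms unfolding stable_def by blast+

lemma stable_vecA: "stable vecA"
  unfolding stable_def by (simp add: vecA_lact vecA_ract box_in sig_in)

end

section \<open>Eigenspaces of the almost complex structure\<close>

lemma scaleC_one_in: "c *\<^sub>C 1 \<in> Omega 0"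
  by (intro Omega_scaleC Omega_one)

lemma scaleC_zero: "c *\<^sub>C 0 = (0::'w::star_dga)"
  using scaleC_add_right[of c 0 "0::'w"] by simp

lemma scaleC_minus_one: "(- 1) *\<^sub>C x = - (x::'w::star_dga)"
proof -
  have "0 *\<^sub>C x = 0" using scaleC_add_left[of 0 0 x] by simp
  then show ?thesis
    using scaleC_add_left[of "-1" 1 x] by (simp add: scaleC_one eq_neg_iff_add_eq_0)
qed

lemma extd_scaleC_one: "extd (c *\<^sub>C (1::'w::star_dga)) = 0"
  by (simp add: extd_scaleC extd_one scaleC_zero)

lemma scaleC_zero_left: "0 *\<^sub>C x = (0::'w::star_dga)"
  using scaleC_add_left[of 0 0 x] by simp

text \<open>A common form for both eigenspaces; the arguments below use only that c squares to
  -1.\<close>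

definition eigen :: "('w::star_dga \<Rightarrow> 'w) \<Rightarrow> complex \<Rightarrow> ('w \<Rightarrow> 'w) set" where
  "eigen J c = {v \<in> vecA. \<forall>\<xi>\<in>Omega 1. v (J \<xi>) = c *\<^sub>C v \<xi>}"

lemma eigen_vecJ: "{v \<in> vecA. vecJ J v = (\<lambda>\<xi>. c *\<^sub>C v \<xi>)} = eigen J c"
  unfolding eigen_def vecJ_def by (auto simp: fun_eq_iff scaleC_zero vecAD(1))

locale complex_connection = connection N e u D \<sigma>inv
  for N :: nat and e :: "nat \<Rightarrow> 'w::star_dga" and u :: "nat \<Rightarrow> 'w \<Rightarrow> 'w"
    and D :: "'w \<Rightarrow> 'w tensor" and \<sigma>inv :: "'w tensor \<Rightarrow> 'w tensor" +
  fixes J :: "'w \<Rightarrow> 'w"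
  assumes J: "almost_complex J"
    and D_J: "\<xi> \<in> Omega 1 \<Longrightarrow> J_id J (D \<xi>) = D (J \<xi>)"
begin

lemma J_scaleC: "\<xi> \<in> Omega 1 \<Longrightarrow> J (c *\<^sub>C \<xi>) = c *\<^sub>C J \<xi>"
  using almost_complexD(3)[OF J, of \<xi> "c *\<^sub>C 1"] by (simp add: scaleC_one_in mult_scaleC_left)

lemma vecA_scaleC: "v \<in> vecA \<Longrightarrow> \<xi> \<in> Omega 1 \<Longrightarrow> v (c *\<^sub>C \<xi>) = c *\<^sub>C v \<xi>"
  using vecAD(4)[of v \<xi> "c *\<^sub>C 1"] by (simp add: scaleC_one_in mult_scaleC_right)

lemma vecJ_in: "v \<in> vecA \<Longrightarrow> vecJ J v \<in> vecA"
  by (rule vecAI)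
     (auto simp: vecJ_def vecAD Omega_add Omega_mult_0 almost_complexD[OF J])

text \<open>For c squared equal to -1 this is twice the projection of the 1-forms onto the
  eigenspace of \<open>J\<close> for -c, on which vector fields of eigenvalue c vanish.\<close>

abbreviation "pr c \<xi> \<equiv> \<xi> + c *\<^sub>C J \<xi>"

lemma pr_in: "\<xi> \<in> Omega 1 \<Longrightarrow> pr c \<xi> \<in> Omega 1"
  by (intro Omega_add Omega_scaleC almost_complexD(1)[OF J])

text \<open>The representative in the definition of \<open>of_map\<close> has letters
  \<open>u i\<close> outside the eigenspace. Replacing them by their eigencomponents changes the
  tensor by one whose map is zero by hypothesis.\<close>

lemma of_map_eigen:
  assumes \<phi>: "right_linear \<phi>" and 0: "\<And>\<xi>. \<xi> \<in> Omega 1 \<Longrightarrow> \<phi> (pr c \<xi>) = 0" and c: "c * c = - 1"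
  shows "of_map \<phi> \<in> tspan (listset [FS, Vect ` eigen J c])"
proof -
  \<comment> \<open>\<open>p i\<close> and \<open>w i\<close> are the components of \<open>u i\<close> in the eigenspaces for \<open>c\<close> and \<open>- c\<close>; the
    \<open>w i\<close> contribute the map \<open>\<phi>(\<xi> + c J\<xi>) / 2\<close>.\<close>
  define p where "p i = (\<lambda>\<xi>. vec_lact ((1/2) *\<^sub>C 1) (u i) \<xi> + vec_lact ((- (c/2)) *\<^sub>C 1) (vecJ J (u i)) \<xi>)" for i
  define w where "w i = (\<lambda>\<xi>. vec_lact ((1/2) *\<^sub>C 1) (u i) \<xi> + vec_lact ((c/2) *\<^sub>C 1) (vecJ J (u i)) \<xi>)" for i
  have w: "w i \<in> vecA" and p: "p i \<in> vecA" if "i < N" for i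
    unfolding w_def p_def using that by (intro vecA_add vecA_lact scaleC_one_in vecJ_in u_in; assumption)+
  have p_eq: "p i \<xi> = (1/2) *\<^sub>C u i \<xi> + (- (c/2)) *\<^sub>C u i (J \<xi>)"
    and w_eq: "w i \<xi> = (1/2) *\<^sub>C u i \<xi> + (c/2) *\<^sub>C u i (J \<xi>)" if "\<xi> \<in> Omega 1" for i \<xi>
    using that by (simp_all add: p_def w_def vec_lact_def vecJ_def mult_scaleC_left)
  have "u i \<xi> = p i \<xi> + w i \<xi>" for i \<xi>
  proof -
    have "p i \<xi> + w i \<xi> = ((1/2) *\<^sub>C u i \<xi> + (1/2) *\<^sub>C u i \<xi>) + ((- (c/2)) *\<^sub>C vecJ J (u i) \<xi> + (c/2) *\<^sub>C vecJ J (u i) \<xi>)"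
      by (simp add: p_def w_def vec_lact_def mult_scaleC_left ac_simps)
    then show ?thesis
      by (simp add: scaleC_add_left[symmetric] scaleC_one scaleC_zero_left)
  qed
  then have "u i = (\<lambda>\<xi>. p i \<xi> + w i \<xi>)" for i by blast
  then have "pure [Vect (u i)] = pure [Vect (p i)] + pure [Vect (w i)]" if "i < N" for i
    using pure_Vect_add[OF p w, OF that that, of "[]"] by metis
  then have "of_map \<phi> = (\<Sum>i<N. \<phi> (e i) \<otimes> pure [Vect (p i)]) + (\<Sum>i<N. \<phi> (e i) \<otimes> pure [Vect (w i)])"
    unfolding of_map_def sum.distrib[symmetric] by (simp add: tens_add_right)
  \<comment> \<open>The factor 1/2 goes into the argument: half of a form is again a form, so the
    hypothesis on \<open>pr c\<close> applies as it stands.\<close>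
  also have "(\<Sum>i<N. \<phi> (e i) \<otimes> pure [Vect (w i)]) = of_map (\<lambda>\<xi>. \<phi> (pr c ((1/2) *\<^sub>C \<xi>)))"
  proof (rule of_map_comp[OF \<phi> w])
    fix \<xi> :: 'w assume \<xi>: "\<xi> \<in> Omega 1"
    then have half: "(1/2) *\<^sub>C \<xi> \<in> Omega 1" by (rule Omega_scaleC)
    have "w i \<xi> = u i (pr c ((1/2) *\<^sub>C \<xi>))" if "i < N" for i
      using u_in[OF that] \<xi> half
      by (simp add: w_eq vecAD(3)[OF u_in[OF that]] Omega_scaleC almost_complexD(1)[OF J] vecA_scaleC J_scaleC scaleC_scaleC)
    then have "(\<Sum>i<N. e i * w i \<xi>) = (\<Sum>i<N. e i * u i (pr c ((1/2) *\<^sub>C \<xi>)))" by simp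
    also have "\<dots> = pr c ((1/2) *\<^sub>C \<xi>)" by (rule expand[OF pr_in[OF half]])
    finally show "(\<Sum>i<N. e i * w i \<xi>) = pr c ((1/2) *\<^sub>C \<xi>)" .
  qed
  also have "\<dots> = of_map (\<lambda>_. 0)"
    by (rule of_map_cong) (simp only: 0 Omega_scaleC)
  also have "\<dots> = 0" by (simp add: of_map_def additive.zero[OF additive_tens_left])
  finally have "of_map \<phi> = (\<Sum>i<N. \<phi> (e i) \<otimes> pure [Vect (p i)])" by simp
  also have "\<dots> \<in> tspan (listset [FS, Vect ` eigen J c])"
  proof (rule tspan_sum)
    fix i assume i: "i \<in> {..<N}"
    have "p i (J \<xi>) = c *\<^sub>C p i \<xi>" if \<xi>: "\<xi> \<in> Omega 1" for \<xi>
    proof -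
      have uJJ: "u i (J (J \<xi>)) = (- 1) *\<^sub>C u i \<xi>"
        using almost_complexD(5)[OF J \<xi>] vecA_scaleC[OF u_in \<xi>, of i "-1"] i by (simp add: scaleC_minus_one)
      show ?thesis
        using \<xi> by (simp add: p_eq uJJ almost_complexD(1)[OF J] scaleC_add_right scaleC_scaleC c add.commute)
    qed
    then have "p i \<in> eigen J c" using p i by (simp add: eigen_def)
    then show "\<phi> (e i) \<otimes> pure [Vect (p i)] \<in> tspan (listset [FS, Vect ` eigen J c])"
      using i by (intro tspan_tens[OF right_linearD(1)[OF \<phi> e_in] tspan_pure[of _ "{[Vect (p i)]}"]])
         (auto simp: listset_pair listset_single)
  qed
  finally show ?thesis .
qed

lemma eigenD: "v \<in> eigen J c \<Longrightarrow> v \<in> vecA" "v \<in> eigen J c \<Longrightarrow> \<xi> \<in> Omega 1 \<Longrightarrow> v (J \<xi>) = c *\<^sub>C v \<xi>"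
  by (simp_all add: eigen_def)

lemma eigen_ract:
  assumes "a \<in> Omega 0" "v \<in> eigen J c"
  shows "vec_ract v a \<in> eigen J c"
proof -
  have "vec_ract v a (J \<xi>) = c *\<^sub>C vec_ract v a \<xi>" if "\<xi> \<in> Omega 1" for \<xi>
    using eigenD(2)[OF assms(2) Omega_0_mult[OF assms(1) that]] that
    by (simp add: vec_ract_apply almost_complexD(1)[OF J] almost_complexD(3)[OF J that assms(1)])
  then show ?thesis by (simp add: eigen_def vecA_ract assms(1) eigenD(1)[OF assms(2)])
qed

lemma eigen_lact:
  assumes "a \<in> Omega 0" "v \<in> eigen J c"
  shows "vec_lact a v \<in> eigen J c"
  using assms by (simp add: eigen_def vecA_lact vec_lact_apply mult_scaleC_right)

lemma pure_Form_zero: "pure (Form 0 # q) = 0"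
  using pure_Form_add[OF Omega_zero Omega_zero, of q] by simp

lemma pure_FF_zero: "pure [Form \<xi>, Form 0] = 0"
  using pure_FF_add_right[OF Omega_zero Omega_zero, of \<xi>] by simp

lemma eigen_pr:
  assumes "v \<in> eigen J c" "c * c = - 1" "\<xi> \<in> Omega 1"
  shows "v (pr c \<xi>) = 0"
  using assms eigenD[OF assms(1)]
  by (simp add: vecAD(3) Omega_scaleC almost_complexD(1)[OF J] vecA_scaleC scaleC_scaleC scaleC_minus_one)

text \<open>On \<xi> \<otimes> \<eta> the value is v(\<xi>)\<eta> + c^2 v(\<xi>)\<eta>. One factor c
  is the eigenvalue; the other enters through the right action, which is how it appears in
  \<box>(c\<xi>).\<close>

lemma contract_J_id:
  assumes v: "v \<in> eigen J c" and c: "c * c = - 1" and x: "x \<in> FF"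
  shows "contract v (x + J_id J (tract x (c *\<^sub>C 1))) = 0"
proof (rule tspan_eqI[OF x, where g = "\<lambda>_. 0"])
  show "additive (\<lambda>x. contract v (x + J_id J (tract x (c *\<^sub>C 1))))"
    by (simp add: additive_def contract_add eigenD[OF v] additive.add[OF additive_J_id[OF J]] tract_add scaleC_one_in ac_simps)
  fix w :: "'w slot list" assume "w \<in> listset [FS, FS]"
  then obtain \<xi> \<eta> where w: "w = [Form \<xi>, Form \<eta>]" "\<xi> \<in> Omega 1" "\<eta> \<in> Omega 1"
    unfolding listset_pair by auto
  have "tract (pure w) (c *\<^sub>C 1) = pure [Form \<xi>, Form (c *\<^sub>C \<eta>)]"
    using tract_pure[OF scaleC_one_in, of "[Form \<xi>]" "Form \<eta>" c] w by (simp add: mult_scaleC_right)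
  then have "contract v (pure w + J_id J (tract (pure w) (c *\<^sub>C 1))) =
      pure [Form (v \<xi> * \<eta>)] + pure [Form (v (J \<xi>) * c *\<^sub>C \<eta>)]"
    using w eigenD(1)[OF v]
    by (simp add: contract_add J_id_pure J Omega_scaleC contract_pure Form_slots almost_complexD(1)[OF J])
  also have "\<dots> = pure [Form (v \<xi> * \<eta> + v (J \<xi>) * c *\<^sub>C \<eta>)]"
    using w by (intro pure_Form_add[symmetric] Omega_0_mult Omega_scaleC vecAD(2)[OF eigenD(1)[OF v]])
  also have "v (J \<xi>) * c *\<^sub>C \<eta> = - (v \<xi> * \<eta>)"
    by (simp add: eigenD(2)[OF v w(2)] mult_scaleC_left mult_scaleC_right scaleC_scaleC c scaleC_minus_one)
  finally show "contract v (pure w + J_id J (tract (pure w) (c *\<^sub>C 1))) = 0"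
    by (simp add: pure_Form_zero)
qed (simp add: additive_def)

text \<open>By the right Leibniz rule and d(c1) = 0, the connection commutes with the scalar c;
  compatibility with \<open>J\<close> then writes \<box>(\<xi> + cJ\<xi>) in the form treated in
  \<open>contract_J_id\<close>.\<close>

lemma contract_D_pr:
  assumes v: "v \<in> eigen J c" and c: "c * c = - 1" and \<xi>: "\<xi> \<in> Omega 1"
  shows "contract v (D (pr c \<xi>)) = 0"
proof -
  have "D (c *\<^sub>C \<xi>) = tract (D \<xi>) (c *\<^sub>C 1)"
    using conn_facts(7)[OF \<xi> scaleC_one_in[of c]] by (simp add: mult_scaleC_right extd_scaleC_one pure_FF_zero)
  moreover have "D (pr c \<xi>) = D \<xi> + J_id J (D (c *\<^sub>C \<xi>))"
    using \<xi> by (simp add: conn_facts(6) Omega_scaleC almost_complexD(1)[OF J] J_scaleC[symmetric] D_J)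
  ultimately show ?thesis using contract_J_id[OF v c conn_facts(5)[OF \<xi>]] by simp
qed

text \<open>\<open>contract_D_pr\<close> is used twice: for v at b\<xi>, because \<open>J\<close>
  commutes with left multiplication by b, and for v.b at \<xi>, because the eigenspace is closed
  under the right action.\<close>

lemma smap_extd_pr:
  assumes v: "v \<in> eigen J c" and c: "c * c = - 1" and \<xi>: "\<xi> \<in> Omega 1" and b: "b \<in> Omega 0"
  shows "smap v (extd b) (pr c \<xi>) = 0"
proof -
  have "\<sigma>inv (pure [Form (extd b), Form (pr c \<xi>)]) = D (b * pr c \<xi>) - tlact b (D (pr c \<xi>))"
    using conn_facts(8)[OF pr_in[OF \<xi>] b] by (simp add: algebra_simps)
  also have "b * pr c \<xi> = pr c (b * \<xi>)"
    by (simp add: distrib_left mult_scaleC_right almost_complexD(3)[OF J \<xi> b])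
  finally have "smap v (extd b) (pr c \<xi>) = contract v (D (pr c (b * \<xi>))) - contract (vec_ract v b) (D (pr c \<xi>))"
    unfolding smap_def
    by (simp add: additive.diff[OF additive_contract] eigenD(1)[OF v] contract_ract b FF_form conn_facts(5) pr_in \<xi>)
  also have "\<dots> = 0"
    by (simp add: contract_D_pr[OF v c] contract_D_pr[OF eigen_ract[OF b v] c] \<xi> Omega_0_mult b)
  finally show ?thesis .
qed

lemma smap_pr:
  assumes v: "v \<in> eigen J c" and c: "c * c = - 1" and \<xi>: "\<xi> \<in> Omega 1" and \<eta>: "\<eta> \<in> Omega 1"
  shows "smap v \<eta> (pr c \<xi>) = 0"
proof -
  note pr = pr_in[OF \<xi>, of c]
  obtain k a b where ab: "\<forall>i<k. a i \<in> Omega 0 \<and> b i \<in> Omega 0" and \<eta>_eq: "\<eta> = (\<Sum>i<(k::nat). a i * extd (b i))"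
    using Omega_1_A_dA[OF \<eta>] by blast
  from ab have "smap v (\<Sum>i<k. a i * extd (b i)) (pr c \<xi>) = 0"
  proof (induction k)
    case 0
    show ?case
      using smap_add_left[OF eigenD(1)[OF v] Omega_zero Omega_zero pr] by simp
  next
    case (Suc k)
    then have ab: "a k \<in> Omega 0" "b k \<in> Omega 0" by auto
    \<comment> \<open>The coefficient \<open>a k\<close> moves into the vector field, which stays in
      the eigenspace, leaving the exact form \<open>extd (b k)\<close>.\<close>
    have "smap v (a k * extd (b k)) (pr c \<xi>) = 0"
      by (simp only: smap_mult[OF ab(1) eigenD(1)[OF v] Omega_extd_0[OF ab(2)] pr] smap_extd_pr[OF eigen_ract[OF ab(1) v] c \<xi> ab(2)])
    moreover have "(\<Sum>i<k. a i * extd (b i)) \<in> Omega 1"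
      using Suc.prems by (intro Omega_sum) (simp add: Omega_0_mult Omega_extd_0)
    ultimately show ?case
      using Suc by (simp add: smap_add_left eigenD(1)[OF v] pr Omega_0_mult Omega_extd_0)
  qed
  then show ?thesis unfolding \<eta>_eq .
qed

lemma stable_eigen:
  assumes c: "c * c = - 1"
  shows "stable (eigen J c)"
  unfolding stable_def
proof (intro conjI ballI)
  fix v assume v: "v \<in> eigen J c"
  note v' = eigenD(1)[OF v]
  show "box v \<in> tspan (listset [FS, Vect ` eigen J c])"
    unfolding box_eq[OF v']
    by (rule of_map_eigen[OF right_linear_dmap[OF v'] _ c])
       (simp add: dmap_def eigen_pr[OF v c] contract_D_pr[OF v c] additive.zero[of extd] additive_def extd_add pure_Form_zero)
  show "sig v \<eta> \<in> tspan (listset [FS, Vect ` eigen J c])" if "\<eta> \<in> Omega 1" for \<eta>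
    unfolding sig_eq
    by (rule of_map_eigen[OF right_linear_smap[OF v' that] _ c]) (rule smap_pr[OF v c _ that])
qed (auto simp: eigen_lact eigen_ract eigenD(1))

end

section \<open>Tensor powers of vector fields\<close>

declare box_pow.simps [simp del] pow_bullet.simps [simp del]

lemma vwords_0: "vwords V 0 = set_Cons AS {[]}"
  by (simp add: vwords_def listset.simps)

lemma vwords_1: "vwords V (Suc 0) = set_Cons (Vect ` V) {[]}"
  by (simp add: vwords_def listset.simps)

lemma vwords_Suc: "n \<noteq> 0 \<Longrightarrow> vwords V (Suc n) = set_Cons (Vect ` V) (vwords V n)"
  by (simp add: vwords_def listset.simps)

lemma saturated_vwords: "saturated (vwords vecA n)"
  unfolding vwords_def by (auto intro!: saturated_listset)

lemma vwords_slots: "vwords vecA n \<subseteq> lists slots"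
  unfolding vwords_def by (simp add: listset_kinds_subset)

lemma vwords_mono:
  assumes "V \<subseteq> V'"
  shows "vwords V n \<subseteq> vwords V' n"
proof (induction n)
  case (Suc n)
  then show ?case
    using assms by (cases "n = 0") (auto simp: vwords_1 vwords_Suc set_Cons_def image_iff subset_iff)
qed (simp add: vwords_0)

text \<open>Degree zero is a scalar letter and not the empty word, so a word of degree n+1 is not
  always a letter in front of one of degree n. From degree two on, two letters are exposed, which
  shows that the tail is no scalar letter.\<close>

lemma vwords_cases [consumes 1, case_names Scal single Cons]:
  assumes "w \<in> vwords V n"
  obtains (Scal) a where "n = 0" "w = [Scal a]" "a \<in> Omega 0"
  | (single) v where "n = 1" "w = [Vect v]" "v \<in> V"
  | (Cons) v v' q m where "n = Suc (Suc m)" "w = Vect v # Vect v' # q" "v \<in> V" "v' \<in> V" "Vect v' # q \<in> vwords V (Suc m)"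
proof (cases n)
  case 0
  then show ?thesis using assms Scal by (auto simp: vwords_0 set_Cons_def)
next
  case (Suc k)
  show ?thesis
  proof (cases k)
    case 0
    then show ?thesis using assms Suc single by (auto simp: vwords_1 set_Cons_def One_nat_def)
  next
    case (Suc m)
    then have "w \<in> set_Cons (Vect ` V) (vwords V (Suc m))"
      using assms \<open>n = Suc k\<close> vwords_Suc[of "Suc m" V] by simp
    then obtain v z where "w = Vect v # z" "v \<in> V" "z \<in> vwords V (Suc m)" by (auto simp: set_Cons_def)
    moreover from this(3) obtain v' q where "z = Vect v' # q" "v' \<in> V"
      by (cases m) (auto simp: vwords_1 vwords_Suc set_Cons_def)
    ultimately show ?thesis using Cons[of m v v' q] Suc \<open>n = Suc k\<close> by simp
  qed
qed

lemma vdeg_vwords: "w \<in> vwords V n \<Longrightarrow> vdeg w = n"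
proof (induction n arbitrary: w)
  case 0
  then show ?case by (auto simp: vwords_0 set_Cons_def)
next
  case (Suc n)
  from Suc.prems show ?case
  proof (cases rule: vwords_cases)
    case (Cons v v' q m)
    then show ?thesis using Suc.IH[of "Vect v' # q"] by simp
  qed (simp_all add: One_nat_def)
qed

text \<open>Words for forms with values in a tensor power; in degree zero the factor A is dropped,
  to match the target of \<open>box_pow\<close> there.\<close>

definition fwords :: "('w::star_dga \<Rightarrow> 'w) set \<Rightarrow> nat \<Rightarrow> 'w slot list set" where
  "fwords V n = (if n = 0 then listset [FS] else set_Cons FS (vwords V n))"

lemma fwords_form_words: "fwords vecA n \<subseteq> form_words"
  unfolding fwords_def form_words_eq listset_single
  using vwords_slots[of n] by (auto simp: set_Cons_def)

text \<open>The word for \<open>\<xi> \<otimes> w\<close>, with \<open>\<Omega>\<^sup>1A \<otimes>\<^sub>A A\<close> identified with \<open>\<Omega>\<^sup>1A\<close>.\<close>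

definition fcons :: "'w::star_dga \<Rightarrow> 'w slot list \<Rightarrow> 'w slot list" where
  "fcons \<xi> ws = (case ws of [Scal a] \<Rightarrow> [Form (\<xi> * a)] | _ \<Rightarrow> Form \<xi> # ws)"

lemma fcons_Vect: "fcons \<xi> (Vect v # ws) = Form \<xi> # Vect v # ws"
  by (simp add: fcons_def)

lemma contract_fcons:
  assumes "u \<in> vecA" "\<xi> \<in> Omega 1" "w \<in> vwords vecA n"
  shows "contract u (pure (fcons \<xi> w)) = pure (word_lact (u \<xi>) w)"
  using assms(3) subsetD[OF vwords_slots assms(3)]
  by (cases rule: vwords_cases)
     (use assms in \<open>auto simp: fcons_def contract_pure Omega_mult_0 vecAD(4)\<close>)

text \<open>The value of \<open>u\<close> on the form acts on the first remaining letter, which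
  stays in \<open>V\<close> by closure under the left action. When nothing remains, this value is
  itself the word of degree zero.\<close>

lemma contract_fwords:
  assumes u: "u \<in> vecA" and V: "V \<subseteq> vecA" "\<And>v a. v \<in> V \<Longrightarrow> a \<in> Omega 0 \<Longrightarrow> vec_lact a v \<in> V"
    and x: "x \<in> tspan (fwords V n)"
  shows "contract u x \<in> tspan (vwords V n)"
proof (rule tspan_mapI[OF x additive_contract[OF u]])
  fix w assume w: "w \<in> fwords V n"
  show "contract u (pure w) \<in> tspan (vwords V n)"
  proof (cases "n = 0")
    case True
    with w obtain \<xi> where "w = [Form \<xi>]" "\<xi> \<in> Omega 1" by (auto simp: fwords_def listset_single)
    then show ?thesis
      using u True by (auto simp: contract_pure vwords_0 set_Cons_def vecAD(2) intro!: tspan_pure)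
  next
    case False
    with w obtain \<xi> z where z: "w = Form \<xi> # z" "\<xi> \<in> Omega 1" "z \<in> vwords V n"
      by (auto simp: fwords_def set_Cons_def)
    then have "z \<in> lists slots" using vwords_mono[OF V(1)] vwords_slots by blast
    then have "contract u (pure w) = pure (word_lact (u \<xi>) z)"
      using u z by (simp add: contract_pure)
    moreover have "word_lact (u \<xi>) z \<in> vwords V n"
      using z(3) False vecAD(2)[OF u, of \<xi>] V(2)
      by (cases rule: vwords_cases) (auto simp: vwords_1 vwords_Suc set_Cons_def One_nat_def)
    ultimately show ?thesis by (simp add: tspan_pure)
  qed
qed

lemma tensorial_plus: "tensorial W f \<Longrightarrow> tensorial W g \<Longrightarrow> tensorial W (\<lambda>w. f w + g w)"
  by (rule tensorialI) (simp_all only: tensorial_saturated tensorial_add tensorial_bal ac_simps)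

lemma tensorial_UN:
  assumes "\<And>n. tensorial (W n) f"
  shows "tensorial (\<Union>n. W n) f"
proof (rule tensorialI)
  show "saturated (\<Union>n. W n)" by (rule saturated_UN) (rule tensorial_saturated[OF assms])
  show "f (p @ [slot_add s t] @ q) = f (p @ [s] @ q) + f (p @ [t] @ q)"
    if "M \<in> kinds" "s \<in> M" "t \<in> M" "p @ [s] @ q \<in> (\<Union>n. W n)" for p q s t M
    using that(4) tensorial_add[OF assms that(1-3)] by blast
  show "f (p @ [slot_ract s a, t] @ q) = f (p @ [s, slot_lact a t] @ q)"
    if "a \<in> Omega 0" "s \<in> slots" "t \<in> slots" "p @ [s, t] @ q \<in> (\<Union>n. W n)" for p q s t a
    using that(4) tensorial_bal[OF assms that(1-3)] by blast
qed

text \<open>Turns the sum of all tensor powers into a single span, so that additive maps on it can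
  be treated on words.\<close>

lemma tensor_alg_eq: "tensor_alg V = tspan (\<Union>n. vwords V n)"
proof
  show "tensor_alg V \<subseteq> tspan (\<Union>n. vwords V n)"
  proof
    fix y assume "y \<in> tensor_alg V"
    then obtain k x where y: "y = (\<Sum>n<(k::nat). x n)" "\<forall>n<k. x n \<in> tspan (vwords V n)"
      by (auto simp: tensor_alg_def vpow_def)
    show "y \<in> tspan (\<Union>n. vwords V n)"
      unfolding y(1) by (rule tspan_sum, rule tspan_mono[of "vwords V _"]) (use y(2) in auto)
  qed
  show "tspan (\<Union>n. vwords V n) \<subseteq> tensor_alg V"
  proof
    fix y assume "y \<in> tspan (\<Union>n. vwords V n)"
    then show "y \<in> tensor_alg V"
    proof (induction rule: tspan_induct)
      case zero
      show ?case unfolding tensor_alg_def by (rule CollectI, rule exI[of _ 0]) simp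
    next
      case (pure w)
      then obtain n where w: "w \<in> vwords V n" by blast
      define x where "x m = (if m = n then Defs.pure w else 0)" for m
      have "Defs.pure w = (\<Sum>m<Suc n. x m)" by (simp add: x_def)
      moreover have "\<forall>m<Suc n. x m \<in> vpow V m" by (auto simp: x_def vpow_def tspan_pure w)
      ultimately show ?case unfolding tensor_alg_def by blast
    next
      case (diff y z)
      then obtain k x l x' where y: "y = (\<Sum>n<(k::nat). x n)" "\<forall>n<k. x n \<in> vpow V n"
        and z: "z = (\<Sum>n<(l::nat). x' n)" "\<forall>n<l. x' n \<in> vpow V n"
        unfolding tensor_alg_def by blast
      \<comment> \<open>Both families are padded with zeros to the common length
        \<open>max k l\<close>.\<close>
      define f where "f n = (if n < k then x n else 0) - (if n < l then x' n else 0)" for n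
      have "y = (\<Sum>n<max k l. if n < k then x n else 0)" "z = (\<Sum>n<max k l. if n < l then x' n else 0)"
        unfolding y(1) z(1) by (rule sum.mono_neutral_cong_left; auto)+
      then have "y - z = (\<Sum>n<max k l. f n)" by (simp add: f_def sum_subtractf)
      moreover have "\<forall>n<max k l. f n \<in> vpow V n"
        unfolding f_def vpow_def using y(2) z(2) by (intro allI impI tspan_diff) (auto simp: vpow_def)
      ultimately show ?case unfolding tensor_alg_def by blast
    qed
  qed
qed

lemma tensor_alg_slots: "x \<in> tensor_alg vecA \<Longrightarrow> x \<in> tspan (lists slots)"
  unfolding tensor_alg_eq by (erule tspan_mono[rotated]) (use vwords_slots in blast)

section \<open>The covariant derivative on tensor powers\<close>

context connection
begin

lemma word_lact_vwords:
  assumes V: "stable V" and w: "w \<in> vwords V n" and a: "a \<in> Omega 0"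
  shows "word_lact a w \<in> vwords V n"
  using w stableD(2)[OF V _ a]
  by (cases rule: vwords_cases)
     (auto simp: vwords_0 vwords_1 vwords_Suc set_Cons_def One_nat_def Omega_0_mult a)

lemma vwords_stable: "stable V \<Longrightarrow> vwords V n \<subseteq> vwords vecA n"
  by (rule vwords_mono) (auto dest: stableD(1))

abbreviation "B \<equiv> box_pow box sig"

text \<open>An induction hypothesis: the last clause, the Leibniz rule, makes the next degree
  balanced; additivity and the second clause, taken for \<open>vecA\<close>, allow the maps applied
  to \<open>B n\<close> to be evaluated.\<close>

definition box_pow_props :: "nat \<Rightarrow> bool" where
  "box_pow_props n \<longleftrightarrow> additive (B n) \<and>
     (\<forall>V. stable V \<longrightarrow> (\<forall>w\<in>vwords V n. B n (pure w) \<in> tspan (fwords V n))) \<and>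
     (\<forall>w\<in>vwords vecA n. \<forall>a\<in>Omega 0.
        B n (pure (word_lact a w)) = tlact a (B n (pure w)) + pure (fcons (extd a) w))"

lemma box_pow_props_0: "box_pow_props 0"
proof -
  have t: "tensorial (vwords vecA 0) (\<lambda>ws. case ws of [Scal a] \<Rightarrow> pure [Form (extd a)] | _ \<Rightarrow> (0 :: 'w tensor))"
    unfolding vwords_0
    by (rule tensorial_Cons[OF _ saturated_Nil _ tensorial_Nil])
       (auto simp: extd_add pure_Form_add Omega_extd_0)
  have B: "B 0 (pure [Scal a]) = pure [Form (extd a)]" if "a \<in> Omega 0" for a
    unfolding box_pow.simps by (subst textend_pure[OF t]) (use that in \<open>auto simp: vwords_0\<close>)
  show ?thesis
    unfolding box_pow_props_def
  proof (intro conjI allI impI ballI)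
    show "additive (B 0)" unfolding box_pow.simps by (rule textend_additive[OF t])
    show "B 0 (pure w) \<in> tspan (fwords V 0)" if "w \<in> vwords V 0" for V w
      using that by (auto simp: vwords_0 B fwords_def Omega_extd_0 intro!: pure_Form_in)
    show "B 0 (pure (word_lact a w)) = tlact a (B 0 (pure w)) + pure (fcons (extd a) w)"
      if "w \<in> vwords vecA 0" "a \<in> Omega 0" for w a
      using that
      by (auto simp: vwords_0 B Omega_0_mult Omega_mult_0 Omega_extd_0 extd_0_mult pure_Form_add tlact_pure fcons_def add.commute)
  qed
qed

lemma box_pow_props_1: "box_pow_props (Suc 0)"
proof -
  \<comment> \<open>The guard \<open>(0::nat) = 0\<close> is kept so that \<open>f\<close> coincides
    literally with the instance of the recursion clause.\<close>
  define f where "f = (\<lambda>ws. case ws of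
         Vect v # zs \<Rightarrow> if (0::nat) = 0 then box v
           else box v \<otimes> pure zs + sid v (B 0 (pure zs))
       | _ \<Rightarrow> 0)"
  have t: "tensorial (vwords vecA (Suc 0)) f"
    unfolding vwords_1
    by (rule tensorial_Cons[OF _ saturated_Nil _ tensorial_Nil])
       (auto simp: f_def box_add)
  have B: "B (Suc 0) (pure [Vect v]) = box v" if "v \<in> vecA" for v
    unfolding box_pow.simps(2) f_def[symmetric]
    by (subst textend_pure[OF t]) (use that in \<open>auto simp: vwords_1 f_def\<close>)
  show ?thesis
    unfolding box_pow_props_def
  proof (intro conjI allI impI ballI)
    show "additive (B (Suc 0))" unfolding box_pow.simps(2) f_def[symmetric] by (rule textend_additive[OF t])
    show "B (Suc 0) (pure w) \<in> tspan (fwords V (Suc 0))" if "stable V" "w \<in> vwords V (Suc 0)" for V w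
      using that(2) stableD(1,4)[OF that(1)]
      by (auto simp: vwords_1 B fwords_def listset.simps)
    show "B (Suc 0) (pure (word_lact a w)) = tlact a (B (Suc 0) (pure w)) + pure (fcons (extd a) w)"
      if "w \<in> vwords vecA (Suc 0)" "a \<in> Omega 0" for w a
      using that by (auto simp: vwords_1 B vecA_lact box_lact fcons_Vect)
  qed
qed

lemma box_pow_props_Suc:
  assumes n: "n \<noteq> 0" and IH: "box_pow_props n"
  shows "box_pow_props (Suc n)"
proof -
  define f where "f = (\<lambda>ws. case ws of
         Vect v # zs \<Rightarrow> if n = 0 then box v
           else box v \<otimes> pure zs + sid v (B n (pure zs))
       | _ \<Rightarrow> 0)"
  have f: "f (Vect v # zs) = box v \<otimes> pure zs + sid v (B n (pure zs))" for v zs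
    by (simp add: f_def n)
  have add: "additive (B n)"
    and V_in: "\<And>V w. stable V \<Longrightarrow> w \<in> vwords V n \<Longrightarrow> B n (pure w) \<in> tspan (fwords V n)"
    and leib: "\<And>w a. w \<in> vwords vecA n \<Longrightarrow> a \<in> Omega 0 \<Longrightarrow>
        B n (pure (word_lact a w)) = tlact a (B n (pure w)) + pure (fcons (extd a) w)"
    using IH unfolding box_pow_props_def by blast+
  have B_in: "B n (pure z) \<in> tspan form_words" if "z \<in> vwords vecA n" for z
    using V_in[OF stable_vecA that] by (rule tspan_mono[OF fwords_form_words])
  have t: "tensorial (vwords vecA (Suc n)) f"
    unfolding vwords_Suc[OF n]
  proof (rule tensorial_Cons, goal_cases)
    case (3 s t z)
    then show ?case
      by (auto simp: f box_add sid_add_left[OF _ _ B_in] tens_add_left)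
  next
    case (4 s)
    then obtain v where v: "s = Vect v" "v \<in> vecA" by auto
    show ?case
    proof (rule tensorial_comp[OF saturated_vwords])
      show "additive (\<lambda>x. box v \<otimes> x + sid v (B n x))"
        by (simp add: additive_def tens_add_right additive.add[OF add] sid_add_right v)
    qed (simp add: f v)
  next
    case (5 s t q a)
    then obtain v where v: "s = Vect v" "v \<in> vecA" by auto
    from 5(3) n obtain v' where t: "t = Vect v'" "v' \<in> vecA"
      by (cases rule: vwords_cases) auto
    note Bz = B_in[OF 5(3)]
    have q: "q \<in> lists slots" using subsetD[OF vwords_slots 5(3)] by simp
    \<comment> \<open>On this side \<sigma>(v \<otimes> da) comes from \<open>box_ract\<close> in
      the first summand. On the other side it comes from the Leibniz rule in degree
      \<open>n\<close>, inside the second summand; only the sums agree.\<close>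
    have "f (slot_ract s a # t # q) = (tract (box v) a + sig v (extd a)) \<otimes> pure (t # q) + sid v (tlact a (B n (pure (t # q))))"
      using v 5(4) by (simp add: f box_ract sid_ract[OF _ _ Bz])
    moreover have "f (s # slot_lact a t # q) = tract (box v) a \<otimes> pure (t # q) + sid v (tlact a (B n (pure (t # q))) + pure (fcons (extd a) (t # q)))"
      using v leib[OF 5(3,4)] tens_pure_lact[OF 5(4) FV_lists_slots[OF box_in[OF v(2)]] 5(2), of q]
      by (simp add: f)
    moreover have "sid v (pure (fcons (extd a) (t # q))) = sig v (extd a) \<otimes> pure (t # q)"
      using v t q 5(4) by (simp add: fcons_Vect sid_pure Omega_extd_0 Vect_slots)
    ultimately show ?case by (simp add: tens_add_left sid_add_right v ac_simps)
  qed (simp_all add: saturated_vwords)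
  have B: "B (Suc n) (pure w) = f w" if "w \<in> vwords vecA (Suc n)" for w
    unfolding box_pow.simps(2) f_def[symmetric] using that by (simp add: textend_pure[OF t])
  show ?thesis
    unfolding box_pow_props_def
  proof (intro conjI allI impI ballI)
    show "additive (B (Suc n))" unfolding box_pow.simps(2) f_def[symmetric] by (rule textend_additive[OF t])
  next
    fix V w assume V: "stable V" and w: "w \<in> vwords V (Suc n)"
    then obtain v z where vz: "w = Vect v # z" "v \<in> V" "z \<in> vwords V n"
      by (auto simp: vwords_Suc[OF n] set_Cons_def)
    have words: "p @ q \<in> fwords V (Suc n)" if "p \<in> listset [FS, Vect ` V]" "q \<in> vwords V n" for p q
      using that by (auto simp: fwords_def vwords_Suc[OF n] listset_pair set_Cons_def)
    have "box v \<otimes> pure z \<in> tspan (fwords V (Suc n))"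
      using words by (rule tspan_tens[OF stableD(4)[OF V vz(2)] tspan_pure[OF vz(3)]])
    moreover have "sid v (B n (pure z)) \<in> tspan (fwords V (Suc n))"
    proof (rule tspan_mapI[OF V_in[OF V vz(3)] additive_sid[OF stableD(1)[OF V vz(2)]]])
      fix w' assume "w' \<in> fwords V n"
      then obtain \<eta> z' where w': "w' = Form \<eta> # z'" "\<eta> \<in> Omega 1" "z' \<in> vwords V n"
        by (auto simp: fwords_def n set_Cons_def)
      then have "z' \<in> lists slots" using vwords_stable[OF V] vwords_slots by blast
      then have "sid v (pure w') = sig v \<eta> \<otimes> pure z'"
        using w' stableD(1)[OF V vz(2)] by (simp add: sid_pure)
      also have "\<dots> \<in> tspan (fwords V (Suc n))"
        using words by (rule tspan_tens[OF stableD(5)[OF V vz(2) w'(2)] tspan_pure[OF w'(3)]])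
      finally show "sid v (pure w') \<in> tspan (fwords V (Suc n))" .
    qed
    ultimately show "B (Suc n) (pure w) \<in> tspan (fwords V (Suc n))"
      using B[OF subsetD[OF vwords_stable[OF V] w]] by (simp add: f vz(1) tspan_add)
  next
    fix w :: "'w slot list" and a :: 'w assume w: "w \<in> vwords vecA (Suc n)" and a: "a \<in> Omega 0"
    then obtain v z where vz: "w = Vect v # z" "v \<in> vecA" "z \<in> vwords vecA n"
      by (auto simp: vwords_Suc[OF n] set_Cons_def)
    \<comment> \<open>The Leibniz term of the first factor is already that of the whole word; the
      summand with \<sigma> is left linear and adds none.\<close>
    have "pure [Form (extd a), Vect v] \<otimes> pure z = pure (fcons (extd a) w)"
      by (simp add: vz(1) fcons_Vect tens_pure)
    then show "B (Suc n) (pure (word_lact a w)) = tlact a (B (Suc n) (pure w)) + pure (fcons (extd a) w)"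
      using B[OF w] B[OF word_lact_vwords[OF stable_vecA w a]] vz a
      by (simp add: f box_lact sid_lact B_in tens_add_left tlact_add tlact_tens FV_nonempty box_in ac_simps)
  qed
qed

lemma box_pow_props: "box_pow_props n"
proof (induction n)
  case (Suc n)
  then show ?case using box_pow_props_1 box_pow_props_Suc by (cases "n = 0") auto
qed (rule box_pow_props_0)

lemma additive_B: "additive (B n)"
  and B_in: "stable V \<Longrightarrow> w \<in> vwords V n \<Longrightarrow> B n (pure w) \<in> tspan (fwords V n)"
  and B_word_lact: "w \<in> vwords vecA n \<Longrightarrow> a \<in> Omega 0 \<Longrightarrow>
        B n (pure (word_lact a w)) = tlact a (B n (pure w)) + pure (fcons (extd a) w)"
  using box_pow_props[of n] unfolding box_pow_props_def by blast+

lemma B_form_words: "w \<in> vwords vecA n \<Longrightarrow> B n (pure w) \<in> tspan form_words"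
  by (rule tspan_mono[OF fwords_form_words B_in[OF stable_vecA]])

end

section \<open>The bullet product\<close>

context connection
begin

abbreviation "vb \<equiv> vec_bullet B"
abbreviation "pb \<equiv> pow_bullet B"

text \<open>Here the summands are balanced separately. On words of fixed degree \<open>vdeg\<close>
  is constant, so the second factors through the additive \<open>B n\<close>. The first is prefixing
  by \<open>r\<close>, except in degree zero, where it is the right action on
  \<open>r\<close>.\<close>

lemma tensorial_vec_bullet:
  assumes r: "r \<in> vecA"
  shows "tensorial (\<Union>m. vwords vecA m) (\<lambda>ws. pure (vcons r ws) + contract r (B (vdeg ws) (pure ws)))"
proof (rule tensorial_UN, rule tensorial_plus)
  fix n
  show "tensorial (vwords vecA n) (\<lambda>ws. pure (vcons r ws))"
  proof (cases "n = 0")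
    case True
    have "vec_ract r (a + b) = (\<lambda>\<xi>. vec_ract r a \<xi> + vec_ract r b \<xi>)" if "a \<in> Omega 0" "b \<in> Omega 0" for a b
      using that by (auto simp: vec_ract_def fun_eq_iff distrib_right vecAD(3)[OF r] Omega_0_mult)
    then show ?thesis
      unfolding True vwords_0
      by (intro tensorial_Cons saturated_Nil tensorial_Nil kinds)
         (auto simp: vcons_def pure_Vect_add vecA_ract r)
  next
    case False
    have "vcons r w = Vect r # w" if "w \<in> vwords vecA n" for w
      using that False by (cases rule: vwords_cases) (auto simp: vcons_def)
    then show ?thesis
      by (intro tensorial_comp[OF saturated_vwords additive_tens_right[of "pure [Vect r]"]]) (simp add: tens_pure)
  qed
  show "tensorial (vwords vecA n) (\<lambda>ws. contract r (B (vdeg ws) (pure ws)))"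
  proof (rule tensorial_comp[OF saturated_vwords])
    show "additive (\<lambda>x. contract r (B n x))"
      by (simp add: additive_def additive.add[OF additive_B] contract_add r)
  qed (simp add: vdeg_vwords)
qed

lemma additive_vb: "r \<in> vecA \<Longrightarrow> additive (vb r)"
  unfolding vec_bullet_def by (rule textend_additive[OF tensorial_vec_bullet])

lemmas vb_add_right = additive.add[OF additive_vb]

lemma vb_pure:
  assumes "r \<in> vecA" "w \<in> vwords vecA n"
  shows "vb r (pure w) = pure (vcons r w) + contract r (B n (pure w))"
  unfolding vec_bullet_def
  by (subst textend_pure[OF tensorial_vec_bullet[OF assms(1)]]) (use assms(2) vdeg_vwords[OF assms(2)] in auto)

lemma tensor_alg_eqI:
  assumes "y \<in> tensor_alg vecA" "additive f" "additive g"
    and "\<And>w n. w \<in> vwords vecA n \<Longrightarrow> f (pure w) = g (pure w)"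
  shows "f y = g y"
  using assms(1) unfolding tensor_alg_eq by (rule tspan_eqI[OF _ assms(2,3)]) (use assms(4) in blast)

lemma vb_add_left:
  assumes v: "v \<in> vecA" and w: "w \<in> vecA" and y: "y \<in> tensor_alg vecA"
  shows "vb (\<lambda>\<xi>. v \<xi> + w \<xi>) y = vb v y + vb w y"
proof (rule tensor_alg_eqI[OF y])
  note vw = vecA_add[OF v w]
  show "additive (vb (\<lambda>\<xi>. v \<xi> + w \<xi>))" by (rule additive_vb[OF vw])
  show "additive (\<lambda>y. vb v y + vb w y)" by (simp add: additive_def vb_add_right v w ac_simps)
  fix z :: "'w slot list" and n assume z: "z \<in> vwords vecA n"
  have ract: "vec_ract (\<lambda>\<xi>. v \<xi> + w \<xi>) a = (\<lambda>\<xi>. vec_ract v a \<xi> + vec_ract w a \<xi>)" for a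
    by (auto simp: vec_ract_def)
  have "pure (vcons (\<lambda>\<xi>. v \<xi> + w \<xi>) z) = pure (vcons v z) + pure (vcons w z)"
    using z by (cases rule: vwords_cases) (simp_all add: ract vcons_def pure_Vect_add v w vecA_ract)
  then show "vb (\<lambda>\<xi>. v \<xi> + w \<xi>) (pure z) = vb v (pure z) + vb w (pure z)"
    by (simp add: vb_pure[OF _ z] vw v w contract_add_left[OF v w B_form_words[OF z]] ac_simps)
qed

lemma vb_lact:
  assumes a: "a \<in> Omega 0" and v: "v \<in> vecA" and y: "y \<in> tensor_alg vecA"
  shows "vb (vec_lact a v) y = tlact a (vb v y)"
proof (rule tensor_alg_eqI[OF y])
  note av = vecA_lact[OF a v]
  show "additive (vb (vec_lact a v))" by (rule additive_vb[OF av])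
  show "additive (\<lambda>y. tlact a (vb v y))" by (simp add: additive_def vb_add_right v tlact_add a)
  fix z :: "'w slot list" and n assume z: "z \<in> vwords vecA n"
  have ract: "vec_ract (vec_lact a v) b = vec_lact a (vec_ract v b)" for b
    by (auto simp: vec_ract_def vec_lact_def)
  have "pure (vcons (vec_lact a v) z) = tlact a (pure (vcons v z))"
    using z by (cases rule: vwords_cases) (simp_all add: ract vcons_def tlact_pure a)
  then show "vb (vec_lact a v) (pure z) = tlact a (vb v (pure z))"
    by (simp add: vb_pure[OF _ z] av v contract_lact[OF a v B_form_words[OF z]] tlact_add a)
qed

text \<open>Contraction with v.a is contraction of a\<box>z with v, and by the Leibniz rule a\<box>z
  is \<box>(az) minus da \<otimes> z; the last term contracts to v(da)z.\<close>

lemma contract_ract_B: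
  assumes a: "a \<in> Omega 0" and v: "v \<in> vecA" and z: "z \<in> vwords vecA n"
  shows "contract (vec_ract v a) (B n (pure z)) =
    contract v (B n (pure (word_lact a z))) - tlact (v (extd a)) (pure z)"
  by (simp add: contract_ract[OF a v B_form_words[OF z]] B_word_lact[OF z a] contract_add v
      contract_fcons[OF v Omega_extd_0[OF a] z] tlact_pure vecAD(2)[OF v])

text \<open>In the algebra v \<bullet> a = v.a + v(da), so this is the associativity of v \<bullet>
  a \<bullet> y, solved for the term with v.a.\<close>

lemma vb_ract:
  assumes a: "a \<in> Omega 0" and v: "v \<in> vecA" and y: "y \<in> tensor_alg vecA"
  shows "vb (vec_ract v a) y = vb v (tlact a y) - tlact (v (extd a)) y"
proof (rule tensor_alg_eqI[OF y])
  note va = vecA_ract[OF a v] and vda = vecAD(2)[OF v, of "extd a"]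
  show "additive (vb (vec_ract v a))" by (rule additive_vb[OF va])
  show "additive (\<lambda>y. vb v (tlact a y) - tlact (v (extd a)) y)"
    by (simp add: additive_def vb_add_right v tlact_add a vda)
  fix z :: "'w slot list" and n assume z: "z \<in> vwords vecA n"
  note az = word_lact_vwords[OF stable_vecA z a]
  have "pure (vcons (vec_ract v a) z) = pure (vcons v (word_lact a z))"
    using z
  proof (cases rule: vwords_cases)
    case (Scal b)
    then show ?thesis using slot_ract_ract[OF a Scal(3), of "Vect v"] by (simp add: vcons_def)
  next
    case (single v')
    then show ?thesis
      using pure_bal[OF a Vect_slots[OF v] Vect_slots[OF single(3)], of "[]" "[]"] by (simp add: vcons_def)
  next
    case (Cons v' v'' q m)
    then show ?thesis
      using pure_bal[OF a Vect_slots[OF v] Vect_slots[OF Cons(3)], of "[]" "Vect v'' # q"] by (simp add: vcons_def)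
  qed
  then show "vb (vec_ract v a) (pure z) = vb v (tlact a (pure z)) - tlact (v (extd a)) (pure z)"
    by (simp add: vb_pure[OF va z] tlact_pure[OF a] vb_pure[OF v az] contract_ract_B[OF a v z])
qed

lemma tensor_alg_mono: "stable V \<Longrightarrow> x \<in> tensor_alg V \<Longrightarrow> x \<in> tensor_alg vecA"
  unfolding tensor_alg_eq by (erule tspan_mono[rotated]) (use vwords_stable in blast)

lemma tensor_alg_vpow: "x \<in> tspan (vwords V n) \<Longrightarrow> x \<in> tensor_alg V"
  unfolding tensor_alg_eq by (erule tspan_mono[rotated]) blast

lemma tensor_alg_add: "x \<in> tensor_alg V \<Longrightarrow> y \<in> tensor_alg V \<Longrightarrow> x + y \<in> tensor_alg V"
  unfolding tensor_alg_eq by (rule tspan_add)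

lemma tensor_alg_diff: "x \<in> tensor_alg V \<Longrightarrow> y \<in> tensor_alg V \<Longrightarrow> x - y \<in> tensor_alg V"
  unfolding tensor_alg_eq by (rule tspan_diff)

lemma tensor_alg_mapI:
  assumes "y \<in> tensor_alg V" "additive f" "\<And>w n. w \<in> vwords V n \<Longrightarrow> f (pure w) \<in> tensor_alg V"
  shows "f y \<in> tensor_alg V"
  using assms(1) unfolding tensor_alg_eq
  by (rule tspan_mapI[OF _ assms(2)]) (use assms(3) in \<open>auto simp: tensor_alg_eq\<close>)

lemma tlact_tensor_alg:
  assumes V: "stable V" and a: "a \<in> Omega 0" and y: "y \<in> tensor_alg V"
  shows "tlact a y \<in> tensor_alg V"
  by (rule tensor_alg_mapI[OF y additive_tlact[OF a]])
     (auto simp: tlact_pure a intro!: tensor_alg_vpow tspan_pure word_lact_vwords[OF V])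

lemma contract_B_in:
  assumes V: "stable V" and r: "r \<in> vecA" and w: "w \<in> vwords V n"
  shows "contract r (B n (pure w)) \<in> tspan (vwords V n)"
  by (rule contract_fwords[OF r _ _ B_in[OF V w]]) (use stableD(1,2)[OF V] in auto)

lemma vb_in:
  assumes V: "stable V" and r: "r \<in> V" and y: "y \<in> tensor_alg V"
  shows "vb r y \<in> tensor_alg V"
proof (rule tensor_alg_mapI[OF y additive_vb])
  note r' = stableD(1)[OF V r]
  show "r \<in> vecA" by (rule r')
  fix w n assume w: "w \<in> vwords V n"
  \<comment> \<open>In degree zero \<open>vcons r [Scal a]\<close> is the single letter
    \<open>vec_ract r a\<close>, hence the appeal to closure under the right action.\<close>
  have "vcons r w \<in> vwords V (Suc n)"
    using w stableD(3)[OF V r] r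
    by (cases rule: vwords_cases) (auto simp: vcons_def vwords_1 vwords_Suc set_Cons_def One_nat_def)
  then show "vb r (pure w) \<in> tensor_alg V"
    unfolding vb_pure[OF r' subsetD[OF vwords_stable[OF V] w]]
    by (intro tensor_alg_add tensor_alg_vpow[OF tspan_pure] tensor_alg_vpow[OF contract_B_in[OF V r' w]])
qed

text \<open>An induction hypothesis with the right factor fixed. Left linearity is the clause that
  makes the next degree balanced.\<close>

definition pow_bullet_props :: "'w tensor \<Rightarrow> nat \<Rightarrow> bool" where
  "pow_bullet_props y n \<longleftrightarrow> additive (\<lambda>x. pb n x y) \<and>
     (\<forall>V. stable V \<longrightarrow> y \<in> tensor_alg V \<longrightarrow> (\<forall>w\<in>vwords V n. pb n (pure w) y \<in> tensor_alg V)) \<and>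
     (\<forall>w\<in>vwords vecA n. \<forall>a\<in>Omega 0. pb n (pure (word_lact a w)) y = tlact a (pb n (pure w) y))"

lemma pow_bullet_props_0:
  assumes y: "y \<in> tensor_alg vecA"
  shows "pow_bullet_props y 0"
proof -
  have t: "tensorial (vwords vecA 0) (\<lambda>ws. case ws of [Scal a] \<Rightarrow> tlact a y | _ \<Rightarrow> 0)"
    unfolding vwords_0
    by (rule tensorial_Cons[OF _ saturated_Nil _ tensorial_Nil])
       (auto simp: tlact_add_left tensor_alg_slots[OF y])
  have P: "pb 0 (pure [Scal a]) y = tlact a y" if "a \<in> Omega 0" for a
    unfolding pow_bullet.simps by (subst textend_pure[OF t]) (use that in \<open>auto simp: vwords_0\<close>)
  show ?thesis
    unfolding pow_bullet_props_def
  proof (intro conjI allI impI ballI)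
    show "additive (\<lambda>x. pb 0 x y)" unfolding pow_bullet.simps by (rule textend_additive[OF t])
    show "pb 0 (pure w) y \<in> tensor_alg V" if "stable V" "y \<in> tensor_alg V" "w \<in> vwords V 0" for V w
      using that by (auto simp: vwords_0 P tlact_tensor_alg)
    show "pb 0 (pure (word_lact a w)) y = tlact a (pb 0 (pure w) y)" if "w \<in> vwords vecA 0" "a \<in> Omega 0" for w a
      using that by (auto simp: vwords_0 P Omega_0_mult tlact_tlact)
  qed
qed

lemma pow_bullet_props_1:
  assumes y: "y \<in> tensor_alg vecA"
  shows "pow_bullet_props y (Suc 0)"
proof -
  define f where "f = (\<lambda>ws. case ws of
         Vect r # vs \<Rightarrow>
           if (0::nat) = 0 then vb r y
           else vb r (pb 0 (pure vs) y) - pb 0 (contract r (B 0 (pure vs))) y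
       | _ \<Rightarrow> 0)"
  have t: "tensorial (vwords vecA (Suc 0)) f"
    unfolding vwords_1
    by (rule tensorial_Cons[OF _ saturated_Nil _ tensorial_Nil])
       (auto simp: f_def vb_add_left y)
  have P: "pb (Suc 0) (pure [Vect v]) y = vb v y" if "v \<in> vecA" for v
    unfolding pow_bullet.simps(2) f_def[symmetric]
    by (subst textend_pure[OF t]) (use that in \<open>auto simp: vwords_1 f_def\<close>)
  show ?thesis
    unfolding pow_bullet_props_def
  proof (intro conjI allI impI ballI)
    show "additive (\<lambda>x. pb (Suc 0) x y)"
      unfolding pow_bullet.simps(2) f_def[symmetric] by (rule textend_additive[OF t])
    show "pb (Suc 0) (pure w) y \<in> tensor_alg V" if "stable V" "y \<in> tensor_alg V" "w \<in> vwords V (Suc 0)" for V w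
      using that stableD(1)[OF that(1)] by (auto simp: vwords_1 P vb_in)
    show "pb (Suc 0) (pure (word_lact a w)) y = tlact a (pb (Suc 0) (pure w) y)"
      if "w \<in> vwords vecA (Suc 0)" "a \<in> Omega 0" for w a
      using that by (auto simp: vwords_1 P vecA_lact vb_lact y)
  qed
qed

lemma pow_bullet_props_Suc:
  assumes y: "y \<in> tensor_alg vecA" and n: "n \<noteq> 0" and IH: "pow_bullet_props y n"
  shows "pow_bullet_props y (Suc n)"
proof -
  define f where "f = (\<lambda>ws. case ws of
         Vect r # vs \<Rightarrow>
           if n = 0 then vb r y
           else vb r (pb n (pure vs) y) - pb n (contract r (B n (pure vs))) y
       | _ \<Rightarrow> 0)"
  have f: "f (Vect v # zs) = vb v (pb n (pure zs) y) - pb n (contract v (B n (pure zs))) y" for v zs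
    by (simp add: f_def n)
  have add: "additive (\<lambda>x. pb n x y)"
    and V_in: "\<And>V w. stable V \<Longrightarrow> y \<in> tensor_alg V \<Longrightarrow> w \<in> vwords V n \<Longrightarrow> pb n (pure w) y \<in> tensor_alg V"
    and lact: "\<And>w a. w \<in> vwords vecA n \<Longrightarrow> a \<in> Omega 0 \<Longrightarrow> pb n (pure (word_lact a w)) y = tlact a (pb n (pure w) y)"
    using IH unfolding pow_bullet_props_def by blast+
  note pb_add = additive.add[OF add] and pb_diff = additive.diff[OF add]
  note P_in = V_in[OF stable_vecA y]
  have lact': "pb n (tlact a x) y = tlact a (pb n x y)" if "x \<in> tspan (vwords vecA n)" "a \<in> Omega 0" for x a
    by (rule tspan_eqI[OF that(1)]) (simp_all add: additive_def tlact_add that(2) pb_add tlact_pure lact)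
  have t: "tensorial (vwords vecA (Suc n)) f"
    unfolding vwords_Suc[OF n]
  proof (rule tensorial_Cons, goal_cases)
    case (3 s t z)
    then show ?case
      by (auto simp: f vb_add_left P_in contract_add_left B_form_words pb_add)
  next
    case (4 s)
    then obtain v where v: "s = Vect v" "v \<in> vecA" by auto
    show ?case
    proof (rule tensorial_comp[OF saturated_vwords])
      show "additive (\<lambda>x. vb v (pb n x y) - pb n (contract v (B n x)) y)"
        by (simp add: additive_def pb_add vb_add_right contract_add additive.add[OF additive_B] v)
    qed (simp add: f v)
  next
    case (5 s t q a)
    then obtain v where v: "s = Vect v" "v \<in> vecA" by auto
    note z = 5(3) and a = 5(4)
    \<comment> \<open>With z = \<open>t # q\<close>, \<open>vb_ract\<close> contributes -v(da)(z
      \<bullet> y) and \<open>contract_ract_B\<close> contributes (v(da)z) \<bullet> y; they cancel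
      by left linearity in degree \<open>n\<close>.\<close>
    have "f (slot_ract s a # t # q) = vb v (tlact a (pb n (pure (t # q)) y)) - pb n (contract v (B n (pure (word_lact a (t # q))))) y"
      by (simp add: f v vb_ract[OF a v(2) P_in[OF z]] contract_ract_B[OF a v(2) z] pb_diff
          lact'[OF tspan_pure[OF z] vecAD(2)[OF v(2)]] del: word_lact.simps)
    also have "\<dots> = f (s # slot_lact a t # q)"
      using lact[OF z a] by (simp add: f v)
    finally show ?case .
  qed (simp_all add: saturated_vwords)
  have P: "pb (Suc n) (pure w) y = f w" if "w \<in> vwords vecA (Suc n)" for w
    unfolding pow_bullet.simps(2) f_def[symmetric] using that by (simp add: textend_pure[OF t])
  show ?thesis
    unfolding pow_bullet_props_def
  proof (intro conjI allI impI ballI)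
    show "additive (\<lambda>x. pb (Suc n) x y)"
      unfolding pow_bullet.simps(2) f_def[symmetric] by (rule textend_additive[OF t])
  next
    fix V w assume V: "stable V" and yV: "y \<in> tensor_alg V" and w: "w \<in> vwords V (Suc n)"
    then obtain v z where vz: "w = Vect v # z" "v \<in> V" "z \<in> vwords V n"
      by (auto simp: vwords_Suc[OF n] set_Cons_def)
    \<comment> \<open>The contraction is not a word but lies in the span of words of degree
      \<open>n\<close> over \<open>V\<close>, to which the induction hypothesis extends
      additively.\<close>
    have "pb n (contract v (B n (pure z))) y \<in> tensor_alg V"
      unfolding tensor_alg_eq
      by (rule tspan_mapI[OF contract_B_in[OF V stableD(1)[OF V vz(2)] vz(3)] add])
         (rule V_in[OF V yV, unfolded tensor_alg_eq])
    then show "pb (Suc n) (pure w) y \<in> tensor_alg V"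
      using P[OF subsetD[OF vwords_stable[OF V] w]] vz V_in[OF V yV vz(3)]
      by (simp add: f tensor_alg_diff vb_in[OF V])
  next
    fix w :: "'w slot list" and a :: 'w assume w: "w \<in> vwords vecA (Suc n)" and a: "a \<in> Omega 0"
    then obtain v z where vz: "w = Vect v # z" "v \<in> vecA" "z \<in> vwords vecA n"
      by (auto simp: vwords_Suc[OF n] set_Cons_def)
    show "pb (Suc n) (pure (word_lact a w)) y = tlact a (pb (Suc n) (pure w) y)"
      using P[OF w] P[OF word_lact_vwords[OF stable_vecA w a]] vz a
      by (simp add: f vb_lact P_in contract_lact B_form_words lact' contract_B_in[OF stable_vecA]
          additive.diff[OF additive_tlact])
  qed
qed

lemma pow_bullet_props: "y \<in> tensor_alg vecA \<Longrightarrow> pow_bullet_props y n"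
proof (induction n)
  case (Suc n)
  then show ?case using pow_bullet_props_1 pow_bullet_props_Suc by (cases "n = 0") auto
qed (rule pow_bullet_props_0)

section \<open>Closure of the full product\<close>

lemma bullet_in:
  assumes V: "stable V" and x: "x \<in> tensor_alg V" and y: "y \<in> tensor_alg V"
  shows "bullet B x y \<in> tensor_alg V"
proof -
  have y': "y \<in> tensor_alg vecA" by (rule tensor_alg_mono[OF V y])
  have add: "additive (\<lambda>x. pb n x y)"
    and V_in: "w \<in> vwords V n \<Longrightarrow> pb n (pure w) y \<in> tensor_alg V" for n w
    using pow_bullet_props[OF y', of n] V y unfolding pow_bullet_props_def by blast+
  have t: "tensorial (\<Union>n. vwords vecA n) (\<lambda>ws. pb (vdeg ws) (pure ws) y)"
    by (rule tensorial_UN, rule tensorial_comp[OF saturated_vwords add]) (simp add: vdeg_vwords)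
  show ?thesis
  proof (rule tensor_alg_mapI[OF x])
    show "additive (\<lambda>x. bullet B x y)" unfolding bullet_def by (rule textend_additive[OF t])
    fix w n assume w: "w \<in> vwords V n"
    note w' = subsetD[OF vwords_stable[OF V] w]
    have "bullet B (pure w) y = pb n (pure w) y"
      unfolding bullet_def by (subst textend_pure[OF t]) (use w' vdeg_vwords[OF w'] in auto)
    then show "bullet B (pure w) y \<in> tensor_alg V" using V_in[OF w] by simp
  qed
qed

lemma subalgebra_stable:
  assumes "stable V"
  shows "is_subalgebra (bullet B) (tensor_alg V)"
  unfolding is_subalgebra_def
proof (intro conjI ballI allI)
  show "tensor_alg V \<subseteq> tensor_alg vecA" using tensor_alg_mono[OF assms] by blast
  show "pure [Scal 1] \<in> tensor_alg V"
    by (rule tensor_alg_vpow[of _ _ 0], rule tspan_pure) (simp add: vwords_0 Omega_one)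
qed (auto intro: tensor_alg_add tlact_tensor_alg[OF assms] scaleC_one_in bullet_in[OF assms])

end

theorem corollary13p3:
  fixes J :: "'w::star_dga \<Rightarrow> 'w"
    and D :: "'w \<Rightarrow> 'w tensor"
    and \<sigma>inv :: "'w tensor \<Rightarrow> 'w tensor"
    and N :: nat and e :: "nat \<Rightarrow> 'w" and u :: "nat \<Rightarrow> 'w \<Rightarrow> 'w"
  assumes "dual_basis N e u"
    and "almost_complex J"
    and "right_bimod_connection D \<sigma>inv"
    and "\<And>\<xi>. \<xi> \<in> Omega 1 \<Longrightarrow> J_id J (D \<xi>) = D (J \<xi>)"
  shows "is_subalgebra (bullet (box_pow (dual_connection D) (sigma \<sigma>inv N e u))) (tensor_alg (vec10 J))
       \<and> is_subalgebra (bullet (box_pow (dual_connection D) (sigma \<sigma>inv N e u))) (tensor_alg (vec01 J))"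
proof -
  interpret complex_connection N e u D \<sigma>inv J
    by unfold_locales (fact assms)+
  show ?thesis
    unfolding vec10_def vec01_def eigen_vecJ
    \<comment> \<open>The remaining goals say that \<open>\<i>\<close> and \<open>- \<i>\<close>
      square to -1.\<close>
    by (intro conjI subalgebra_stable stable_eigen) simp_all
qed

end
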